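(* Let $N\ge 2$ and let $g:[0,\infty)\to\mathbb{R}$ satisfy conditions (G1)--(G5) listed in the context. Then the problem $$-\Delta u=g(u)\ \text{ in }\mathbb{R}^N,\qquad u(x)\to 0\ \text{ as }|x|\to\infty,$$ has at most one positive radial solution. Moreover, if $u$ is a positive radial solution, then the corresponding linearized operator $\mathcal{L}=\Delta+g'(u)$ does not have $0$ as an eigenvalue in $H^1_{rad}(\mathbb{R}^N)$; that is, the only $\varphi\in H^1_{rad}(\mathbb{R}^N)$ with $\Delta\varphi+g'(u)\varphi=0$ is $\varphi\equiv 0$.
   Context: A positive radial solution is a classical solution $u(x)=u(|x|)>0$, i.e. a solution of $u''+\frac{N-1}{r}u'+g(u)=0$ for $r>0$, with $u'(0)=0$, $u(r)>0$ for $r\ge 0$ and $u(r)\to0$ as $r\to\infty$. $H^1_{rad}(\mathbb{R}^N)$ is the space of radially symmetric functions in $H^1(\mathbb{R}^N)$. The growth function of $g$ is $K_g(s):=\frac{s g'(s)}{g(s)}$ (where $g(s)\neq 0$). The conditions are: - (G1) $g\in C^1[0,\infty)$, $g(0)=0$ and $g'(0)<0$. - (G2) There exist $b>0$ and $\tilde b\in(b,\infty]$ such that $g(s)<0$ on $(0,b)$, $g(s)>0$ on $(b,\tilde b)$ and $g'(b)>0$. If $\tilde b<\infty$, then $g(s)<0$ on $(\tilde b,\infty)$ and $g'(\tilde b)<0$. - (G3) There exists $\zeta>b$ such that $\int_0^\zeta g(s)\,ds>0$. - (G4) $K_g(s)$ is (strictly) decreasing on $(b,\tilde b)$. - (G5)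 $K_g(s)\le 1$ on $(0,b)$. *)

theory Defs
  imports "HOL-Analysis.Analysis"
begin

text \<open>
  A function \<open>g : [0,\<infinity>) \<rightarrow> \<real>\<close> is represented by a total function on the reals; only its values
  on \<open>[0,\<infinity>)\<close> are ever used. Its derivative is carried as a second function \<open>g'\<close>, which
  condition \<open>G1\<close> determines uniquely on \<open>[0,\<infinity>)\<close> (the derivative at \<open>0\<close> being one-sided).
\<close>

definition growth :: "(real \<Rightarrow> real) \<Rightarrow> (real \<Rightarrow> real) \<Rightarrow> real \<Rightarrow> real" where
  "growth g g' s = s * g' s / g s"

definition G1 :: "(real \<Rightarrow> real) \<Rightarrow> (real \<Rightarrow> real) \<Rightarrow> bool" where
  "G1 g g' \<longleftrightarrow>
     (\<forall>s\<ge>0. (g has_real_derivative g' s) (at s within {0..})) \<and>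
     continuous_on {0..} g' \<and> g 0 = 0 \<and> g' 0 < 0"

definition G2 :: "(real \<Rightarrow> real) \<Rightarrow> (real \<Rightarrow> real) \<Rightarrow> real \<Rightarrow> ereal \<Rightarrow> bool" where
  "G2 g g' b bt \<longleftrightarrow>
     0 < b \<and> ereal b < bt \<and>
     (\<forall>s. 0 < s \<and> s < b \<longrightarrow> g s < 0) \<and>
     (\<forall>s. b < s \<and> ereal s < bt \<longrightarrow> 0 < g s) \<and>
     0 < g' b \<and>
     (bt < \<infinity> \<longrightarrow> (\<forall>s. bt < ereal s \<longrightarrow> g s < 0) \<and> g' (real_of_ereal bt) < 0)"

definition G3 :: "(real \<Rightarrow> real) \<Rightarrow> real \<Rightarrow> bool" where
  "G3 g b \<longleftrightarrow> (\<exists>\<zeta>>b. 0 < integral {0..\<zeta>} g)"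

definition G4 :: "(real \<Rightarrow> real) \<Rightarrow> (real \<Rightarrow> real) \<Rightarrow> real \<Rightarrow> ereal \<Rightarrow> bool" where
  "G4 g g' b bt \<longleftrightarrow> strict_antimono_on {s. b < s \<and> ereal s < bt} (growth g g')"

definition G5 :: "(real \<Rightarrow> real) \<Rightarrow> (real \<Rightarrow> real) \<Rightarrow> real \<Rightarrow> bool" where
  "G5 g g' b \<longleftrightarrow> (\<forall>s. 0 < s \<and> s < b \<longrightarrow> growth g g' s \<le> 1)"

definition partial :: "'a \<Rightarrow> ('a::euclidean_space \<Rightarrow> real) \<Rightarrow> 'a \<Rightarrow> real" where
  "partial i f x = frechet_derivative f (at x) i"

text \<open>
  \<open>Ck k f\<close>: \<open>f\<close> is of class \<open>C^k\<close> on the whole space. The differentiability requirement makes every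
  \<open>partial i f\<close> the genuine partial derivative.
\<close>

primrec Ck :: "nat \<Rightarrow> ('a::euclidean_space \<Rightarrow> real) \<Rightarrow> bool" where
  "Ck 0 f \<longleftrightarrow> continuous_on UNIV f"
| "Ck (Suc k) f \<longleftrightarrow> f differentiable_on UNIV \<and> (\<forall>i\<in>Basis. Ck k (partial i f))"

definition laplacian :: "('a::euclidean_space \<Rightarrow> real) \<Rightarrow> 'a \<Rightarrow> real" where
  "laplacian f x = (\<Sum>i\<in>Basis. partial i (partial i f) x)"

text \<open>
  The solution is a function on the whole space; in terms of the profile \<open>U\<close> the equation reads
  \<open>U'' + (N - 1)/r U' + g(U) = 0\<close> for \<open>r > 0\<close> with \<open>U'(0) = 0\<close>.
\<close>

definition positive_radial_solution ::
    "(real \<Rightarrow> real) \<Rightarrow> ('a::euclidean_space \<Rightarrow> real) \<Rightarrow> bool" where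
  "positive_radial_solution g u \<longleftrightarrow>
     Ck 2 u \<and>
     (\<forall>x. - laplacian u x = g (u x)) \<and>
     (u \<longlongrightarrow> 0) at_infinity \<and>
     (\<exists>U. \<forall>x. u x = U (norm x)) \<and>
     (\<forall>x. 0 < u x)"

definition test_function :: "('a::euclidean_space \<Rightarrow> real) \<Rightarrow> bool" where
  "test_function \<psi> \<longleftrightarrow> (\<forall>k. Ck k \<psi>) \<and> compact (closure {x. \<psi> x \<noteq> 0})"

definition L2 :: "('a::euclidean_space \<Rightarrow> real) set" where
  "L2 = {f \<in> borel_measurable lebesgue. integrable lebesgue (\<lambda>x. (f x)\<^sup>2)}"

definition weak_partial ::
    "'a \<Rightarrow> ('a::euclidean_space \<Rightarrow> real) \<Rightarrow> ('a \<Rightarrow> real) \<Rightarrow> bool" where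
  "weak_partial i f h \<longleftrightarrow>
     (\<forall>\<psi>. test_function \<psi> \<longrightarrow>
        (LINT x|lebesgue. f x * partial i \<psi> x) = - (LINT x|lebesgue. h x * \<psi> x))"

text \<open>
  Elements of \<open>H1\<close> are functions, not almost-everywhere classes; accordingly radial symmetry is
  required up to a null set.
\<close>

definition H1 :: "('a::euclidean_space \<Rightarrow> real) set" where
  "H1 = {f \<in> L2. \<forall>i\<in>Basis. \<exists>h\<in>L2. weak_partial i f h}"

definition H1_rad :: "('a::euclidean_space \<Rightarrow> real) set" where
  "H1_rad = {f \<in> H1. \<exists>F. AE x in lebesgue. f x = F (norm x)}"

text \<open>\<open>weak_laplacian f h\<close> says that \<open>\<Delta>f = h\<close> in the sense of distributions.\<close>

definition weak_laplacian :: "('a::euclidean_space \<Rightarrow> real) \<Rightarrow> ('a \<Rightarrow> real) \<Rightarrow> bool" where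
  "weak_laplacian f h \<longleftrightarrow>
     (\<forall>\<psi>. test_function \<psi> \<longrightarrow>
        (LINT x|lebesgue. f x * laplacian \<psi> x) = (LINT x|lebesgue. h x * \<psi> x))"

text \<open>
  \<open>\<phi>\<close> is an \<open>H1_rad\<close> eigenfunction of \<open>\<Delta> + V\<close> for the eigenvalue \<open>\<mu>\<close>, i.e.
  \<open>\<Delta>\<phi> + V\<phi> = \<mu>\<phi>\<close>, except that \<open>\<phi>\<close> may vanish almost everywhere.
\<close>

definition in_eigenspace_rad ::
    "('a::euclidean_space \<Rightarrow> real) \<Rightarrow> real \<Rightarrow> ('a \<Rightarrow> real) \<Rightarrow> bool" where
  "in_eigenspace_rad V \<mu> \<phi> \<longleftrightarrow>
     \<phi> \<in> H1_rad \<and> weak_laplacian \<phi> (\<lambda>x. \<mu> * \<phi> x - V x * \<phi> x)"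

definition eigenvalue_rad :: "('a::euclidean_space \<Rightarrow> real) \<Rightarrow> real \<Rightarrow> bool" where
  "eigenvalue_rad V \<mu> \<longleftrightarrow>
     (\<exists>\<phi>. in_eigenspace_rad V \<mu> \<phi> \<and> \<not> (AE x in lebesgue. \<phi> x = 0))"

end

theory Submission
  imports Defs "HOL-Computational_Algebra.Polynomial"
begin

text \<open>
  Write \<open>k = N - 1\<close> and let \<open>U\<close> be the profile of a positive radial solution. The Pohozaev function is
  positive because \<open>N G - (N - 2)/2 s g\<close> changes sign at most once on the range of \<open>U\<close>; together with
  (G5) and the monotonicity of the growth function this makes \<open>\<theta> = - r U'/U\<close> strictly increasing.
  For \<open>\<beta> \<ge> 0\<close> the function \<open>v = r U' + \<beta> U\<close> satisfies \<open>(\<Delta> + g'(U)) v = g(U) (\<beta> (K_g(U) - 1) - 2)\<close>,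
  and by (G4) and (G5) the right-hand side changes sign at most once, from negative to positive as \<open>r\<close>
  grows. If a solution \<open>w\<close> of the linearized equation vanishes at \<open>r1\<close>, take \<open>\<beta> = \<theta>(r1)\<close>, so that \<open>v\<close>
  is positive before \<open>r1\<close> and negative after it; Sturm comparison of \<open>w\<close> with \<open>v\<close>, on the left or on
  the right of \<open>r1\<close> according to the sign of \<open>(\<Delta> + g'(U)) v\<close> there, excludes a further zero and also
  polynomial growth of \<open>w\<close>. Comparison with \<open>U'\<close> excludes a \<open>w\<close> without zeros that is bounded by a
  power of \<open>r\<close>. This is nondegeneracy.

  It also shows that the derivative of the shooting solution with respect to its initial height is
  negative and decreasing near infinity. Hence the heights just above that of a ground state
  lead to solutions that cross zero, and those just below lead to solutions whose energy becomes
  negative. Both kinds of heights form open sets, so two ground states cannot coexist.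
\<close>

section \<open>Radial equations and decay\<close>

text \<open>The eigenfunction is given only as a distributional solution in H^1, whereas Sturm
  comparison needs a classical one. Regularity theory is bypassed: tested against radial functions
  of |x|^2, the equation becomes an ordinary differential equation for the integrals of \<phi> over
  balls. This yields only weak boundary information, namely polynomial growth at infinity and
  vanishing weighted traces at the origin; it suffices because U, U' and v decay exponentially, so
  that the Wronskian boundary terms vanish. The choice \<beta> = \<theta>(r1) makes v and w vanish
  together at r1, so their Wronskian is zero there, and a source with at most one sign change has a
  fixed sign on at least one full side of r1. On the left the origin serves as second boundary point
  and the comparison always ends in a contradiction; hence at every zero of w the source is
  nonnegative, and the comparison to the right applies. (G4) gives monotonicity of K_g but no
  derivative of it, so all sign patterns are stated by comparing two heights.\<close>

lemma first_zero:
  fixes f :: "real \<Rightarrow> real"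
  assumes "a \<le> c" "continuous_on {a..c} f" "f a < 0" "f c \<ge> 0"
  obtains z where "a < z" "z \<le> c" "f z = 0" "\<And>x. a \<le> x \<Longrightarrow> x < z \<Longrightarrow> f x < 0"
proof -
  define S where "S = {x \<in> {a..c}. f x \<ge> 0}"
  have "closed S" unfolding S_def
    using continuous_on_closed_Collect_le[of "{a..c}" "\<lambda>_. 0" f] assms(2) by auto
  moreover have "S \<noteq> {}" "bdd_below S" using assms unfolding S_def by (auto intro!: bdd_belowI[of _ a])
  ultimately have zS: "Inf S \<in> S" using closed_contains_Inf by blast
  let ?z = "Inf S"
  have z: "a \<le> ?z" "?z \<le> c" "f ?z \<ge> 0" using zS unfolding S_def by auto
  have lt: "f x < 0" if "a \<le> x" "x < ?z" for x
  proof (rule ccontr)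
    assume "\<not> f x < 0"
    then have "x \<in> S" using that z unfolding S_def by auto
    then show False using cInf_lower[of x S] \<open>bdd_below S\<close> that by auto
  qed
  have "f ?z \<le> 0"
  proof (rule ccontr)
    assume "\<not> f ?z \<le> 0"
    then obtain y where "a \<le> y" "y \<le> ?z" "f y = 0"
      using IVT'[of f a 0 ?z] assms z continuous_on_subset[OF assms(2), of "{a..?z}"] by force
    then show False using lt[of y] \<open>\<not> f ?z \<le> 0\<close> by (cases "y = ?z") auto
  qed
  then show thesis using that[of ?z] z lt assms(3) by (metis order_antisym order_le_less less_irrefl)
qed

text \<open>Monotonicity of \<open>B - f\<close> and of \<open>B + f\<close>. Derivatives are
  demanded only in the open interval, because the radial equations are differentiated for r > 0
  only.\<close>

lemma deriv_bound_compare: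
  fixes f B :: "real \<Rightarrow> real"
  assumes "a \<le> c" "continuous_on {a..c} f" "continuous_on {a..c} B"
    "\<And>x. a < x \<Longrightarrow> x < c \<Longrightarrow> (f has_real_derivative f' x) (at x)"
    "\<And>x. a < x \<Longrightarrow> x < c \<Longrightarrow> (B has_real_derivative B' x) (at x)"
    "\<And>x. a < x \<Longrightarrow> x < c \<Longrightarrow> \<bar>f' x\<bar> \<le> B' x"
  shows "\<bar>f c - f a\<bar> \<le> B c - B a"
proof -
  have "(\<lambda>x. B x - f x) a \<le> (\<lambda>x. B x - f x) c"
  proof (rule DERIV_nonneg_imp_increasing_open[OF assms(1)])
    fix x assume x: "a < x" "x < c"
    show "\<exists>y. ((\<lambda>x. B x - f x) has_real_derivative y) (at x) \<and> 0 \<le> y"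
      using assms(4-6)[OF x] by (intro exI[of _ "B' x - f' x"]) (auto intro!: derivative_intros)
  qed (intro continuous_intros assms)
  moreover have "(\<lambda>x. B x + f x) a \<le> (\<lambda>x. B x + f x) c"
  proof (rule DERIV_nonneg_imp_increasing_open[OF assms(1)])
    fix x assume x: "a < x" "x < c"
    show "\<exists>y. ((\<lambda>x. B x + f x) has_real_derivative y) (at x) \<and> 0 \<le> y"
      using assms(4-6)[OF x] by (intro exI[of _ "B' x + f' x"]) (auto intro!: derivative_intros)
  qed (intro continuous_intros assms)
  ultimately show ?thesis by auto
qed

section \<open>Decay and growth classes at infinity\<close>

definition rapid :: "(real \<Rightarrow> real) \<Rightarrow> bool" where
  "rapid f \<longleftrightarrow> (\<forall>n::nat. ((\<lambda>r. r ^ n * f r) \<longlongrightarrow> 0) at_top)"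

text \<open>Eigenfunctions are only known to grow at most like a power, while the comparison
  functions built from U are \<open>rapid\<close>; the product of the two classes is
  \<open>rapid\<close>, and so the Wronskians vanish at infinity.\<close>

definition tempered :: "(real \<Rightarrow> real) \<Rightarrow> bool" where
  "tempered f \<longleftrightarrow> (\<exists>C n. \<forall>\<^sub>F r in at_top. \<bar>f r\<bar> \<le> C * r ^ n)"

lemma rapid_add: "rapid f \<Longrightarrow> rapid h \<Longrightarrow> rapid (\<lambda>r. f r + h r)"
  unfolding rapid_def by (auto simp: distrib_left intro!: tendsto_add_zero)

lemma rapid_tempered_mult:
  assumes "rapid f" "tempered h" shows "rapid (\<lambda>r. h r * f r)"
  unfolding rapid_def
proof
  fix n
  obtain C m where ev: "\<forall>\<^sub>F r in at_top. \<bar>h r\<bar> \<le> C * r ^ m" using assms(2) unfolding tempered_def by auto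
  have "((\<lambda>r. r ^ (n + m) * f r) \<longlongrightarrow> 0) at_top" using assms(1) unfolding rapid_def by auto
  then have "((\<lambda>r. C * \<bar>r ^ (n + m) * f r\<bar>) \<longlongrightarrow> 0) at_top"
    by (intro tendsto_mult_right_zero tendsto_rabs_zero)
  then show "((\<lambda>r. r ^ n * (h r * f r)) \<longlongrightarrow> 0) at_top"
  proof (rule Lim_null_comparison[rotated])
    show "\<forall>\<^sub>F r in at_top. norm (r ^ n * (h r * f r)) \<le> C * \<bar>r ^ (n + m) * f r\<bar>"
      using ev eventually_ge_at_top[of 0]
    proof eventually_elim
      case (elim r)
      have "\<bar>h r\<bar> * (r ^ n * \<bar>f r\<bar>) \<le> (C * r ^ m) * (r ^ n * \<bar>f r\<bar>)"
        using elim by (intro mult_right_mono) auto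
      then show ?case using elim by (simp add: abs_mult power_add mult_ac)
    qed
  qed
qed

lemma rapid_tendsto: "rapid f \<Longrightarrow> (f \<longlongrightarrow> 0) at_top"
  unfolding rapid_def by (drule spec[of _ 0]) simp

lemma tempered_power: "tempered (\<lambda>r. r ^ n)"
  unfolding tempered_def
  by (intro exI[of _ 1] exI[of _ n] eventually_mono[OF eventually_ge_at_top[of 0]]) auto

lemma temperedI: "(\<And>r. r \<ge> R \<Longrightarrow> \<bar>f r\<bar> \<le> C * r ^ n) \<Longrightarrow> tempered f"
  unfolding tempered_def
  by (intro exI[of _ C] exI[of _ n] eventually_mono[OF eventually_ge_at_top[of R]]) auto

lemma tempered_const: "tempered (\<lambda>r. c)"
  by (rule temperedI[of 0 _ "\<bar>c\<bar>" 0]) auto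

lemma tempered_mult: assumes "tempered f" "tempered h" shows "tempered (\<lambda>r. f r * h r)"
proof -
  obtain C m where 1: "\<forall>\<^sub>F r in at_top. \<bar>f r\<bar> \<le> C * r ^ m" using assms(1) unfolding tempered_def by auto
  obtain D n where 2: "\<forall>\<^sub>F r in at_top. \<bar>h r\<bar> \<le> D * r ^ n" using assms(2) unfolding tempered_def by auto
  have "\<forall>\<^sub>F r in at_top. \<bar>f r * h r\<bar> \<le> (C * D) * r ^ (m + n)"
    using 1 2
  proof eventually_elim
    case (elim r)
    have "\<bar>f r\<bar> * \<bar>h r\<bar> \<le> (C * r ^ m) * (D * r ^ n)"
      using elim by (intro mult_mono) auto
    then show ?case by (simp add: abs_mult power_add mult_ac)
  qed
  then show ?thesis unfolding tempered_def by blast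
qed

lemma rapid_cmult: "rapid f \<Longrightarrow> rapid (\<lambda>r. c * f r)"
  by (rule rapid_tempered_mult[OF _ tempered_const])

lemma rapid_expI:
  assumes "c > 0" "\<And>r. r \<ge> R \<Longrightarrow> \<bar>f r\<bar> \<le> C * exp (- c * r)"
  shows "rapid f"
  unfolding rapid_def
proof
  fix n
  have "((\<lambda>r. (c * r) ^ n / exp (c * r)) \<longlongrightarrow> 0) at_top"
    by (rule filterlim_compose[OF tendsto_power_div_exp_0[of n]])
       (use assms(1) in \<open>auto intro!: filterlim_tendsto_pos_mult_at_top filterlim_ident\<close>)
  then have "((\<lambda>r. (C / c ^ n) * ((c * r) ^ n / exp (c * r))) \<longlongrightarrow> 0) at_top"
    by (intro tendsto_mult_right_zero)
  then show "((\<lambda>r. r ^ n * f r) \<longlongrightarrow> 0) at_top"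
  proof (rule Lim_null_comparison[rotated])
    show "\<forall>\<^sub>F r in at_top. norm (r ^ n * f r) \<le> (C / c ^ n) * ((c * r) ^ n / exp (c * r))"
      using eventually_ge_at_top[of R] eventually_ge_at_top[of 0]
    proof eventually_elim
      case (elim r)
      have "r ^ n * \<bar>f r\<bar> \<le> r ^ n * (C * exp (- c * r))"
        using elim assms(2)[of r] by (intro mult_left_mono) auto
      also have "\<dots> = (C / c ^ n) * ((c * r) ^ n / exp (c * r))"
        using assms(1) by (simp add: power_mult_distrib exp_minus field_simps)
      finally show ?case using elim by (simp add: abs_mult)
    qed
  qed
qed

text \<open>\<open>rad_ode k u p h\<close>: \<open>u'' + (k/r) u' + h = 0\<close> in divergence form, with \<open>p = u'\<close> and \<open>u'(0) = 0\<close>.\<close>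

definition rad_ode :: "nat \<Rightarrow> (real \<Rightarrow> real) \<Rightarrow> (real \<Rightarrow> real) \<Rightarrow> (real \<Rightarrow> real) \<Rightarrow> bool" where
  "rad_ode k u p h \<longleftrightarrow> continuous_on {0..} u \<and> continuous_on {0..} p \<and> p 0 = 0 \<and>
     (\<forall>r>0. (u has_real_derivative p r) (at r)) \<and>
     (\<forall>r>0. ((\<lambda>r. r ^ k * p r) has_real_derivative - (r ^ k * h r)) (at r))"

lemma weighted_deriv:
  fixes p :: "real \<Rightarrow> real"
  assumes "r > 0" "((\<lambda>r. r ^ k * p r) has_real_derivative - (r ^ k * h)) (at r)"
  shows "(p has_real_derivative - (real k / r) * p r - h) (at r)"
proof -
  have "((\<lambda>r. (r ^ k * p r) / r ^ k) has_real_derivative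
      ((- (r ^ k * h)) * r ^ k - (r ^ k * p r) * (real k * r ^ (k - 1))) / (r ^ k * r ^ k)) (at r)"
    by (rule DERIV_divide[OF assms(2)]) (use assms(1) in \<open>auto intro!: derivative_eq_intros\<close>)
  also have "((- (r ^ k * h)) * r ^ k - (r ^ k * p r) * (real k * r ^ (k - 1))) / (r ^ k * r ^ k)
      = - (real k / r) * p r - h"
    using assms(1) by (cases k) (auto simp: field_simps)
  finally show ?thesis
    by (rule has_field_derivative_transform_within_open[where S = "{0<..}"]) (use assms(1) in auto)
qed

lemma rad_ode_p_deriv:
  assumes "rad_ode k u p h" "r > 0"
  shows "(p has_real_derivative - (real k / r) * p r - h r) (at r)"
  using assms weighted_deriv unfolding rad_ode_def by auto

lemma rad_ode_diff:
  assumes "rad_ode k u p h" "rad_ode k v q f"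
  shows "rad_ode k (\<lambda>r. u r - c * v r) (\<lambda>r. p r - c * q r) (\<lambda>r. h r - c * f r)"
proof -
  have "((\<lambda>r. r ^ k * (p r - c * q r)) has_real_derivative - (r ^ k * (h r - c * f r))) (at r)"
    if "r > 0" for r
  proof -
    have "((\<lambda>r. r ^ k * p r - c * (r ^ k * q r)) has_real_derivative
       (- (r ^ k * h r) - c * (- (r ^ k * f r)))) (at r)"
      using assms that unfolding rad_ode_def by (intro DERIV_diff DERIV_cmult) auto
    then show ?thesis by (simp add: algebra_simps)
  qed
  then show ?thesis using assms unfolding rad_ode_def
    by (auto intro!: continuous_intros DERIV_diff DERIV_cmult)
qed

text \<open>L'Hopital's rule for \<open>r ^ k * p r\<close> against \<open>r ^ Suc k\<close>. The
  limit plays the role of u''(0): at the origin the equation reads (k + 1) u''(0) = - h(0).\<close>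

lemma rad_slope:
  assumes "rad_ode k u p h" "(h \<longlongrightarrow> h0) (at_right 0)"
  shows "((\<lambda>r. p r / r) \<longlongrightarrow> - h0 / (real k + 1)) (at_right 0)"
proof -
  have pos: "\<forall>\<^sub>F r in at_right 0. r > (0::real)" by (simp add: eventually_at_right_less)
  have p0: "(p \<longlongrightarrow> 0) (at_right 0)"
    using assms(1) unfolding rad_ode_def continuous_on
    by (metis atLeast_iff order_refl at_within_Ici_at_right)
  have "((\<lambda>r. (r ^ k * p r) / r ^ Suc k) \<longlongrightarrow> - h0 / (real k + 1)) (at_right 0)"
  proof (rule lhopital_right_0)
    show "((\<lambda>r. r ^ k * p r) \<longlongrightarrow> 0) (at_right 0)"
      using p0 by (auto intro!: tendsto_eq_intros)
    show "((\<lambda>r. r ^ Suc k) \<longlongrightarrow> (0::real)) (at_right 0)" by (auto intro!: tendsto_eq_intros)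
    show "\<forall>\<^sub>F r in at_right 0. r ^ Suc k \<noteq> (0::real)" using pos by eventually_elim auto
    show "\<forall>\<^sub>F r in at_right 0. (real k + 1) * r ^ k \<noteq> 0" using pos by eventually_elim auto
    show "\<forall>\<^sub>F r in at_right 0. ((\<lambda>r. r ^ k * p r) has_real_derivative - (r ^ k * h r)) (at r)"
      using pos by eventually_elim (use assms in \<open>auto simp: rad_ode_def\<close>)
    show "\<forall>\<^sub>F r in at_right 0. ((\<lambda>r. r ^ Suc k) has_real_derivative (real k + 1) * r ^ k) (at r)"
      by (intro always_eventually allI) (rule derivative_eq_intros refl | simp)+
    have "((\<lambda>r. - h r / (real k + 1)) \<longlongrightarrow> - h0 / (real k + 1)) (at_right 0)"
      using assms(2) by (auto intro!: tendsto_eq_intros)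
    then show "((\<lambda>r. - (r ^ k * h r) / ((real k + 1) * r ^ k)) \<longlongrightarrow> - h0 / (real k + 1)) (at_right 0)"
      by (rule Lim_transform_eventually) (use pos in eventually_elim, auto)
  qed
  then show ?thesis
    by (rule Lim_transform_eventually) (use pos in eventually_elim, auto simp: field_simps)
qed

text \<open>By \<open>rad_slope\<close>, p is negative near 0. At its first later zero z, u has
  dropped below its initial value, so \<open>crit\<close> gives h z > 0; then r^k p decreases
  strictly through z and was positive just before, a contradiction. Energy arguments supply
  \<open>crit\<close>, both for ground states and for shooting solutions.\<close>

lemma rad_ode_descends:
  assumes ode: "rad_ode k u p h" and h: "continuous_on {0..} h" "0 < h 0" and s: "0 < s"
    and crit: "\<And>z. 0 < z \<Longrightarrow> z \<le> s \<Longrightarrow> p z = 0 \<Longrightarrow> u z < u 0 \<Longrightarrow> 0 < h z"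
  shows "p s < 0"
proof (rule ccontr)
  assume n: "\<not> p s < 0"
  have uc: "continuous_on {0..} u" and pc: "continuous_on {0..} p"
    and ud: "\<And>r. 0 < r \<Longrightarrow> (u has_real_derivative p r) (at r)"
    and kpd: "\<And>r. 0 < r \<Longrightarrow> ((\<lambda>r. r ^ k * p r) has_real_derivative - (r ^ k * h r)) (at r)"
    using ode unfolding rad_ode_def by auto
  have "(h \<longlongrightarrow> h 0) (at_right 0)"
    using h(1) unfolding continuous_on by (metis atLeast_iff order_refl at_within_Ici_at_right)
  then have "\<forall>\<^sub>F r in at_right 0. p r / r < 0"
    by (rule order_tendstoD(2)[OF rad_slope[OF ode]]) (use h(2) in \<open>simp add: divide_neg_pos\<close>)
  then obtain e where e: "0 < e" "\<And>x. 0 < x \<Longrightarrow> x < e \<Longrightarrow> p x / x < 0"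
    unfolding eventually_at_right_field by auto
  have e': "p x < 0" if "0 < x" "x < e" for x using e(2)[OF that] that by (simp add: divide_less_0_iff)
  define a where "a = min (e / 2) (s / 2)"
  have a: "0 < a" "a < e" "a < s" using e s unfolding a_def by auto
  obtain z where z: "a < z" "z \<le> s" "p z = 0" "\<And>x. a \<le> x \<Longrightarrow> x < z \<Longrightarrow> p x < 0"
    by (rule first_zero[of a s p]) (use a e' n in \<open>auto intro: continuous_on_subset[OF pc]\<close>)
  have neg: "p x < 0" if "0 < x" "x < z" for x using z(4)[of x] e'[of x] that a by force
  have "u z < u 0"
  proof (rule DERIV_neg_imp_decreasing_open[of 0 z])
    fix x assume "0 < x" "x < z"
    then show "\<exists>y. (u has_real_derivative y) (at x) \<and> y < 0" using ud[of x] neg[of x] by auto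
  qed (use z a in \<open>auto intro: continuous_on_subset[OF uc]\<close>)
  then have "0 < h z" using crit[of z] z a by simp
  then have "- (z ^ k * h z) < 0" using z a by simp
  then obtain h0 where h0: "0 < h0" "\<And>h. 0 < h \<Longrightarrow> h < h0 \<Longrightarrow> z ^ k * p z < (z - h) ^ k * p (z - h)"
    using DERIV_neg_dec_left[OF kpd[of z]] z a by auto
  define t where "t = min (h0 / 2) (z / 2)"
  have t: "0 < t" "t < h0" "t < z" using h0 z a unfolding t_def by auto
  then have "0 < (z - t) ^ k * p (z - t)" using h0(2)[of t] z(3) by simp
  then show False using neg[of "z - t"] t by (simp add: zero_less_mult_iff)
qed

definition gw_const :: "real \<Rightarrow> real \<Rightarrow> real" where
  "gw_const L R = 2 * exp ((2 * L + 1) * R) * (1 + R\<^sup>2) + R"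

text \<open>Let S be the maximum of |e| weighted by exp(- \<kappa> x). With \<kappa> = 2 L + 1 the
  integrations return S with a factor at most 1/2, so that it can be absorbed. Integrating r^k p
  instead of p removes the singular term k p / r.\<close>

lemma rad_gronwall:
  assumes ode: "rad_ode k e p h" and "0 \<le> L" "0 \<le> \<mu>" "0 \<le> R"
    and h: "\<And>r. 0 < r \<Longrightarrow> r \<le> R \<Longrightarrow> \<bar>h r\<bar> \<le> L * \<bar>e r\<bar> + \<mu>"
    and r: "0 \<le> r" "r \<le> R"
  shows "\<bar>e r\<bar> \<le> gw_const L R * (\<bar>e 0\<bar> + \<mu>)" "\<bar>p r\<bar> \<le> gw_const L R * (\<bar>e 0\<bar> + \<mu>)"
proof -
  define \<kappa> where "\<kappa> = 2 * L + 1"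
  have \<kappa>: "\<kappa> \<ge> 1" "2 * L \<le> \<kappa>" using assms(2) unfolding \<kappa>_def by auto
  have ce: "continuous_on {0..} e" "continuous_on {0..} p" "p 0 = 0" using ode unfolding rad_ode_def by auto
  have "continuous_on {0..R} (\<lambda>x. \<bar>e x\<bar> * exp (- \<kappa> * x))"
    by (intro continuous_intros continuous_on_subset[OF ce(1)]) auto
  then obtain x0 where x0: "x0 \<in> {0..R}" "\<And>x. x \<in> {0..R} \<Longrightarrow>
      \<bar>e x\<bar> * exp (- \<kappa> * x) \<le> \<bar>e x0\<bar> * exp (- \<kappa> * x0)"
    using continuous_attains_sup[of "{0..R}" "\<lambda>x. \<bar>e x\<bar> * exp (- \<kappa> * x)"] assms(4) by auto
  define S where "S = \<bar>e x0\<bar> * exp (- \<kappa> * x0)"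
  have S0: "S \<ge> 0" unfolding S_def by auto
  have eS: "\<bar>e x\<bar> \<le> S * exp (\<kappa> * x)" if "x \<in> {0..R}" for x
    using x0(2)[OF that] unfolding S_def[symmetric] by (simp add: exp_minus field_simps)
  \<comment> \<open>Candidate bound for |p|. As (r^k B)' >= r^k B', it is enough that B' dominates
    |h|, which is where L S <= \<kappa> S / 2 enters.\<close>
  define B where "B x = S / 2 * exp (\<kappa> * x) + \<mu> * x" for x
  have LS: "L * S \<le> \<kappa> * S / 2" using \<kappa> S0 mult_right_mono[of "2 * L" \<kappa> S] by auto
  have pB: "\<bar>p x\<bar> \<le> B x" if x: "x \<in> {0..R}" for x
  proof (cases "x = 0")
    case True then show ?thesis using ce S0 unfolding B_def by auto
  next
    case False
    have "\<bar>x ^ k * p x - 0 ^ k * p 0\<bar> \<le> x ^ k * B x - 0 ^ k * B 0"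
    proof (rule deriv_bound_compare[where f = "\<lambda>y. y ^ k * p y" and B = "\<lambda>y. y ^ k * B y"])
      show "0 \<le> x" using x by auto
      show "continuous_on {0..x} (\<lambda>y. y ^ k * p y)"
        by (intro continuous_intros continuous_on_subset[OF ce(2)]) auto
      show "continuous_on {0..x} (\<lambda>y. y ^ k * B y)" unfolding B_def by (intro continuous_intros)
      fix y assume y: "0 < y" "y < x"
      show "((\<lambda>y. y ^ k * p y) has_real_derivative - (y ^ k * h y)) (at y)"
        using ode y unfolding rad_ode_def by auto
      show "((\<lambda>y. y ^ k * B y) has_real_derivative
          (real k * y ^ (k - 1)) * B y + y ^ k * (\<kappa> * S / 2 * exp (\<kappa> * y) + \<mu>)) (at y)"
        unfolding B_def by (auto intro!: derivative_eq_intros simp: algebra_simps)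
      have "\<bar>h y\<bar> \<le> L * \<bar>e y\<bar> + \<mu>" using h[of y] y x by auto
      also have "\<dots> \<le> L * (S * exp (\<kappa> * y)) + \<mu>"
        using eS[of y] y x assms(2) by (auto intro!: mult_left_mono)
      also have "\<dots> \<le> \<kappa> * S / 2 * exp (\<kappa> * y) + \<mu>"
        using mult_right_mono[OF LS, of "exp (\<kappa> * y)"] by (simp add: mult_ac)
      finally have 1: "\<bar>h y\<bar> \<le> \<kappa> * S / 2 * exp (\<kappa> * y) + \<mu>" .
      have 2: "0 \<le> (real k * y ^ (k - 1)) * B y" unfolding B_def using y S0 assms(3) by auto
      show "\<bar>- (y ^ k * h y)\<bar> \<le> (real k * y ^ (k - 1)) * B y + y ^ k * (\<kappa> * S / 2 * exp (\<kappa> * y) + \<mu>)"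
        using mult_left_mono[OF 1, of "y ^ k"] 2 y zero_less_power[OF y(1), of k]
        unfolding abs_minus_cancel abs_mult by linarith
    qed
    moreover have "0 \<le> 0 ^ k * B 0" unfolding B_def using S0 by (cases k) auto
    moreover have xk: "0 < x ^ k" using False x by simp
    moreover have "\<bar>x ^ k * p x - 0 ^ k * p 0\<bar> = x ^ k * \<bar>p x\<bar>"
      using ce(3) xk by (simp add: abs_mult del: zero_less_power_eq)
    ultimately have "x ^ k * \<bar>p x\<bar> \<le> x ^ k * B x" by linarith
    then show ?thesis using \<open>0 < x ^ k\<close> by simp
  qed
  have eb: "\<bar>e x\<bar> \<le> \<bar>e 0\<bar> + S / 2 * exp (\<kappa> * x) + \<mu> * R\<^sup>2" if x: "x \<in> {0..R}" for x
  proof -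
    have "\<bar>e x - e 0\<bar> \<le> (S / (2 * \<kappa>) * exp (\<kappa> * x) + \<mu> * x\<^sup>2 / 2) - (S / (2 * \<kappa>) * exp (\<kappa> * 0) + \<mu> * 0\<^sup>2 / 2)"
    proof (rule deriv_bound_compare[where B = "\<lambda>x. S / (2 * \<kappa>) * exp (\<kappa> * x) + \<mu> * x\<^sup>2 / 2"])
      show "0 \<le> x" using x by auto
      show "continuous_on {0..x} e" using ce(1) by (rule continuous_on_subset) auto
      show "continuous_on {0..x} (\<lambda>x. S / (2 * \<kappa>) * exp (\<kappa> * x) + \<mu> * x\<^sup>2 / 2)" by (intro continuous_intros) auto
      fix y assume y: "0 < y" "y < x"
      show "(e has_real_derivative p y) (at y)" using ode y unfolding rad_ode_def by auto
      show "((\<lambda>x. S / (2 * \<kappa>) * exp (\<kappa> * x) + \<mu> * x\<^sup>2 / 2) has_real_derivative B y) (at y)"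
        unfolding B_def using \<kappa>(1) by (auto intro!: derivative_eq_intros simp: field_simps)
      show "\<bar>p y\<bar> \<le> B y" using pB[of y] x y by auto
    qed
    moreover have "S / (2 * \<kappa>) * exp (\<kappa> * x) \<le> S / 2 * exp (\<kappa> * x)"
      using \<kappa> S0 by (intro mult_right_mono) (auto simp: field_simps mult_le_cancel_left1)
    moreover have "\<mu> * x\<^sup>2 / 2 \<le> \<mu> * R\<^sup>2"
    proof -
      have "x\<^sup>2 / 2 \<le> R\<^sup>2" using power_mono[of x R 2] x zero_le_power2[of R] by (simp, linarith)
      from mult_left_mono[OF this assms(3)] show ?thesis by simp
    qed
    moreover have "0 \<le> S / (2 * \<kappa>)" using S0 \<kappa> by auto
    ultimately show ?thesis by auto
  qed
  have "S \<le> \<bar>e 0\<bar> + S / 2 + \<mu> * R\<^sup>2"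
  proof -
    have "S \<le> (\<bar>e 0\<bar> + S / 2 * exp (\<kappa> * x0) + \<mu> * R\<^sup>2) * exp (- \<kappa> * x0)"
      unfolding S_def using eb[OF x0(1)] unfolding S_def by (intro mult_right_mono) auto
    also have "\<dots> = (\<bar>e 0\<bar> + \<mu> * R\<^sup>2) * exp (- \<kappa> * x0) + S / 2" by (simp add: algebra_simps exp_minus)
    also have "(\<bar>e 0\<bar> + \<mu> * R\<^sup>2) * exp (- \<kappa> * x0) \<le> (\<bar>e 0\<bar> + \<mu> * R\<^sup>2) * 1"
      using x0(1) \<kappa> assms(3) by (intro mult_left_mono) (auto simp: mult_nonneg_nonneg)
    finally show ?thesis by simp
  qed
  then have S1: "S \<le> 2 * (\<bar>e 0\<bar> + \<mu> * R\<^sup>2)" by simp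
  also have "\<dots> \<le> 2 * ((1 + R\<^sup>2) * (\<bar>e 0\<bar> + \<mu>))" using assms(3) by (simp add: algebra_simps)
  finally have S2: "S \<le> 2 * (1 + R\<^sup>2) * (\<bar>e 0\<bar> + \<mu>)" by (simp only: mult.assoc)
  have ex: "exp (\<kappa> * r) \<le> exp (\<kappa> * R)" using r \<kappa> by (auto intro!: mult_left_mono)
  have Se: "S * exp (\<kappa> * r) \<le> (2 * (1 + R\<^sup>2) * (\<bar>e 0\<bar> + \<mu>)) * exp (\<kappa> * R)"
    using S2 ex assms(3) by (intro mult_mono) auto
  have g: "gw_const L R * (\<bar>e 0\<bar> + \<mu>) = (2 * (1 + R\<^sup>2) * (\<bar>e 0\<bar> + \<mu>)) * exp (\<kappa> * R) + R * (\<bar>e 0\<bar> + \<mu>)"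
    unfolding gw_const_def \<kappa>_def by (simp add: algebra_simps)
  have R: "0 \<le> R * (\<bar>e 0\<bar> + \<mu>)" "\<mu> * r \<le> R * (\<bar>e 0\<bar> + \<mu>)"
    using assms(3,4) r mult_mono[of \<mu> "\<bar>e 0\<bar> + \<mu>" r R] by (auto simp: mult_ac)
  show "\<bar>e r\<bar> \<le> gw_const L R * (\<bar>e 0\<bar> + \<mu>)"
    using eS[of r] r Se R(1) unfolding g by auto
  have "0 \<le> S * exp (\<kappa> * r)" using S0 by auto
  then show "\<bar>p r\<bar> \<le> gw_const L R * (\<bar>e 0\<bar> + \<mu>)"
    using pB[of r] r Se R(2) unfolding g B_def by auto
qed

text \<open>To the right of the zero, Z exp(- C x) is nonincreasing; to the left of it, Z exp(C x)
  is nondecreasing. Either way Z is squeezed between 0 and 0.\<close>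

lemma gronwall_zero:
  fixes Z :: "real \<Rightarrow> real"
  assumes der: "\<And>x. a \<le> x \<Longrightarrow> x \<le> c \<Longrightarrow> (Z has_real_derivative Z' x) (at x)"
    and bd: "\<And>x. a \<le> x \<Longrightarrow> x \<le> c \<Longrightarrow> \<bar>Z' x\<bar> \<le> C * Z x"
    and nn: "\<And>x. a \<le> x \<Longrightarrow> x \<le> c \<Longrightarrow> 0 \<le> Z x"
    and "a \<le> z" "z \<le> c" "Z z = 0" "a \<le> x" "x \<le> c"
  shows "Z x = 0"
proof (cases "z \<le> x")
  case True
  have "Z x * exp (- C * x) \<le> Z z * exp (- C * z)"
  proof (rule DERIV_nonpos_imp_nonincreasing[OF True])
    fix y assume y: "z \<le> y" "y \<le> x"
    have "((\<lambda>y. Z y * exp (- C * y)) has_real_derivative (Z' y - C * Z y) * exp (- C * y)) (at y)"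
      by (rule derivative_eq_intros der refl | use y assms in \<open>simp add: algebra_simps\<close>)+
    moreover have "(Z' y - C * Z y) * exp (- C * y) \<le> 0"
      using bd[of y] y assms(4,8) abs_le_D1[of "Z' y" "C * Z y"] by (intro mult_nonpos_nonneg) auto
    ultimately show "\<exists>y'. ((\<lambda>y. Z y * exp (- C * y)) has_real_derivative y') (at y) \<and> y' \<le> 0" by blast
  qed
  then have "Z x \<le> 0" using assms(6) by (simp add: mult_le_0_iff)
  then show ?thesis using nn[of x] assms(7,8) by simp
next
  case False
  have "Z x * exp (C * x) \<le> Z z * exp (C * z)"
  proof (rule DERIV_nonneg_imp_nondecreasing[of x z])
    show "x \<le> z" using False by simp
    fix y assume y: "x \<le> y" "y \<le> z"
    have "((\<lambda>y. Z y * exp (C * y)) has_real_derivative (Z' y + C * Z y) * exp (C * y)) (at y)"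
      by (rule derivative_eq_intros der refl | use y assms in \<open>simp add: algebra_simps\<close>)+
    moreover have "0 \<le> (Z' y + C * Z y) * exp (C * y)"
      using bd[of y] y assms(5,7) abs_le_D2[of "Z' y" "C * Z y"] by (intro mult_nonneg_nonneg) auto
    ultimately show "\<exists>y'. ((\<lambda>y. Z y * exp (C * y)) has_real_derivative y') (at y) \<and> 0 \<le> y'" by blast
  qed
  then have "Z x \<le> 0" using assms(6) by (simp add: mult_le_0_iff)
  then show ?thesis using nn[of x] assms(7,8) by simp
qed

section \<open>The nonlinearity\<close>

locale nonlinearity =
  fixes g g' :: "real \<Rightarrow> real" and b :: real and bt :: ereal
  assumes G1: "G1 g g'" and G2: "G2 g g' b bt" and G4: "G4 g g' b bt" and G5: "G5 g g' b"
begin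

definition G where "G s = integral {0..s} g"
text \<open>\<open>(\<Delta> + g'(U)) U = j(U)\<close> and \<open>(\<Delta> + g'(U)) (r U' + \<beta> U) = ell \<beta> (U)\<close>.\<close>

definition j where "j s = s * g' s - g s"
definition ell where "ell \<beta> s = \<beta> * j s - 2 * g s"

lemma b_pos: "0 < b" and b_less: "ereal b < bt" and g_neg: "0 < s \<Longrightarrow> s < b \<Longrightarrow> g s < 0"
  and g_pos: "b < s \<Longrightarrow> ereal s < bt \<Longrightarrow> 0 < g s" and gb: "0 < g' b" and g0: "g 0 = 0" and g'0: "g' 0 < 0"
  and g'_cont: "continuous_on {0..} g'"
  and g_deriv_within: "0 \<le> s \<Longrightarrow> (g has_real_derivative g' s) (at s within {0..})"
  using G1 G2 unfolding G1_def G2_def by auto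

lemma g_deriv: "0 < s \<Longrightarrow> (g has_real_derivative g' s) (at s)"
  using g_deriv_within[of s] at_within_interior[of s "{0..}"] by simp

lemma g_cont: "continuous_on {0..} g"
  using g_deriv_within by (auto simp: continuous_on_eq_continuous_within intro: DERIV_continuous)

lemma g_isCont: "0 < s \<Longrightarrow> isCont g s" using g_deriv DERIV_isCont by blast
text \<open>Continuity between the two strict signs prescribed by (G2). Since bt may be infinite, a
  real B between b and bt marks a right neighbourhood in which g is positive.\<close>

lemma g_b: "g b = 0"
proof (rule ccontr)
  assume "g b \<noteq> 0"
  have c: "isCont g b" using g_isCont b_pos by simp
  obtain B where B: "b < B" "ereal B < bt" using ereal_dense2[OF b_less] by auto
  show False
  proof (cases "g b > 0")
    case True
    then have "\<forall>\<^sub>F x in at b. g x > 0" using c unfolding isCont_def by (rule order_tendstoD(1)[rotated])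
    then have "\<forall>\<^sub>F x in at_left b. g x > 0" unfolding eventually_at_split by simp
    moreover have "\<forall>\<^sub>F x in at_left b. x \<in> {0<..<b}" using eventually_at_left_real[OF b_pos] by simp
    ultimately have "\<forall>\<^sub>F x in at_left b. False" by eventually_elim (use g_neg in force)
    then show False by simp
  next
    case False
    then have "g b < 0" using \<open>g b \<noteq> 0\<close> by simp
    then have "\<forall>\<^sub>F x in at b. g x < 0" using c unfolding isCont_def by (rule order_tendstoD(2)[rotated])
    then have "\<forall>\<^sub>F x in at_right b. g x < 0" unfolding eventually_at_split by simp
    moreover have "\<forall>\<^sub>F x in at_right b. x \<in> {b<..<B}" using eventually_at_right_real[OF B(1)] by simp
    ultimately have "\<forall>\<^sub>F x in at_right b. False"
    proof eventually_elim
      case (elim x)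
      then have "ereal x < bt" using B(2) less_trans[of "ereal x" "ereal B" bt] by auto
      then show ?case using g_pos[of x] elim by auto
    qed
    then show False by simp
  qed
qed

lemma g_bt: assumes "bt = ereal B" shows "g B = 0"
proof (rule ccontr)
  assume nz: "g B \<noteq> 0"
  have bB: "b < B" using b_less assms by simp
  have c: "isCont g B" using g_isCont b_pos bB by simp
  have neg: "g s < 0" if "B < s" for s using G2 that assms unfolding G2_def by auto
  show False
  proof (cases "g B > 0")
    case True
    then have "\<forall>\<^sub>F x in at B. g x > 0" using c unfolding isCont_def by (rule order_tendstoD(1)[rotated])
    then have "\<forall>\<^sub>F x in at_right B. g x > 0" unfolding eventually_at_split by simp
    moreover have "\<forall>\<^sub>F x in at_right B. x > B" by (simp add: eventually_at_right_less)
    ultimately have "\<forall>\<^sub>F x in at_right B. False" by eventually_elim (use neg in force)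
    then show False by simp
  next
    case False
    then have "g B < 0" using nz by simp
    then have "\<forall>\<^sub>F x in at B. g x < 0" using c unfolding isCont_def by (rule order_tendstoD(2)[rotated])
    then have "\<forall>\<^sub>F x in at_left B. g x < 0" unfolding eventually_at_split by simp
    moreover have "\<forall>\<^sub>F x in at_left B. x \<in> {b<..<B}" using eventually_at_left_real[OF bB] by simp
    ultimately have "\<forall>\<^sub>F x in at_left B. False" by eventually_elim (use g_pos assms in force)
    then show False by simp
  qed
qed

lemma g_integrable: "0 \<le> a \<Longrightarrow> g integrable_on {a..c}"
  by (rule integrable_continuous_interval, rule continuous_on_subset[OF g_cont]) auto

lemma G_deriv: assumes "0 < s" shows "(G has_real_derivative g s) (at s)"
proof -
  have "((\<lambda>x. integral {0..x} g) has_real_derivative g s) (at s within {0..s+1})"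
    by (rule integral_has_real_derivative) (use assms in \<open>auto intro: continuous_on_subset[OF g_cont]\<close>)
  then show ?thesis unfolding G_def[abs_def]
    using at_within_interior[of s "{0..s+1}"] assms by simp
qed

lemma G_0: "G 0 = 0" unfolding G_def by simp

lemma G_cont: "continuous_on {0..} G"
proof -
  have "isCont G s" if "0 < s" for s using G_deriv[OF that] DERIV_isCont by blast
  moreover have "continuous (at 0 within {0..}) G"
  proof -
    have "continuous_on {0..1} G" unfolding G_def[abs_def]
      by (rule indefinite_integral_continuous_1[OF g_integrable]) simp
    then have "continuous (at 0 within {0..1}) G" by (simp add: continuous_on_eq_continuous_within)
    then show ?thesis by (simp add: continuous_within at_within_Icc_at_right at_within_Ici_at_right)
  qed
  ultimately show ?thesis unfolding continuous_on_eq_continuous_within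
    by (metis atLeast_iff continuous_at_imp_continuous_at_within order_le_less)
qed

lemma G_neg: assumes "0 < s" "s \<le> b" shows "G s < 0"
proof -
  have "G s < G 0"
  proof (rule DERIV_neg_imp_decreasing_open[OF assms(1)])
    fix x assume "0 < x" "x < s"
    then show "\<exists>y. (G has_real_derivative y) (at x) \<and> y < 0" using G_deriv[of x] g_neg[of x] assms by auto
  qed (auto intro: continuous_on_subset[OF G_cont])
  then show ?thesis using G_0 by simp
qed

text \<open>The antiderivative s g - 2 G of \<open>j\<close> is the term that is added to the
  Pohozaev function in \<open>\<Theta>\<close>.\<close>

lemma j_deriv_m: "0 < s \<Longrightarrow> ((\<lambda>s. s * g s - 2 * G s) has_real_derivative j s) (at s)"
  unfolding j_def by (auto intro!: derivative_eq_intros G_deriv g_deriv)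

text \<open>Multiplying K_g <= 1 by the negative number g reverses it into s g' >= g.\<close>

lemma j_nonneg_low: assumes "0 < s" "s < b" shows "0 \<le> j s"
  using assms g_neg[OF assms] G5 unfolding G5_def growth_def j_def by (auto simp: divide_le_eq)

lemma j_b: "0 < j b" unfolding j_def using g_b gb b_pos by simp

text \<open>As the height decreases, \<open>ell\<close> can only pass from negative to positive, and
  only once. Above b it equals g (\<beta> (K_g - 1) - 2) with g > 0 and, for \<beta> > 0, a strictly
  decreasing bracket by (G4). Below b, - 2 g is positive and \<beta> j is nonnegative by (G5). The
  case \<beta> = 0 with s > b contradicts the assumed sign at s.\<close>

lemma ell_pattern:
  assumes "0 \<le> \<beta>" "0 < s'" "s' < s" "ereal s < bt" "0 \<le> ell \<beta> s"
  shows "0 < ell \<beta> s'"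
proof (cases s' b rule: linorder_cases)
  case less
  then show ?thesis using j_nonneg_low[of s'] g_neg[of s'] assms unfolding ell_def
    by (smt (verit) mult_nonneg_nonneg)
next
  case equal
  have gs: "0 < g s" using g_pos assms equal by simp
  have "\<beta> \<noteq> 0" using assms(5) gs unfolding ell_def by auto
  then show ?thesis using equal j_b g_b assms unfolding ell_def by simp
next
  case greater
  have gs: "0 < g s" using g_pos assms greater by simp
  have bt': "ereal s' < bt" using assms(3,4) less_trans[of "ereal s'" "ereal s" bt] by simp
  have gs': "0 < g s'" using g_pos greater bt' by simp
  have "growth g g' s < growth g g' s'"
    using G4 greater assms(3,4) bt' unfolding G4_def by (auto simp: monotone_on_def)
  have e: "ell \<beta> t = g t * (\<beta> * (growth g g' t - 1) - 2)" if "0 < g t" for t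
    using that unfolding ell_def j_def growth_def by (simp add: field_simps)
  have "\<beta> \<noteq> 0" using assms(5) gs unfolding ell_def by auto
  then have "\<beta> * (growth g g' s - 1) < \<beta> * (growth g g' s' - 1)"
    using \<open>growth g g' s < growth g g' s'\<close> assms(1) by simp
  moreover have "0 \<le> \<beta> * (growth g g' s - 1) - 2"
    using assms(5) gs unfolding e[OF gs] by (simp add: zero_le_mult_iff)
  ultimately show ?thesis unfolding e[OF gs'] using gs' by simp
qed

text \<open>The argument of \<open>ell_pattern\<close> with the bracket K_g - 1, in nonstrict
  form.\<close>

lemma j_pattern:
  assumes "0 < s'" "s' < s" "ereal s < bt" "0 \<le> j s"
  shows "0 \<le> j s'"
proof (cases s' b rule: linorder_cases)
  case less then show ?thesis using j_nonneg_low assms by simp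
next
  case equal then show ?thesis using j_b by simp
next
  case greater
  have gs: "0 < g s" using g_pos assms greater by simp
  have bt': "ereal s' < bt" using assms(2,3) less_trans[of "ereal s'" "ereal s" bt] by simp
  have gs': "0 < g s'" using g_pos greater bt' by simp
  have "growth g g' s < growth g g' s'"
    using G4 greater assms bt' unfolding G4_def by (auto simp: monotone_on_def)
  moreover have e: "j t = g t * (growth g g' t - 1)" if "0 < g t" for t
    using that unfolding j_def growth_def by (simp add: field_simps)
  ultimately show ?thesis using assms(4) gs gs' by (auto simp: e zero_le_mult_iff)
qed

definition H where "H k s = (real k + 1) * G s - (real k - 1) / 2 * (s * g s)"

text \<open>Up to sign the derivative is again a source function \<open>ell\<close>, now with
  \<beta> = (N - 2)/2 for N = k + 1; its sign pattern therefore governs the Pohozaev function as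
  well.\<close>

lemma H_deriv: "0 < s \<Longrightarrow> (H k has_real_derivative - ell ((real k - 1) / 2) s) (at s)"
  unfolding H_def[abs_def] ell_def j_def
  by (auto intro!: derivative_eq_intros G_deriv g_deriv simp: field_simps)

lemma H_cont: "continuous_on {0..} (H k)"
  unfolding H_def[abs_def] by (intro continuous_intros G_cont g_cont)

text \<open>Since H vanishes at 0, H(s) >= 0 is incompatible with H' < 0 on all of (0, s). So
  \<open>ell\<close> is nonpositive somewhere below s, hence negative from s on by
  \<open>ell_pattern\<close>, and H increases beyond s.\<close>

lemma H_pattern:
  assumes "1 \<le> k" "0 < s" "s < t" "ereal t < bt" "0 \<le> H k s"
  shows "0 < H k t"
proof -
  let ?\<beta> = "(real k - 1) / 2"
  have \<beta>: "0 \<le> ?\<beta>" using assms(1) by simp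
  have "\<exists>y>0. y < s \<and> ell ?\<beta> y \<le> 0"
  proof (rule ccontr)
    assume "\<not> ?thesis"
    then have e: "0 < ell ?\<beta> y" if "0 < y" "y < s" for y using that by force
    have "H k s < H k 0"
    proof (rule DERIV_neg_imp_decreasing_open[OF assms(2)])
      fix x assume "0 < x" "x < s"
      then show "\<exists>y. (H k has_real_derivative y) (at x) \<and> y < 0" using H_deriv[of x k] e[of x] by auto
    qed (auto intro: continuous_on_subset[OF H_cont])
    then show False using assms(5) G_0 g0 unfolding H_def by simp
  qed
  then obtain y where y: "0 < y" "y < s" "ell ?\<beta> y \<le> 0" by auto
  have neg: "ell ?\<beta> x < 0" if "s \<le> x" "x < t" for x
  proof (rule ccontr)
    assume "\<not> ell ?\<beta> x < 0"
    moreover have "ereal x < bt" using that assms(4) less_trans[of "ereal x" "ereal t" bt] by simp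
    ultimately show False using ell_pattern[OF \<beta> y(1), of x] y that by force
  qed
  have "H k s < H k t"
  proof (rule DERIV_pos_imp_increasing_open[OF assms(3)])
    fix x assume "s < x" "x < t"
    then show "\<exists>y. (H k has_real_derivative y) (at x) \<and> 0 < y"
      using H_deriv[of x k] neg[of x] assms(2) by fastforce
  qed (use assms(2) in \<open>auto intro: continuous_on_subset[OF H_cont]\<close>)
  then show ?thesis using assms(5) by simp
qed

lemma g_lipschitz:
  assumes "0 \<le> M"
  obtains L where "0 \<le> L" "\<And>x y. x \<in> {0..M} \<Longrightarrow> y \<in> {0..M} \<Longrightarrow> \<bar>g x - g y\<bar> \<le> L * \<bar>x - y\<bar>"
    "\<And>x. x \<in> {0..M} \<Longrightarrow> \<bar>g' x\<bar> \<le> L"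
proof -
  have "compact (g' ` {0..M})"
    by (rule compact_continuous_image) (auto intro: continuous_on_subset[OF g'_cont])
  then obtain L where L: "\<And>x. x \<in> {0..M} \<Longrightarrow> \<bar>g' x\<bar> \<le> L"
    by (metis compact_imp_bounded bounded_iff imageI real_norm_def)
  have le: "\<bar>g y - g x\<bar> \<le> L * y - L * x" if "x \<in> {0..M}" "y \<in> {0..M}" "x \<le> y" for x y
    by (rule deriv_bound_compare[OF that(3), of g _ g' "\<lambda>_. L"])
       (use that L in \<open>auto intro!: continuous_on_subset[OF g_cont] g_deriv continuous_intros derivative_eq_intros\<close>)
  have "\<bar>g x - g y\<bar> \<le> L * \<bar>x - y\<bar>" if "x \<in> {0..M}" "y \<in> {0..M}" for x y
    using le[OF that] le[OF that(2,1)] unfolding right_diff_distrib[symmetric] abs_minus_commute[of "g x"]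
    by (cases "x \<le> y") (auto simp: abs_minus_commute[of "g x" "g y"])
  moreover have "0 \<le> L" using L[of 0] assms by auto
  ultimately show thesis using that L by blast
qed

text \<open>All facts near height 0 come from g'(0) < 0, with rate a = - g'(0) / 2. The bound on G
  yields exponential decay, the bound on g' makes g nonincreasing where the tails of the profiles
  lie.\<close>

lemma g_small:
  obtains a \<delta> where "0 < a" "0 < \<delta>" "\<delta> < b" "\<And>s. 0 \<le> s \<Longrightarrow> s \<le> \<delta> \<Longrightarrow> g' s \<le> - a"
    "\<And>s. 0 \<le> s \<Longrightarrow> s \<le> \<delta> \<Longrightarrow> g s \<le> - a * s"
    "\<And>s. 0 \<le> s \<Longrightarrow> s \<le> \<delta> \<Longrightarrow> G s \<le> - a * s\<^sup>2 / 2"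
proof -
  have "(g' \<longlongrightarrow> g' 0) (at_right 0)"
    using g'_cont unfolding continuous_on by (metis atLeast_iff order_refl at_within_Ici_at_right)
  then have "\<forall>\<^sub>F s in at_right 0. g' s < g' 0 / 2" by (rule order_tendstoD) (use g'0 in simp)
  then obtain e where e: "0 < e" "\<And>s. 0 < s \<Longrightarrow> s < e \<Longrightarrow> g' s < g' 0 / 2"
    unfolding eventually_at_right_field by auto
  define \<delta> where "\<delta> = min (e / 2) (b / 2)"
  define a where "a = - g' 0 / 2"
  have \<delta>: "0 < \<delta>" "\<delta> < b" "\<delta> < e" using e(1) b_pos unfolding \<delta>_def by (auto simp: min_def)
  have a: "0 < a" using g'0 unfolding a_def by simp
  have g'a: "g' s \<le> - a" if "0 \<le> s" "s \<le> \<delta>" for s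
    using that e(2)[of s] \<delta> g'0 unfolding a_def by (cases "s = 0") auto
  have ga: "g s \<le> - a * s" if "0 \<le> s" "s \<le> \<delta>" for s
  proof -
    have "(\<lambda>s. g s + a * s) s \<le> (\<lambda>s. g s + a * s) 0"
    proof (rule DERIV_nonpos_imp_decreasing_open[OF that(1)])
      fix x assume x: "0 < x" "x < s"
      then show "\<exists>y. ((\<lambda>s. g s + a * s) has_real_derivative y) (at x) \<and> y \<le> 0"
        by (intro exI[of _ "g' x + a"]) (use g'a[of x] that in \<open>auto intro!: derivative_eq_intros g_deriv\<close>)
    qed (auto intro!: continuous_intros continuous_on_subset[OF g_cont])
    then show ?thesis using g0 by simp
  qed
  have Ga: "G s \<le> - a * s\<^sup>2 / 2" if "0 \<le> s" "s \<le> \<delta>" for s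
  proof -
    have "(\<lambda>s. G s + a * s\<^sup>2 / 2) s \<le> (\<lambda>s. G s + a * s\<^sup>2 / 2) 0"
    proof (rule DERIV_nonpos_imp_decreasing_open[OF that(1)])
      fix x assume x: "0 < x" "x < s"
      then show "\<exists>y. ((\<lambda>s. G s + a * s\<^sup>2 / 2) has_real_derivative y) (at x) \<and> y \<le> 0"
        by (intro exI[of _ "g x + a * x"]) (use ga[of x] that in \<open>auto intro!: derivative_eq_intros G_deriv\<close>)
    qed (auto intro!: continuous_intros continuous_on_subset[OF G_cont])
    then show ?thesis using G_0 by simp
  qed
  show thesis using that[OF a \<delta>(1,2) g'a ga Ga] .
qed

end

section \<open>Ground states\<close>

locale ground_state = nonlinearity +
  fixes k :: nat and U P :: "real \<Rightarrow> real"
  assumes k1: "1 \<le> k"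
    and ode: "rad_ode k U P (\<lambda>r. g (U r))"
    and U_pos: "\<And>r. 0 \<le> r \<Longrightarrow> 0 < U r"
    and U_lim: "(U \<longlongrightarrow> 0) at_top"
begin

lemma U_cont: "continuous_on {0..} U" and P_cont: "continuous_on {0..} P" and P_0: "P 0 = 0"
  and U_deriv: "0 < r \<Longrightarrow> (U has_real_derivative P r) (at r)"
  and kP_deriv: "0 < r \<Longrightarrow> ((\<lambda>r. r ^ k * P r) has_real_derivative - (r ^ k * g (U r))) (at r)"
  using ode unfolding rad_ode_def by auto

lemmas P_deriv = rad_ode_p_deriv[OF ode]

text \<open>Mechanical energy of a motion in the potential G; the term k U'/r acts as friction, so
  the energy does not increase.\<close>

definition E where "E r = (P r)\<^sup>2 / 2 + G (U r)"

lemma GU_deriv: "0 < r \<Longrightarrow> ((\<lambda>r. G (U r)) has_real_derivative g (U r) * P r) (at r)"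
  using DERIV_chain2[OF G_deriv[OF U_pos] U_deriv] by simp

lemma gU_deriv: "0 < r \<Longrightarrow> ((\<lambda>r. g (U r)) has_real_derivative g' (U r) * P r) (at r)"
  using DERIV_chain2[OF g_deriv[OF U_pos] U_deriv] by simp

lemma gU_cont: "continuous_on {0..} (\<lambda>r. g (U r))"
  by (rule continuous_on_compose2[OF g_cont U_cont]) (use U_pos in \<open>auto intro: less_imp_le\<close>)

lemma GU_cont: "continuous_on {0..} (\<lambda>r. G (U r))"
  by (rule continuous_on_compose2[OF G_cont U_cont]) (use U_pos in \<open>auto intro: less_imp_le\<close>)

lemma E_cont: "continuous_on {0..} E"
  unfolding E_def[abs_def] by (intro continuous_intros P_cont GU_cont) auto

lemma E_deriv: assumes "0 < r" shows "(E has_real_derivative - (real k / r) * (P r)\<^sup>2) (at r)"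
proof -
  have "((\<lambda>r. P r * P r / 2 + G (U r)) has_real_derivative
      ((- (real k / r) * P r - g (U r)) * P r + (- (real k / r) * P r - g (U r)) * P r) / 2 + g (U r) * P r) (at r)"
    by (intro DERIV_add DERIV_cdivide DERIV_mult P_deriv GU_deriv assms)
  moreover have "((- (real k / r) * P r - g (U r)) * P r + (- (real k / r) * P r - g (U r)) * P r) / 2 + g (U r) * P r
      = - (real k / r) * (P r)\<^sup>2" using assms by (simp add: power2_eq_square field_simps)
  ultimately show ?thesis unfolding E_def[abs_def] by (simp add: power2_eq_square)
qed

lemma E_antimono: assumes "0 \<le> r" "r \<le> t" shows "E t \<le> E r"
proof (rule DERIV_nonpos_imp_decreasing_open[OF assms(2)])
  fix x assume "r < x"
  then show "\<exists>y. (E has_real_derivative y) (at x) \<and> y \<le> 0"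
    using E_deriv[of x] assms by (intro exI[of _ "- (real k / x) * (P x)\<^sup>2"]) auto
qed (use assms in \<open>auto intro: continuous_on_subset[OF E_cont]\<close>)

lemma U_lim_within: "filterlim U (at 0 within {0..}) at_top"
  unfolding filterlim_at using U_lim U_pos
  by (auto intro!: eventually_mono[OF eventually_ge_at_top[of 0]] simp: less_imp_le less_imp_neq[symmetric])

lemma GU_lim: "((\<lambda>r. G (U r)) \<longlongrightarrow> 0) at_top"
proof -
  have "(G \<longlongrightarrow> G 0) (at 0 within {0..})" using G_cont unfolding continuous_on by simp
  from filterlim_compose[OF this U_lim_within] show ?thesis using G_0 by simp
qed

text \<open>Nothing is known yet about P at infinity. The lower bound E >= G(U), whose right-hand
  side tends to 0, together with monotonicity is enough.\<close>

lemma E_nonneg: assumes "0 \<le> r" shows "0 \<le> E r"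
proof (rule tendsto_upperbound[OF GU_lim])
  show "\<forall>\<^sub>F t in at_top. G (U t) \<le> E r"
    using eventually_ge_at_top[of r]
  proof eventually_elim
    case (elim t)
    have "G (U t) \<le> E t" unfolding E_def by simp
    then show ?case using E_antimono[OF assms elim] by simp
  qed
qed simp

text \<open>Once zero, the energy stays zero; then the dissipation k P^2 / r vanishes, so U is
  constant and positive from there on, against its limit 0.\<close>

lemma E_pos: assumes "0 \<le> r" shows "0 < E r"
proof (rule ccontr)
  assume "\<not> 0 < E r"
  then have 0: "E t = 0" if "r \<le> t" for t
    using E_antimono[OF assms that] E_nonneg[of t] assms that by simp
  have P0: "P t = 0" if "r < t" for t
  proof -
    have "(E has_real_derivative 0) (at t)"
      by (rule has_field_derivative_transform_within_open[where S = "{r<..}" and f = "\<lambda>_. 0"]) (use that 0 in auto)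
    then have "- (real k / t) * (P t)\<^sup>2 = 0" using DERIV_unique[OF E_deriv[of t]] assms that by auto
    then show ?thesis using k1 assms that by auto
  qed
  have c: "U t = U (r + 1)" if "r + 1 \<le> t" for t
  proof (rule DERIV_isconst2[of "r + 1" "t + 1"])
    show "continuous_on {r + 1..t + 1} U" using assms by (auto intro: continuous_on_subset[OF U_cont])
    show "\<And>x. r + 1 < x \<Longrightarrow> x < t + 1 \<Longrightarrow> (U has_real_derivative 0) (at x)"
    proof -
      fix x assume x: "r + 1 < x" "x < t + 1"
      then show "(U has_real_derivative 0) (at x)" using U_deriv[of x] P0[of x] assms by simp
    qed
  qed (use that in auto)
  have "\<forall>\<^sub>F t in at_top. U (r + 1) = U t"
    using eventually_ge_at_top[of "r + 1"] by eventually_elim (rule c[symmetric])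
  then have "(U \<longlongrightarrow> U (r + 1)) at_top" by (rule Lim_transform_eventually[rotated]) simp
  then have "U (r + 1) = 0" using tendsto_unique[OF trivial_limit_at_top_linorder _ U_lim] by blast
  then show False using U_pos[of "r + 1"] assms by simp
qed

text \<open>At the origin the energy is purely potential, so it is positive only if G(U 0) > 0,
  which fails for heights up to b.\<close>

lemma U0_gt: "b < U 0"
  using E_pos[of 0] G_neg[of "U 0"] U_pos[of 0] unfolding E_def P_0 by force

text \<open>Let bt = B be finite. A start exactly at B is the constant solution, by Gronwall. A
  start above B meets g < 0, so U increases as long as it stays above B and cannot come down to
  B.\<close>

lemma U0_less: "ereal (U 0) < bt"
proof (rule ccontr)
  assume "\<not> ereal (U 0) < bt"
  then obtain B where B: "bt = ereal B" "B \<le> U 0" using b_less by (cases bt) auto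
  have B0: "b < B" using b_less B by simp
  show False
  proof (cases "U 0 = B")
    case True
    obtain r where r: "0 < r" "U r < B"
    proof -
      have "\<forall>\<^sub>F r in at_top. U r < B" by (rule order_tendstoD(2)[OF U_lim]) (use b_pos B0 in simp)
      then obtain R where "\<And>r. r \<ge> R \<Longrightarrow> U r < B" unfolding eventually_at_top_linorder by auto
      then show thesis using that[of "max R 1"] by simp
    qed
    have "compact (U ` {0..r})"
      by (rule compact_continuous_image) (auto intro: continuous_on_subset[OF U_cont])
    then obtain M where M: "\<And>x. x \<in> {0..r} \<Longrightarrow> \<bar>U x\<bar> \<le> M"
      by (metis compact_imp_bounded bounded_iff imageI real_norm_def)
    have M0: "0 \<le> M" using M[of 0] r by auto
    obtain L where L: "0 \<le> L" "\<And>x y. x \<in> {0..M} \<Longrightarrow> y \<in> {0..M} \<Longrightarrow> \<bar>g x - g y\<bar> \<le> L * \<bar>x - y\<bar>"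
      using g_lipschitz[OF M0] by metis
    have c: "rad_ode k (\<lambda>_. B) (\<lambda>_. 0) (\<lambda>_. 0)" unfolding rad_ode_def by auto
    have "rad_ode k (\<lambda>r. U r - 1 * B) (\<lambda>r. P r - 1 * 0) (\<lambda>r. g (U r) - 1 * 0)"
      by (rule rad_ode_diff[OF ode c])
    then have d: "rad_ode k (\<lambda>r. U r - B) P (\<lambda>r. g (U r))" by simp
    have "\<bar>U r - B\<bar> \<le> gw_const L r * (\<bar>U 0 - B\<bar> + 0)"
    proof (rule rad_gronwall[OF d L(1)])
      fix x assume x: "0 < x" "x \<le> r"
      have "\<bar>g (U x) - g B\<bar> \<le> L * \<bar>U x - B\<bar>"
        by (rule L(2)) (use M[of x] M[of 0] U_pos[of x] x r True B0 b_pos in auto)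
      then show "\<bar>g (U x)\<bar> \<le> L * \<bar>U x - B\<bar> + 0" using g_bt[OF B(1)] by simp
    qed (use r in auto)
    then show False using r True by simp
  next
    case False
    then have B2: "B < U 0" using B(2) by simp
    have "\<forall>\<^sub>F r in at_top. U r < B" by (rule order_tendstoD(2)[OF U_lim]) (use b_pos B0 in simp)
    then obtain R where "\<And>r. r \<ge> R \<Longrightarrow> U r < B" unfolding eventually_at_top_linorder by auto
    then have R: "U (max R 1) < B" by simp
    obtain z where z: "0 < z" "z \<le> max R 1" "B - U z = 0" "\<And>x. 0 \<le> x \<Longrightarrow> x < z \<Longrightarrow> B - U x < 0"
      by (rule first_zero[of 0 "max R 1" "\<lambda>r. B - U r"])
         (use B2 R in \<open>auto intro!: continuous_intros continuous_on_subset[OF U_cont]\<close>)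
    have neg: "g (U x) < 0" if "0 < x" "x < z" for x
      using G2 z(4)[of x] that B unfolding G2_def by auto
    have Pp: "0 < P x" if "0 < x" "x < z" for x
    proof -
      have "0 ^ k * P 0 < x ^ k * P x"
      proof (rule DERIV_pos_imp_increasing_open[of 0 x "\<lambda>r. r ^ k * P r"])
        fix y assume y: "0 < y" "y < x"
        then show "\<exists>d. ((\<lambda>r. r ^ k * P r) has_real_derivative d) (at y) \<and> 0 < d"
          using kP_deriv[of y] neg[of y] that by (auto simp: mult_pos_neg intro!: exI[of _ "- (y ^ k * g (U y))"])
      qed (use that in \<open>auto intro!: continuous_intros continuous_on_subset[OF P_cont]\<close>)
      then show ?thesis using that P_0 by (simp add: zero_less_mult_iff)
    qed
    have "U 0 \<le> U z"
    proof (rule DERIV_nonneg_imp_increasing_open[of 0 z])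
      fix x assume "0 < x" "x < z"
      then show "\<exists>y. (U has_real_derivative y) (at x) \<and> 0 \<le> y" using U_deriv[of x] Pp[of x] by (auto intro: less_imp_le)
    qed (use z(1) in \<open>auto intro: continuous_on_subset[OF U_cont]\<close>)
    then show False using z(3) B2 by simp
  qed
qed

lemma g_U0: "0 < g (U 0)" using g_pos[OF U0_gt U0_less] .

lemma at_right_0_pos: "\<forall>\<^sub>F r in at_right 0. (0::real) < r" by (simp add: eventually_at_right_less)

lemma P_slope: "((\<lambda>r. P r / r) \<longlongrightarrow> - g (U 0) / (real k + 1)) (at_right 0)"
proof (rule rad_slope[OF ode])
  show "((\<lambda>r. g (U r)) \<longlongrightarrow> g (U 0)) (at_right 0)"
    using gU_cont unfolding continuous_on by (metis atLeast_iff order_refl at_within_Ici_at_right)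
qed

text \<open>At a critical point the positive energy consists of G(U) alone, which forces U > b and
  hence g(U) > 0, as \<open>rad_ode_descends\<close> requires.\<close>

lemma P_neg: assumes "0 < r" shows "P r < 0"
proof (rule rad_ode_descends[OF ode gU_cont g_U0 assms])
  fix z assume z: "0 < z" "P z = 0" "U z < U 0"
  have "0 < G (U z)" using E_pos[of z] z unfolding E_def by simp
  then have "b < U z" using G_neg[of "U z"] U_pos[of z] z by force
  moreover have "ereal (U z) < bt" using z(3) U0_less less_trans[of "ereal (U z)" "ereal (U 0)" bt] by simp
  ultimately show "0 < g (U z)" by (rule g_pos)
qed

lemma U_strict: assumes "0 \<le> r" "r < t" shows "U t < U r"
proof (rule DERIV_neg_imp_decreasing_open[OF assms(2)])
  fix x assume "r < x"
  then show "\<exists>y. (U has_real_derivative y) (at x) \<and> y < 0" using U_deriv[of x] P_neg[of x] assms by auto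
qed (use assms in \<open>auto intro: continuous_on_subset[OF U_cont]\<close>)

lemma U_le: "0 \<le> r \<Longrightarrow> U r \<le> U 0" using U_strict[of 0 r] by (cases "r = 0") auto

lemma U_bt: "0 \<le> r \<Longrightarrow> ereal (U r) < bt"
  using U_le[of r] U0_less le_less_trans[of "ereal (U r)" "ereal (U 0)" bt] by simp

text \<open>Positive energy and G(s) <= - a s^2 / 2 give P^2 >= a U^2, that is U' <= - sqrt(a) U far
  out. There g(U) < 0 makes P nondecreasing, so - P(r) is at most the drop of U over [r - 1, r] and
  hence at most U(r - 1); the unit shift costs the factor \<open>exp c\<close>.\<close>

lemma exp_decay:
  obtains R C c where "0 < c" "0 < R" "\<And>r. r \<ge> R \<Longrightarrow> \<bar>U r\<bar> \<le> C * exp (- c * r)"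
     "\<And>r. r \<ge> R \<Longrightarrow> \<bar>P r\<bar> \<le> C * exp (- c * r)"
proof -
  obtain a \<delta> where a: "0 < a" "0 < \<delta>" "\<delta> < b" "\<And>s. 0 \<le> s \<Longrightarrow> s \<le> \<delta> \<Longrightarrow> g s \<le> - a * s"
    "\<And>s. 0 \<le> s \<Longrightarrow> s \<le> \<delta> \<Longrightarrow> G s \<le> - a * s\<^sup>2 / 2" using g_small by metis
  have "\<forall>\<^sub>F r in at_top. U r < \<delta>" by (rule order_tendstoD(2)[OF U_lim a(2)])
  then obtain R0 where R0: "\<And>r. r \<ge> R0 \<Longrightarrow> U r < \<delta>" unfolding eventually_at_top_linorder by auto
  define R where "R = max R0 1"
  have R: "0 < R" "\<And>r. r \<ge> R \<Longrightarrow> U r < \<delta>" using R0 unfolding R_def by auto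
  define c where "c = sqrt a"
  have c: "0 < c" "c\<^sup>2 = a" using a unfolding c_def by auto
  have Pc: "P r \<le> - c * U r" if "r \<ge> R" for r
  proof -
    have "(c * U r)\<^sup>2 \<le> (P r)\<^sup>2"
      using E_pos[of r] a(5)[of "U r"] R(1) R(2)[OF that] that U_pos[of r] c(2) unfolding E_def by (simp add: power_mult_distrib)
    then have "c * U r \<le> \<bar>P r\<bar>" by (metis abs_le_square_iff abs_ge_self order.trans)
    then show ?thesis using P_neg[of r] R that by auto
  qed
  define C where "C = U R * exp (c * R)"
  have Ub: "U r \<le> C * exp (- c * r)" if "r \<ge> R" for r
  proof -
    have "U r * exp (c * r) \<le> U R * exp (c * R)"
    proof (rule DERIV_nonpos_imp_nonincreasing[OF that])
      fix x assume x: "R \<le> x" "x \<le> r"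
      have "((\<lambda>r. U r * exp (c * r)) has_real_derivative (P x + c * U x) * exp (c * x)) (at x)"
        by (rule derivative_eq_intros U_deriv refl | use x R in \<open>simp add: algebra_simps\<close>)+
      then show "\<exists>y. ((\<lambda>r. U r * exp (c * r)) has_real_derivative y) (at x) \<and> y \<le> 0"
        using Pc[of x] x by (auto intro!: exI mult_nonpos_nonneg)
    qed
    then show ?thesis unfolding C_def by (simp add: exp_minus field_simps)
  qed
  have Pb: "\<bar>P r\<bar> \<le> C * exp c * exp (- c * r)" if "r \<ge> R + 1" for r
  proof -
    have mono: "P x \<le> P r" if "r - 1 < x" "x < r" for x
    proof (rule DERIV_nonneg_imp_nondecreasing[OF less_imp_le[OF that(2)]])
      fix y assume y: "x \<le> y" "y \<le> r"
      then have "y \<ge> R" using \<open>r \<ge> R + 1\<close> that by simp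
      then have "g (U y) < 0" using g_neg[of "U y"] U_pos[of y] R a(3) by force
      moreover have "0 < y" using \<open>y \<ge> R\<close> R by simp
      ultimately show "\<exists>z. (P has_real_derivative z) (at y) \<and> 0 \<le> z"
        using P_deriv[of y] P_neg[of y]
          mult_nonneg_nonpos[of "real k / y" "P y"]
        by (intro exI[of _ "- (real k / y) * P y - g (U y)"]) auto
    qed
    have "(\<lambda>x. U x - P r * x) r \<le> (\<lambda>x. U x - P r * x) (r - 1)"
    proof (rule DERIV_nonpos_imp_decreasing_open[of "r - 1" r])
      fix x assume x: "r - 1 < x" "x < r"
      then have "0 < x" using \<open>r \<ge> R + 1\<close> R by simp
      then show "\<exists>y. ((\<lambda>x. U x - P r * x) has_real_derivative y) (at x) \<and> y \<le> 0"
        using mono[OF x] by (intro exI[of _ "P x - P r"]) (auto intro!: derivative_eq_intros U_deriv)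
    qed (use that R in \<open>auto intro!: continuous_intros continuous_on_subset[OF U_cont]\<close>)
    then have "- P r \<le> U (r - 1)" using U_pos[of r] that R by (simp add: algebra_simps)
    also have "\<dots> \<le> C * exp (- c * (r - 1))" using Ub[of "r - 1"] that by simp
    also have "\<dots> = C * exp c * exp (- c * r)" by (simp add: exp_add[symmetric] algebra_simps)
    finally show ?thesis using P_neg[of r] that R by simp
  qed
  have C0: "0 < C" unfolding C_def using U_pos[of R] R by simp
  show thesis
  proof (rule that[of c "R + 1" "C * exp c"])
    fix r assume r: "R + 1 \<le> r"
    have "C * exp (- c * r) \<le> C * exp c * exp (- c * r)" using C0 c(1) by (auto intro!: mult_right_mono simp: mult_le_cancel_left1)
    then show "\<bar>U r\<bar> \<le> C * exp c * exp (- c * r)" using Ub[of r] U_pos[of r] r R by simp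
  qed (use c R Pb in auto)
qed

lemma rapid_U: "rapid U" and rapid_P: "rapid P"
proof -
  obtain R C c where d: "0 < c" "0 < R" "\<And>r. r \<ge> R \<Longrightarrow> \<bar>U r\<bar> \<le> C * exp (- c * r)"
     "\<And>r. r \<ge> R \<Longrightarrow> \<bar>P r\<bar> \<le> C * exp (- c * r)" using exp_decay by metis
  show "rapid U" using rapid_expI[OF d(1) d(3)] .
  show "rapid P" using rapid_expI[OF d(1) d(4)] .
qed

lemma U_lipschitz_bound:
  obtains L where "0 \<le> L" "\<And>r. 0 \<le> r \<Longrightarrow> \<bar>g (U r)\<bar> \<le> L * U r" "\<And>r. 0 \<le> r \<Longrightarrow> \<bar>g' (U r)\<bar> \<le> L"
proof -
  obtain L where L: "0 \<le> L" "\<And>x y. x \<in> {0..U 0} \<Longrightarrow> y \<in> {0..U 0} \<Longrightarrow> \<bar>g x - g y\<bar> \<le> L * \<bar>x - y\<bar>"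
    "\<And>x. x \<in> {0..U 0} \<Longrightarrow> \<bar>g' x\<bar> \<le> L"
    using g_lipschitz[OF less_imp_le[OF U_pos[OF order_refl]]] by metis
  have r: "U r \<in> {0..U 0}" "0 \<le> U r" if "0 \<le> r" for r using U_le[OF that] U_pos[OF that] by auto
  show thesis
  proof (rule that[OF L(1)])
    fix x :: real assume x: "0 \<le> x"
    show "\<bar>g' (U x)\<bar> \<le> L" using L(3) r[OF x] by blast
    show "\<bar>g (U x)\<bar> \<le> L * U x" using L(2)[of "U x" 0] r[OF x] g0 U_pos[of 0] by simp
  qed
qed

lemma rapid_gU: "rapid (\<lambda>r. g (U r))"
proof -
  obtain L where L: "0 \<le> L" "\<And>r. 0 \<le> r \<Longrightarrow> \<bar>g (U r)\<bar> \<le> L * U r" using U_lipschitz_bound by metis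
  obtain R C c where d: "0 < c" "0 < R" "\<And>r. r \<ge> R \<Longrightarrow> \<bar>U r\<bar> \<le> C * exp (- c * r)" using exp_decay by metis
  show ?thesis
  proof (rule rapid_expI[OF d(1), of R _ "L * C"])
    fix r assume r: "R \<le> r"
    have "L * U r \<le> L * (C * exp (- c * r))" using d(3)[OF r] L(1) by (intro mult_left_mono) auto
    then show "\<bar>g (U r)\<bar> \<le> L * C * exp (- c * r)" using L(2)[of r] r d(2) by simp
  qed
qed

end

section \<open>The Pohozaev function and the monotonicity of \<open>\<theta>\<close>\<close>

context ground_state begin

text \<open>It arises from multiplying the equation by r U' + (N - 2)/2 U with N = k + 1; for this
  weight the terms in P^2 cancel in the derivative.\<close>

definition pohozaev where "pohozaev r = r ^ (k + 1) * ((P r)\<^sup>2 / 2 + G (U r)) + (real k - 1) / 2 * (r ^ k * U r * P r)"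

lemma pohozaev_cont: "continuous_on {0..} pohozaev"
  unfolding pohozaev_def[abs_def] by (intro continuous_intros P_cont GU_cont U_cont) auto

lemma rP_deriv: assumes "0 < r"
  shows "((\<lambda>r. r * P r) has_real_derivative (1 - real k) * P r - r * g (U r)) (at r)"
proof -
  have "((\<lambda>r. r * P r) has_real_derivative 1 * P r + (- (real k / r) * P r - g (U r)) * r) (at r)"
    by (intro DERIV_mult DERIV_ident P_deriv assms)
  moreover have "1 * P r + (- (real k / r) * P r - g (U r)) * r = (1 - real k) * P r - r * g (U r)"
    using assms by (simp add: field_simps)
  ultimately show ?thesis by simp
qed

lemma power_Suc_deriv: "((\<lambda>r. r ^ (k + 1)) has_real_derivative (real k + 1) * r ^ k) (at r)"
  using DERIV_pow[of "k + 1" r] by (simp add: add.commute)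

lemma pohozaev_deriv: assumes "0 < r" shows "(pohozaev has_real_derivative r ^ k * H k (U r)) (at r)"
proof -
  have 1: "((\<lambda>r. (r ^ k * P r) * (r * P r) / 2 + r ^ (k + 1) * G (U r) + (real k - 1) / 2 * ((r ^ k * P r) * U r))
     has_real_derivative ((- (r ^ k * g (U r))) * (r * P r) + ((1 - real k) * P r - r * g (U r)) * (r ^ k * P r)) / 2
       + ((real k + 1) * r ^ k * G (U r) + g (U r) * P r * r ^ (k + 1))
       + (real k - 1) / 2 * ((- (r ^ k * g (U r))) * U r + P r * (r ^ k * P r))) (at r)"
    by (intro DERIV_add DERIV_cdivide DERIV_cmult DERIV_mult power_Suc_deriv rP_deriv
        GU_deriv U_deriv kP_deriv assms)
  have 2: "((- (r ^ k * g (U r))) * (r * P r) + ((1 - real k) * P r - r * g (U r)) * (r ^ k * P r)) / 2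
       + ((real k + 1) * r ^ k * G (U r) + g (U r) * P r * r ^ (k + 1))
       + (real k - 1) / 2 * ((- (r ^ k * g (U r))) * U r + P r * (r ^ k * P r)) = r ^ k * H k (U r)"
    unfolding H_def by (simp add: field_simps)
  have "pohozaev = (\<lambda>r. (r ^ k * P r) * (r * P r) / 2 + r ^ (k + 1) * G (U r) + (real k - 1) / 2 * ((r ^ k * P r) * U r))"
    unfolding pohozaev_def by (auto simp: algebra_simps power2_eq_square)
  then show ?thesis using 1 unfolding 2 by simp
qed

lemma pohozaev_0: "pohozaev 0 = 0" unfolding pohozaev_def using P_0 by simp

lemma rapid_GU: "((\<lambda>r. r ^ n * (P r)\<^sup>2) \<longlongrightarrow> 0) at_top" "((\<lambda>r. r ^ n * (U r)\<^sup>2) \<longlongrightarrow> 0) at_top"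
proof -
  have "((\<lambda>r. (r ^ n * P r) * (r ^ 0 * P r)) \<longlongrightarrow> 0 * 0) at_top"
    using rapid_P unfolding rapid_def by (intro tendsto_mult) blast+
  then show "((\<lambda>r. r ^ n * (P r)\<^sup>2) \<longlongrightarrow> 0) at_top" by (simp add: power2_eq_square mult_ac)
  have "((\<lambda>r. (r ^ n * U r) * (r ^ 0 * U r)) \<longlongrightarrow> 0 * 0) at_top"
    using rapid_U unfolding rapid_def by (intro tendsto_mult) blast+
  then show "((\<lambda>r. r ^ n * (U r)\<^sup>2) \<longlongrightarrow> 0) at_top" by (simp add: power2_eq_square mult_ac)
qed

lemma pohozaev_lim: "(pohozaev \<longlongrightarrow> 0) at_top"
proof -
  have a: "((\<lambda>r. r ^ (k+1) * (P r)\<^sup>2) \<longlongrightarrow> 0) at_top" by (rule rapid_GU)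
  have "((\<lambda>r. (r ^ k * P r) * (r ^ 0 * U r)) \<longlongrightarrow> 0 * 0) at_top"
    using rapid_U rapid_P unfolding rapid_def by (intro tendsto_mult) blast+
  then have c: "((\<lambda>r. (real k - 1) / 2 * (r ^ k * U r * P r)) \<longlongrightarrow> 0) at_top"
    by (intro tendsto_mult_right_zero) (simp add: mult_ac)
  \<comment> \<open>Far out G(U) is negative while the energy is positive, so |G(U)| is dominated by
    P^2 and the decay of P suffices.\<close>
  have b: "((\<lambda>r. r ^ (k+1) * G (U r)) \<longlongrightarrow> 0) at_top"
  proof -
    have "\<forall>\<^sub>F r in at_top. U r < b" by (rule order_tendstoD(2)[OF U_lim b_pos])
    moreover have "\<forall>\<^sub>F r in at_top. (0::real) < r" by (rule eventually_gt_at_top)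
    ultimately have "\<forall>\<^sub>F r in at_top. norm (r ^ (k+1) * G (U r)) \<le> r ^ (k+1) * (P r)\<^sup>2"
    proof eventually_elim
      case (elim r)
      have "G (U r) < 0" using G_neg[of "U r"] U_pos[of r] elim by simp
      moreover have "0 < (P r)\<^sup>2 / 2 + G (U r)" using E_pos[of r] elim unfolding E_def by simp
      ultimately have "\<bar>G (U r)\<bar> \<le> (P r)\<^sup>2" by simp
      then show ?case using elim by (simp add: abs_mult)
    qed
    then show ?thesis by (rule Lim_null_comparison) (rule a)
  qed
  have "((\<lambda>r. (r ^ (k+1) * (P r)\<^sup>2) / 2 + r ^ (k+1) * G (U r) + (real k - 1) / 2 * (r ^ k * U r * P r)) \<longlongrightarrow> 0 / 2 + 0 + 0) at_top"
    by (intro tendsto_intros a b c) simp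
  then show ?thesis unfolding pohozaev_def[abs_def] by (simp add: algebra_simps)
qed

text \<open>
  \<open>pohozaev' = r ^ k H(U)\<close>, where \<open>H(U)\<close> is first positive, then negative; as \<open>pohozaev\<close> vanishes at both ends, it
  first increases from \<open>0\<close> and then decreases to \<open>0\<close>.
\<close>

lemma pohozaev_pos: assumes "0 < r" shows "0 < pohozaev r"
proof (cases "0 \<le> H k (U r)")
  case True
  have "pohozaev 0 < pohozaev r"
  proof (rule DERIV_pos_imp_increasing_open[OF assms])
    fix x assume x: "0 < x" "x < r"
    have "0 < H k (U x)"
      by (rule H_pattern[OF k1 U_pos[of r] U_strict[of x r] U_bt[of x] True]) (use x in auto)
    then show "\<exists>y. (pohozaev has_real_derivative y) (at x) \<and> 0 < y" using pohozaev_deriv[OF x(1)] x by auto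
  qed (auto intro: continuous_on_subset[OF pohozaev_cont])
  then show ?thesis using pohozaev_0 by simp
next
  case False
  have neg: "H k (U x) < 0" if "r \<le> x" for x
  proof (rule ccontr)
    assume "\<not> H k (U x) < 0"
    then have "0 < H k (U r)" using False that U_strict[of r x] U_pos[of x] U_bt[of r] assms
        H_pattern[OF k1, of "U x" "U r"] by (cases "x = r") auto
    then show False using False by simp
  qed
  have dec: "pohozaev y < pohozaev x" if "r \<le> x" "x < y" for x y
  proof (rule DERIV_neg_imp_decreasing_open[OF that(2)])
    fix z assume z: "x < z" "z < y"
    have "0 < z ^ k" using z that assms by auto
    then have "z ^ k * H k (U z) < 0" using neg[of z] z that by (auto simp: mult_less_0_iff)
    then show "\<exists>d. (pohozaev has_real_derivative d) (at z) \<and> d < 0" using pohozaev_deriv[of z] z that assms by auto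
  qed (use that assms in \<open>auto intro: continuous_on_subset[OF pohozaev_cont]\<close>)
  have "0 \<le> pohozaev (r + 1)"
  proof (rule tendsto_upperbound[OF pohozaev_lim])
    show "\<forall>\<^sub>F x in at_top. pohozaev x \<le> pohozaev (r + 1)"
      by (rule eventually_mono[OF eventually_gt_at_top[of "r + 1"]]) (use dec in \<open>auto intro: less_imp_le\<close>)
  qed simp
  then show ?thesis using dec[of r "r + 1"] by simp
qed

text \<open>\<open>\<Theta> r = r ^ k * (U r)\<^sup>2 * \<theta>' r\<close> for the function \<open>\<theta>\<close> defined below.\<close>

definition \<Theta> where "\<Theta> r = 2 * pohozaev r + r ^ (k + 1) * (U r * g (U r) - 2 * G (U r))"

lemma \<Theta>_cont: "continuous_on {0..} \<Theta>"
  unfolding \<Theta>_def[abs_def] by (intro continuous_intros pohozaev_cont U_cont gU_cont GU_cont)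

lemma \<Theta>_deriv: assumes "0 < r"
  shows "(\<Theta> has_real_derivative r ^ k * (2 * g (U r) * U r + r * P r * j (U r))) (at r)"
proof -
  have 1: "((\<lambda>r. 2 * pohozaev r + r ^ (k + 1) * (U r * g (U r) - 2 * G (U r))) has_real_derivative
     2 * (r ^ k * H k (U r)) + ((real k + 1) * r ^ k * (U r * g (U r) - 2 * G (U r)) +
      (P r * g (U r) + g' (U r) * P r * U r - 2 * (g (U r) * P r)) * r ^ (k + 1))) (at r)"
    by (intro DERIV_add DERIV_diff DERIV_cmult DERIV_mult power_Suc_deriv pohozaev_deriv U_deriv gU_deriv GU_deriv assms)
  have "2 * (r ^ k * H k (U r)) + ((real k + 1) * r ^ k * (U r * g (U r) - 2 * G (U r)) +
      (P r * g (U r) + g' (U r) * P r * U r - 2 * (g (U r) * P r)) * r ^ (k + 1))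
     = r ^ k * (2 * g (U r) * U r + r * P r * j (U r))"
    unfolding H_def j_def by (simp add: field_simps)
  then show ?thesis using 1 unfolding \<Theta>_def[abs_def] by simp
qed

text \<open>By \<open>j_pattern\<close> the derivative \<open>j\<close> of s g - 2 G is nonnegative
  on all of (0, s), and the function vanishes at 0.\<close>

lemma m_nonneg: assumes "0 < s" "ereal s < bt" "0 \<le> j s" shows "0 \<le> s * g s - 2 * G s"
proof -
  have "(\<lambda>s. s * g s - 2 * G s) 0 \<le> (\<lambda>s. s * g s - 2 * G s) s"
  proof (rule DERIV_nonneg_imp_increasing_open[of 0 s])
    fix x assume x: "0 < x" "x < s"
    then show "\<exists>y. ((\<lambda>s. s * g s - 2 * G s) has_real_derivative y) (at x) \<and> 0 \<le> y"
      using j_deriv_m[of x] j_pattern[of x s] assms by blast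
  qed (use assms in \<open>auto intro!: continuous_intros continuous_on_subset[OF g_cont] continuous_on_subset[OF G_cont]\<close>)
  then show ?thesis using G_0 by simp
qed

text \<open>If j(U r) >= 0, the term added to the positive Pohozaev function is nonnegative.
  Otherwise j(U) < 0 on the whole of (0, r], so U stays above b on (0, r); there g(U) > 0 and P j(U)
  > 0, both terms of the derivative of \<open>\<Theta>\<close> are positive, and
  \<open>\<Theta>\<close> grows from its value 0 at the origin.\<close>

lemma \<Theta>_pos: assumes "0 < r" shows "0 < \<Theta> r"
proof (cases "0 \<le> j (U r)")
  case True
  then have "0 \<le> U r * g (U r) - 2 * G (U r)" using m_nonneg[of "U r"] U_pos[of r] U_bt[of r] assms by simp
  then show ?thesis using pohozaev_pos[OF assms] assms unfolding \<Theta>_def by (intro add_pos_nonneg) auto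
next
  case False
  have neg: "j (U x) < 0" if "0 < x" "x \<le> r" for x
  proof (rule ccontr)
    assume "\<not> j (U x) < 0"
    then have "0 \<le> j (U r)" using j_pattern[of "U r" "U x"] U_pos[of r] U_strict[of x r] U_bt[of x] that assms
      by (cases "x = r") auto
    then show False using False by simp
  qed
  have "b < U x" if "0 < x" "x < r" for x
  proof (rule ccontr)
    assume "\<not> b < U x"
    then have "0 \<le> j (U x)" using j_nonneg_low[of "U x"] j_b U_pos[of x] that by (cases "U x = b") auto
    then show False using neg[of x] that by simp
  qed
  then have gp: "0 < g (U x)" if "0 < x" "x < r" for x using g_pos[of "U x"] U_bt[of x] that by simp
  have "\<Theta> 0 < \<Theta> r"
  proof (rule DERIV_pos_imp_increasing_open[OF assms])
    fix x assume x: "0 < x" "x < r"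
    have "0 < P x * j (U x)" using P_neg[OF x(1)] neg[of x] x by (simp add: mult_neg_neg)
    then have "0 < x * (P x * j (U x))" using x by simp
    moreover have "0 < 2 * g (U x) * U x" using gp[OF x] U_pos[of x] x by simp
    ultimately have "0 < 2 * g (U x) * U x + x * (P x * j (U x))" by (rule add_pos_pos[rotated])
    then have "0 < x ^ k * (2 * g (U x) * U x + x * P x * j (U x))"
      using x by (simp only: mult_pos_pos zero_less_power mult.assoc)
    then show "\<exists>y. (\<Theta> has_real_derivative y) (at x) \<and> 0 < y" using \<Theta>_deriv[OF x(1)] by blast
  qed (auto intro: continuous_on_subset[OF \<Theta>_cont])
  then show ?thesis unfolding \<Theta>_def using pohozaev_0 by simp
qed

definition \<theta> where "\<theta> r = - (r * P r) / U r"

lemma \<theta>_pos: "0 < r \<Longrightarrow> 0 < \<theta> r"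
  unfolding \<theta>_def using P_neg[of r] U_pos[of r] by (intro divide_pos_pos) (auto simp: mult_pos_neg)

lemma \<theta>_strict: assumes "0 < r" "r < t" shows "\<theta> r < \<theta> t"
proof (rule DERIV_pos_imp_increasing[OF assms(2)])
  fix x assume "r \<le> x" "x \<le> t"
  then have x: "0 < x" using assms by simp
  have U: "0 < U x" using U_pos x by simp
  have xk: "0 < x ^ k" using x by simp
  let ?D = "- ((1 - real k) * P x - x * g (U x)) * U x + x * P x * P x"
  have "((\<lambda>r. - (r * P r) / U r) has_real_derivative
      (- ((1 - real k) * P x - x * g (U x)) * U x - (- (x * P x)) * P x) / (U x * U x)) (at x)"
    by (intro DERIV_divide DERIV_minus rP_deriv U_deriv x) (use U in simp)
  then have 1: "(\<theta> has_real_derivative ?D / (U x * U x)) (at x)" unfolding \<theta>_def[abs_def] by simp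
  have "x ^ k * ?D = \<Theta> x"
    unfolding \<Theta>_def pohozaev_def by (simp add: field_simps power2_eq_square)
  then have "0 < ?D" using \<Theta>_pos[OF x] xk by (metis zero_less_mult_pos)
  then show "\<exists>y. (\<theta> has_real_derivative y) (at x) \<and> 0 < y" using U 1 by (blast intro: divide_pos_pos mult_pos_pos)
qed

definition v where "v \<beta> r = r * P r + \<beta> * U r"
definition dv where "dv \<beta> r = (\<beta> + 1 - real k) * P r - r * g (U r)"

lemma v_eq: "0 \<le> r \<Longrightarrow> v \<beta> r = U r * (\<beta> - \<theta> r)"
  unfolding v_def \<theta>_def using U_pos[of r] by (simp add: field_simps)

lemma v_deriv: assumes "0 < r" shows "(v \<beta> has_real_derivative dv \<beta> r) (at r)"
proof -
  have "((\<lambda>r. r * P r + \<beta> * U r) has_real_derivative (1 - real k) * P r - r * g (U r) + \<beta> * P r) (at r)"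
    by (intro DERIV_add DERIV_cmult rP_deriv U_deriv assms)
  then show ?thesis unfolding v_def[abs_def] dv_def by (simp add: algebra_simps)
qed

text \<open>Divergence form of the equation for v. After U'' has been eliminated, r^k dv is a
  combination of r^k P and r^(k+1) g(U), so only the first derivative of g occurs.\<close>

lemma kdv_deriv: assumes "0 < r"
  shows "((\<lambda>r. r ^ k * dv \<beta> r) has_real_derivative r ^ k * (ell \<beta> (U r) - g' (U r) * v \<beta> r)) (at r)"
proof -
  have "((\<lambda>r. (\<beta> + 1 - real k) * (r ^ k * P r) - r ^ (k + 1) * g (U r)) has_real_derivative
      (\<beta> + 1 - real k) * - (r ^ k * g (U r)) - ((real k + 1) * r ^ k * g (U r) + g' (U r) * P r * r ^ (k + 1))) (at r)"
    by (intro DERIV_diff DERIV_cmult DERIV_mult power_Suc_deriv kP_deriv gU_deriv assms)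
  moreover have "(\<beta> + 1 - real k) * - (r ^ k * g (U r)) - ((real k + 1) * r ^ k * g (U r) + g' (U r) * P r * r ^ (k + 1))
    = r ^ k * (ell \<beta> (U r) - g' (U r) * v \<beta> r)"
    by (simp add: ell_def j_def v_def algebra_simps)
  moreover have "(\<lambda>r. (\<beta> + 1 - real k) * (r ^ k * P r) - r ^ (k + 1) * g (U r)) = (\<lambda>r. r ^ k * dv \<beta> r)"
    unfolding dv_def by (auto simp: algebra_simps)
  ultimately show ?thesis by simp
qed

lemma rapid_v: "rapid (v \<beta>)" and rapid_dv: "rapid (dv \<beta>)"
proof -
  show "rapid (v \<beta>)" unfolding v_def[abs_def]
    using rapid_add[OF rapid_tempered_mult[OF rapid_P tempered_power[of 1]] rapid_cmult[OF rapid_U, of \<beta>]] by simp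
  show "rapid (dv \<beta>)" unfolding dv_def[abs_def]
    using rapid_add[OF rapid_cmult[OF rapid_P, of "\<beta> + 1 - real k"]
       rapid_cmult[OF rapid_tempered_mult[OF rapid_gU tempered_power[of 1]], of "-1"]] by simp
qed

end

section \<open>The linearized equation\<close>

lemma connected_nonzero_sign:
  fixes f :: "real \<Rightarrow> real"
  assumes "connected A" "continuous_on A f" "\<And>x. x \<in> A \<Longrightarrow> f x \<noteq> 0"
  shows "(\<forall>x\<in>A. f x > 0) \<or> (\<forall>x\<in>A. f x < 0)"
proof (rule ccontr)
  assume "\<not> ?thesis"
  then obtain x z where xz: "x \<in> A" "f x < 0" "z \<in> A" "f z > 0"
    using assms(3) by (meson linorder_neqE_linordered_idom)
  have "connected (f ` A)" by (rule connected_continuous_image[OF assms(2,1)])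
  from connectedD_interval[OF this, of "f x" "f z" 0] have "0 \<in> f ` A" using xz by auto
  then show False using assms(3) by auto
qed

text \<open>The point a is the last zero of f before c, or 0 if there is none: putting 0 into the
  set of zeros makes the supremum meaningful in both cases. Nonvanishing just before c keeps it
  below c.\<close>

lemma sign_interval_left:
  fixes f :: "real \<Rightarrow> real"
  assumes "0 < c" "continuous_on {0<..} f" "\<forall>\<^sub>F x in at_left c. f x \<noteq> 0"
  obtains a where "0 \<le> a" "a < c" "a = 0 \<or> f a = 0" "(\<forall>x. a < x \<longrightarrow> x < c \<longrightarrow> f x > 0) \<or> (\<forall>x. a < x \<longrightarrow> x < c \<longrightarrow> f x < 0)"
proof -
  obtain y0 where y0: "y0 < c" "\<And>y. y0 < y \<Longrightarrow> y < c \<Longrightarrow> f y \<noteq> 0"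
    using assms(3) unfolding eventually_at_left_field by auto
  define y where "y = max ((y0 + c) / 2) (c / 2)"
  have y: "0 < y" "y < c" "\<And>x. y \<le> x \<Longrightarrow> x < c \<Longrightarrow> f x \<noteq> 0"
  proof -
    show "0 < y" "y < c" using y0(1) assms(1) unfolding y_def by auto
    fix x assume "y \<le> x" "x < c"
    then show "f x \<noteq> 0" using y0 unfolding y_def by (auto simp: max_def split: if_splits)
  qed
  define S where "S = insert 0 {x \<in> {0<..y}. f x = 0}"
  have bdd: "bdd_above S" unfolding S_def using y(1) by (auto intro!: bdd_aboveI[of _ y])
  define a where "a = Sup S"
  have a0: "0 \<le> a" unfolding a_def using bdd by (rule cSup_upper[rotated]) (simp add: S_def)
  have ay: "a \<le> y" unfolding a_def by (rule cSup_least) (use y(1) in \<open>auto simp: S_def\<close>)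
  have fa: "a = 0 \<or> f a = 0"
  proof (cases "a = 0")
    case na: False
    have "f a = 0"
    proof (rule ccontr)
      assume "f a \<noteq> 0"
      have "isCont f a" using assms(2) a0 na by (simp add: continuous_on_eq_continuous_at)
      then have "\<forall>\<^sub>F x in at a. f x \<noteq> 0" unfolding isCont_def
        using \<open>f a \<noteq> 0\<close> tendsto_imp_eventually_ne by blast
      then obtain d where d: "0 < d" "\<And>x. x \<noteq> a \<Longrightarrow> dist x a < d \<Longrightarrow> f x \<noteq> 0"
        unfolding eventually_at by auto
      have "Sup S \<le> max 0 (a - d / 2)"
      proof (rule cSup_least)
        show "S \<noteq> {}" unfolding S_def by auto
        fix x assume x: "x \<in> S"
        show "x \<le> max 0 (a - d / 2)"
        proof (rule ccontr)
          assume n: "\<not> x \<le> max 0 (a - d / 2)"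
          then have fx: "f x = 0" "0 < x" using x unfolding S_def by auto
          have "x \<le> a" unfolding a_def using x bdd by (rule cSup_upper)
          then have "dist x a < d" using n d(1) by (auto simp: dist_real_def)
          then show False using d(2)[of x] fx \<open>f a \<noteq> 0\<close> by auto
        qed
      qed
      then show False using a0 na d(1) unfolding a_def[symmetric] by auto
    qed
    then show ?thesis by simp
  qed simp
  have nz: "f x \<noteq> 0" if "a < x" "x < c" for x
  proof (cases "x \<le> y")
    case True
    show ?thesis
    proof
      assume "f x = 0"
      then have "x \<in> S" using True that a0 unfolding S_def by auto
      then have "x \<le> a" unfolding a_def using bdd by (intro cSup_upper)
      then show False using that by simp
    qed
  next
    case False then show ?thesis using y(3) that by simp
  qed
  have "(\<forall>x\<in>{a<..<c}. f x > 0) \<or> (\<forall>x\<in>{a<..<c}. f x < 0)"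
    by (rule connected_nonzero_sign) (use nz a0 in \<open>auto intro: continuous_on_subset[OF assms(2)]\<close>)
  then have "(\<forall>x. a < x \<longrightarrow> x < c \<longrightarrow> f x > 0) \<or> (\<forall>x. a < x \<longrightarrow> x < c \<longrightarrow> f x < 0)" by auto
  then show thesis using that[of a] a0 ay y(2) fa by simp
qed

text \<open>Either there is a first zero d after c, with constant sign in between, or the sign is
  constant on the whole half-line. Nonvanishing just after c separates the infimum of the later
  zeros from c.\<close>

lemma sign_interval_right:
  fixes f :: "real \<Rightarrow> real"
  assumes "continuous_on {c..} f" "\<forall>\<^sub>F x in at_right c. f x \<noteq> 0"
  shows "(\<exists>d>c. f d = 0 \<and> ((\<forall>x. c < x \<longrightarrow> x < d \<longrightarrow> f x > 0) \<or> (\<forall>x. c < x \<longrightarrow> x < d \<longrightarrow> f x < 0)))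
      \<or> (\<forall>x>c. f x > 0) \<or> (\<forall>x>c. f x < 0)"
proof -
  have conn: "(\<forall>x\<in>A. f x > 0) \<or> (\<forall>x\<in>A. f x < 0)" if "connected A" "A \<subseteq> {c..}" "\<And>x. x \<in> A \<Longrightarrow> f x \<noteq> 0" for A
    by (rule connected_nonzero_sign[OF that(1) continuous_on_subset[OF assms(1) that(2)] that(3)])
  show ?thesis
  proof (cases "\<exists>x>c. f x = 0")
    case False
    have "(\<forall>x\<in>{c<..}. f x > 0) \<or> (\<forall>x\<in>{c<..}. f x < 0)" by (rule conn) (use False in auto)
    then show ?thesis by auto
  next
    case True
    obtain e where e: "c < e" "\<And>x. c < x \<Longrightarrow> x < e \<Longrightarrow> f x \<noteq> 0"
      using assms(2) unfolding eventually_at_right_field by auto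
    define S where "S = {x \<in> {e..}. f x = 0}"
    have "S \<noteq> {}" using True e unfolding S_def by (force simp: not_less)
    moreover have "closed S" unfolding S_def
      by (rule continuous_closed_preimage_constant) (use e in \<open>auto intro: continuous_on_subset[OF assms(1)]\<close>)
    moreover have bdd: "bdd_below S" unfolding S_def by (auto intro!: bdd_belowI[of _ e])
    ultimately have i: "Inf S \<in> S" by (intro closed_contains_Inf)
    have nz: "f x \<noteq> 0" if "c < x" "x < Inf S" for x
    proof
      assume "f x = 0"
      then have "x \<in> S" using e(2)[of x] that unfolding S_def by force
      then show False using cInf_lower[OF _ bdd, of x] that by simp
    qed
    have "(\<forall>x\<in>{c<..<Inf S}. f x > 0) \<or> (\<forall>x\<in>{c<..<Inf S}. f x < 0)" by (rule conn) (use nz in auto)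
    moreover have "c < Inf S" "f (Inf S) = 0" using i e(1) unfolding S_def[symmetric] by (auto simp: S_def)
    ultimately show ?thesis by (intro disjI1 exI[of _ "Inf S"]) auto
  qed
qed

text \<open>Gronwall for w^2 + q^2 on a compact interval [a, c] inside r > 0 containing both points,
  where the singular coefficient k / r is at most k / a.\<close>

lemma second_order_zero:
  fixes w q h :: "real \<Rightarrow> real"
  assumes wd: "\<And>y. 0 < y \<Longrightarrow> (w has_real_derivative q y) (at y)"
    and qd: "\<And>y. 0 < y \<Longrightarrow> (q has_real_derivative - (real k / y) * q y - h y) (at y)"
    and h: "\<And>y. 0 < y \<Longrightarrow> \<bar>h y\<bar> \<le> L * \<bar>w y\<bar>" and L: "0 \<le> L"
    and r: "0 < r" "w r = 0" "q r = 0" and x: "0 < x"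
  shows "w x = 0"
proof -
  define a where "a = min r x"
  define c where "c = max r x"
  have ac: "0 < a" "a \<le> r" "a \<le> x" "r \<le> c" "x \<le> c" using r x unfolding a_def c_def by auto
  have abs3: "\<bar>A - C - D\<bar> \<le> \<bar>A\<bar> + \<bar>C\<bar> + \<bar>D\<bar>" for A C D :: real by linarith
  have "(w x)\<^sup>2 + (q x)\<^sup>2 = 0"
  proof (rule gronwall_zero[where Z = "\<lambda>x. (w x)\<^sup>2 + (q x)\<^sup>2" and a = a and c = c and z = r and C = "1 + L + 2 * real k / a"
      and Z' = "\<lambda>x. 2 * w x * q x + 2 * q x * (- (real k / x) * q x - h x)"])
    fix y assume y: "a \<le> y" "y \<le> c"
    have y0: "0 < y" using y ac by simp
    show "((\<lambda>x. (w x)\<^sup>2 + (q x)\<^sup>2) has_real_derivative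
       2 * w y * q y + 2 * q y * (- (real k / y) * q y - h y)) (at y)"
      using wd[OF y0] qd[OF y0] by (auto intro!: derivative_eq_intros)
    let ?S = "(w y)\<^sup>2 + (q y)\<^sup>2"
    have 1: "\<bar>2 * w y * q y\<bar> \<le> ?S"
      using sum_squares_bound[of "\<bar>w y\<bar>" "\<bar>q y\<bar>"] by (simp add: abs_mult)
    have "\<bar>2 * q y\<bar> * \<bar>h y\<bar> \<le> \<bar>2 * q y\<bar> * (L * \<bar>w y\<bar>)"
      by (rule mult_left_mono[OF h[OF y0]]) simp
    also have "\<dots> = L * \<bar>2 * w y * q y\<bar>" by (simp add: abs_mult mult_ac)
    also have "\<dots> \<le> L * ?S" by (rule mult_left_mono[OF 1 L])
    finally have 2: "\<bar>2 * q y * h y\<bar> \<le> L * ?S" by (simp add: abs_mult)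
    have "real k / y \<le> real k / a" using y ac by (intro divide_left_mono) auto
    then have "2 * (real k / y) * (q y)\<^sup>2 \<le> 2 * (real k / a) * ?S"
      using ac y0 by (intro mult_mono) auto
    then have 3: "\<bar>2 * q y * (real k / y) * q y\<bar> \<le> 2 * real k / a * ?S"
      using y0 by (simp add: abs_mult power2_eq_square mult_ac)
    have "2 * w y * q y + 2 * q y * (- (real k / y) * q y - h y)
      = 2 * w y * q y - 2 * q y * (real k / y) * q y - 2 * q y * h y" by (simp add: algebra_simps)
    also have "\<bar>\<dots>\<bar> \<le> \<bar>2 * w y * q y\<bar> + \<bar>2 * q y * (real k / y) * q y\<bar> + \<bar>2 * q y * h y\<bar>" by (rule abs3)
    also have "\<dots> \<le> ?S + 2 * real k / a * ?S + L * ?S" by (intro add_mono 1 2 3)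
    also have "\<dots> = (1 + L + 2 * real k / a) * ?S" by (simp add: distrib_right)
    finally show "\<bar>2 * w y * q y + 2 * q y * (- (real k / y) * q y - h y)\<bar> \<le> (1 + L + 2 * real k / a) * ?S" .
  qed (use ac r in auto)
  then show ?thesis by simp
qed

section \<open>Wronskian comparison of linearized solutions with \<open>v\<close>\<close>

context ground_state begin

text \<open>At the origin only the two weighted limits are required, not boundedness of w or q: this
  is what the ball integrals of a weak eigenfunction provide, and it is just enough for the boundary
  terms of the Wronskians. Nontriviality is part of the notion.\<close>

definition lin_sol :: "(real \<Rightarrow> real) \<Rightarrow> (real \<Rightarrow> real) \<Rightarrow> bool" where
  "lin_sol w q \<longleftrightarrow>
     (\<forall>r>0. (w has_real_derivative q r) (at r)) \<and>
     (\<forall>r>0. ((\<lambda>r. r ^ k * q r) has_real_derivative - (r ^ k * (g' (U r) * w r))) (at r)) \<and>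
     ((\<lambda>r. r ^ k * q r) \<longlongrightarrow> 0) (at_right 0) \<and> ((\<lambda>r. r ^ (k + 1) * w r) \<longlongrightarrow> 0) (at_right 0) \<and>
     (\<exists>r>0. w r \<noteq> 0)"

lemma lin_sol_minus: assumes "lin_sol w q" shows "lin_sol (\<lambda>r. - w r) (\<lambda>r. - q r)"
proof -
  have "((\<lambda>r. r ^ k * (- q r)) has_real_derivative - (r ^ k * (g' (U r) * (- w r)))) (at r)" if "0 < r" for r
    using DERIV_minus[of "\<lambda>r. r ^ k * q r" _ r] assms that unfolding lin_sol_def by fastforce
  moreover have "((\<lambda>r. r ^ k * (- q r)) \<longlongrightarrow> 0) (at_right 0)" "((\<lambda>r. r ^ (k + 1) * (- w r)) \<longlongrightarrow> 0) (at_right 0)"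
    using tendsto_minus[of "\<lambda>r. r ^ k * q r" 0] tendsto_minus[of "\<lambda>r. r ^ (k + 1) * w r" 0] assms
    unfolding lin_sol_def by auto
  ultimately show ?thesis using assms unfolding lin_sol_def by (auto intro: DERIV_minus)
qed

lemma lin_sol_isCont: assumes "lin_sol w q" shows "continuous_on {0<..} w" "continuous_on {0<..} q"
proof -
  show "continuous_on {0<..} w" using assms unfolding lin_sol_def
    by (auto intro!: continuous_at_imp_continuous_on DERIV_isCont)
  have "isCont q r" if "0 < r" for r
    using weighted_deriv[OF that, of k q "g' (U r) * w r"] assms that unfolding lin_sol_def by (auto intro: DERIV_isCont)
  then show "continuous_on {0<..} q" by (auto intro!: continuous_at_imp_continuous_on)
qed

lemma lin_sol_q_deriv: assumes "lin_sol w q" "0 < r"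
  shows "(q has_real_derivative - (real k / r) * q r - g' (U r) * w r) (at r)"
  using weighted_deriv[OF assms(2), of k q "g' (U r) * w r"] assms unfolding lin_sol_def by auto

lemma lin_sol_simple_zero: assumes "lin_sol w q" "0 < r" "w r = 0" shows "q r \<noteq> 0"
proof
  assume q0: "q r = 0"
  obtain L where L: "0 \<le> L" "\<And>r. 0 \<le> r \<Longrightarrow> \<bar>g' (U r)\<bar> \<le> L" using U_lipschitz_bound by metis
  have "w x = 0" if "0 < x" for x
  proof (rule second_order_zero[of w q k "\<lambda>x. g' (U x) * w x" L r x])
    fix y :: real assume y: "0 < y"
    show "\<bar>g' (U y) * w y\<bar> \<le> L * \<bar>w y\<bar>" unfolding abs_mult using L(2)[of y] y by (intro mult_right_mono) auto
  qed (use assms L lin_sol_q_deriv[OF assms(1)] q0 that in \<open>auto simp: lin_sol_def\<close>)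
  then show False using assms(1) unfolding lin_sol_def by auto
qed

lemma lin_sol_isolated: assumes "lin_sol w q" "0 < r" "w r = 0" shows "\<forall>\<^sub>F x in at r. w x \<noteq> 0"
proof -
  have "(w has_real_derivative q r) (at r)" using assms unfolding lin_sol_def by auto
  then have "((\<lambda>x. (w x - w r) / (x - r)) \<longlongrightarrow> q r) (at r)" by (simp add: has_field_derivative_iff)
  then have "\<forall>\<^sub>F x in at r. (w x - w r) / (x - r) \<noteq> 0"
    using lin_sol_simple_zero[OF assms] by (rule tendsto_imp_eventually_ne)
  then show ?thesis by eventually_elim (use assms(3) in auto)
qed

text \<open>The Wronskian of \<open>v \<beta>\<close> and w with weight r^k. The potential terms
  cancel in its derivative, which leaves only the source \<open>ell\<close> times w.\<close>

definition W where "W \<beta> w q r = (r ^ k * dv \<beta> r) * w r - v \<beta> r * (r ^ k * q r)"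

lemma W_deriv: assumes "lin_sol w q" "0 < r"
  shows "(W \<beta> w q has_real_derivative r ^ k * ell \<beta> (U r) * w r) (at r)"
proof -
  have "(W \<beta> w q has_real_derivative (r ^ k * (ell \<beta> (U r) - g' (U r) * v \<beta> r)) * w r + q r * (r ^ k * dv \<beta> r)
     - (dv \<beta> r * (r ^ k * q r) + (- (r ^ k * (g' (U r) * w r))) * v \<beta> r)) (at r)"
    unfolding W_def[abs_def] using assms(1)
    by (intro DERIV_diff DERIV_mult kdv_deriv v_deriv assms(2)) (auto simp: lin_sol_def assms(2))
  then show ?thesis by (simp add: algebra_simps)
qed

lemma U_right: "(U \<longlongrightarrow> U 0) (at_right 0)" "((\<lambda>r. g (U r)) \<longlongrightarrow> g (U 0)) (at_right 0)" "(P \<longlongrightarrow> 0) (at_right 0)"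
  using U_cont gU_cont P_cont P_0 unfolding continuous_on
  by (metis atLeast_iff order_refl at_within_Ici_at_right)+

text \<open>The factor r^k dv w is rewritten as r^(k+1) w times dv / r; the first tends to 0 and the
  second has a finite limit by \<open>P_slope\<close>. The other product contains r^k q, which tends
  to 0, and the bounded v.\<close>

lemma W_lim0: assumes "lin_sol w q" shows "(W \<beta> w q \<longlongrightarrow> 0) (at_right 0)"
proof -
  have a: "((\<lambda>r. (\<beta> + 1 - real k) * (P r / r) - g (U r)) \<longlongrightarrow> (\<beta> + 1 - real k) * (- g (U 0) / (real k + 1)) - g (U 0)) (at_right 0)"
    by (intro tendsto_intros P_slope U_right)
  have "((\<lambda>r. (r ^ (k + 1) * w r) * ((\<beta> + 1 - real k) * (P r / r) - g (U r)) - v \<beta> r * (r ^ k * q r)) \<longlongrightarrow> 0 - 0) (at_right 0)"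
  proof (rule tendsto_diff)
    show "((\<lambda>r. (r ^ (k + 1) * w r) * ((\<beta> + 1 - real k) * (P r / r) - g (U r))) \<longlongrightarrow> 0) (at_right 0)"
      using tendsto_mult[OF _ a, of "\<lambda>r. r ^ (k + 1) * w r" 0] assms unfolding lin_sol_def by simp
    have "((\<lambda>r. v \<beta> r) \<longlongrightarrow> 0 * 0 + \<beta> * U 0) (at_right 0)" unfolding v_def
      by (intro tendsto_intros U_right)
    moreover have "((\<lambda>r. r ^ k * q r) \<longlongrightarrow> 0) (at_right 0)" using assms unfolding lin_sol_def by auto
    ultimately show "((\<lambda>r. v \<beta> r * (r ^ k * q r)) \<longlongrightarrow> 0) (at_right 0)" using tendsto_mult by fastforce
  qed
  then have "((\<lambda>r. (r ^ (k + 1) * w r) * ((\<beta> + 1 - real k) * (P r / r) - g (U r)) - v \<beta> r * (r ^ k * q r)) \<longlongrightarrow> 0) (at_right 0)"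
    by simp
  then show ?thesis
    by (rule Lim_transform_eventually)
       (rule eventually_mono[OF at_right_0_pos], simp add: W_def dv_def field_simps)
qed

lemma W_lim_top: assumes "tempered w" "tempered q" shows "(W \<beta> w q \<longlongrightarrow> 0) at_top"
proof -
  have 1: "rapid (\<lambda>r. (r ^ k * w r) * dv \<beta> r)"
    by (rule rapid_tempered_mult[OF rapid_dv tempered_mult[OF tempered_power assms(1)]])
  have 2: "rapid (\<lambda>r. (r ^ k * q r) * v \<beta> r)"
    by (rule rapid_tempered_mult[OF rapid_v tempered_mult[OF tempered_power assms(2)]])
  have "((\<lambda>r. (r ^ k * w r) * dv \<beta> r - (r ^ k * q r) * v \<beta> r) \<longlongrightarrow> 0 - 0) at_top"
    by (intro tendsto_diff rapid_tendsto 1 2)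
  then show ?thesis unfolding W_def[abs_def] by (simp add: mult_ac)
qed

end

lemma increasing_imp_isCont_less:
  fixes f :: "real \<Rightarrow> real"
  assumes "a < c" "\<And>x. a \<le> x \<Longrightarrow> x \<le> c \<Longrightarrow> (f has_real_derivative f' x) (at x)"
    "\<And>x. a < x \<Longrightarrow> x < c \<Longrightarrow> 0 < f' x"
  shows "f a < f c"
proof (rule DERIV_pos_imp_increasing_open[OF assms(1)])
  fix x assume "a < x" "x < c"
  then show "\<exists>y. (f has_real_derivative y) (at x) \<and> 0 < y" using assms(2)[of x] assms(3)[of x] by auto
qed (auto intro!: continuous_at_imp_continuous_on DERIV_isCont assms(2))

context ground_state begin

lemma W_zero: assumes "0 < r" "w r = 0" shows "W (\<theta> r) w q r = 0"
  unfolding W_def using assms v_eq[of r "\<theta> r"] by simp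

text \<open>The Wronskian vanishes at r1 and strictly decreases on (a, r1), the source being
  negative there. If a = 0, it would start from the limit 0 and could not end at 0. If a is a zero
  of w, it is positive at a; as v(a) > 0 this means q(a) < 0, although w > 0 to the right of
  a.\<close>

lemma no_positive_left:
  assumes lin: "lin_sol w q" and "0 \<le> a" "a < r1" "w r1 = 0" "a = 0 \<or> w a = 0"
    and pos: "\<And>x. a < x \<Longrightarrow> x < r1 \<Longrightarrow> 0 < w x" and ell: "ell (\<theta> r1) (U r1) \<le> 0"
  shows False
proof -
  have r1: "0 < r1" using assms by simp
  let ?\<beta> = "\<theta> r1" let ?W = "W (\<theta> r1) w q"
  have \<beta>: "0 < ?\<beta>" using \<theta>_pos r1 by simp
  have neg: "ell ?\<beta> (U x) < 0" if "0 < x" "x < r1" for x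
  proof (rule ccontr)
    assume "\<not> ell ?\<beta> (U x) < 0"
    then have "0 < ell ?\<beta> (U r1)"
      using ell_pattern[of ?\<beta> "U r1" "U x"] \<beta> U_pos[of r1] U_strict[of x r1] U_bt[of x] that by auto
    then show False using ell by simp
  qed
  have dec: "?W y < ?W x" if "a \<le> x" "0 < x" "x < y" "y \<le> r1" for x y
  proof -
    have "- ?W x < - ?W y"
    proof (rule increasing_imp_isCont_less[where f = "\<lambda>x. - ?W x"])
      fix z assume "x \<le> z" "z \<le> y"
      then show "((\<lambda>x. - ?W x) has_real_derivative - (z ^ k * ell ?\<beta> (U z) * w z)) (at z)"
        using W_deriv[OF lin, of z] that by (intro DERIV_minus) auto
    next
      fix z assume z: "x < z" "z < y"
      have "0 < z ^ k * (- ell ?\<beta> (U z)) * w z" using neg[of z] pos[of z] z that by (intro mult_pos_pos) auto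
      then show "0 < - (z ^ k * ell ?\<beta> (U z) * w z)" by simp
    qed (use that in auto)
    then show ?thesis by simp
  qed
  have W1: "?W r1 = 0" using W_zero[of r1 w q] assms(4) r1 by simp
  show False
  proof (cases "a = 0")
    case True
    have "?W (r1 / 2) \<le> 0"
    proof (rule tendsto_lowerbound[OF W_lim0[OF lin, of ?\<beta>]])
      have "\<forall>\<^sub>F x in at_right 0. x \<in> {0<..<r1 / 2}" by (rule eventually_at_right_real) (use r1 in simp)
      then show "\<forall>\<^sub>F x in at_right 0. ?W (r1 / 2) \<le> ?W x"
        by eventually_elim (use dec True r1 in \<open>auto intro!: less_imp_le\<close>)
    qed simp
    then show False using dec[of "r1 / 2" r1] W1 True r1 by simp
  next
    case False
    then have a: "0 < a" "w a = 0" using assms by auto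
    have "0 < ?W a" using dec[of a r1] W1 a assms(3) by simp
    then have "v ?\<beta> a * (a ^ k * q a) < 0" unfolding W_def using a by simp
    moreover have "0 < v ?\<beta> a" using v_eq[of a ?\<beta>] U_pos[of a] \<theta>_strict[of a r1] a assms(3) by simp
    ultimately have "q a < 0" using a by (auto simp: mult_less_0_iff zero_less_mult_iff)
    then obtain d where d: "0 < d" "\<And>h. 0 < h \<Longrightarrow> h < d \<Longrightarrow> w (a + h) < w a"
      using DERIV_neg_dec_right[of w "q a" a] lin a unfolding lin_sol_def by blast
    define h where "h = min (d / 2) ((r1 - a) / 2)"
    have "0 < h" "h < d" "a + h < r1" using d assms(3) unfolding h_def by (auto simp: min_def field_simps)
    then show False using d(2)[of h] pos[of "a + h"] a by simp
  qed
qed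

text \<open>The source is nonnegative at r1, so \<open>ell_pattern\<close> and the decrease of U
  make it positive everywhere to the right; the Wronskian grows as long as w > 0.\<close>

lemma right_facts:
  assumes lin: "lin_sol w q" and r1: "0 < r1" "w r1 = 0" and ell: "0 \<le> ell (\<theta> r1) (U r1)"
    and pos: "\<And>x. r1 < x \<Longrightarrow> x < d \<Longrightarrow> 0 < w x" and y: "r1 \<le> x" "x < y" "y \<le> d"
  shows "W (\<theta> r1) w q x < W (\<theta> r1) w q y"
proof (rule increasing_imp_isCont_less[OF y(2)])
  let ?\<beta> = "\<theta> r1"
  fix z assume "x \<le> z" "z \<le> y"
  then show "(W (\<theta> r1) w q has_real_derivative z ^ k * ell ?\<beta> (U z) * w z) (at z)"
    using W_deriv[OF lin, of z] r1 y by auto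
next
  let ?\<beta> = "\<theta> r1"
  fix z assume z: "x < z" "z < y"
  have "0 < ell ?\<beta> (U z)"
    using ell_pattern[of ?\<beta> "U z" "U r1"] \<theta>_pos[of r1] U_pos[of z] U_strict[of r1 z] U_bt[of r1] ell z y r1 by simp
  then show "0 < z ^ k * ell ?\<beta> (U z) * w z" using pos[of z] z y r1 by (intro mult_pos_pos) auto
qed

text \<open>The Wronskian is positive at d and v(d) < 0, so q(d) > 0, although w descends to 0 from
  positive values.\<close>

lemma no_positive_right:
  assumes lin: "lin_sol w q" and r1: "0 < r1" "w r1 = 0" and ell: "0 \<le> ell (\<theta> r1) (U r1)"
    and pos: "\<And>x. r1 < x \<Longrightarrow> x < d \<Longrightarrow> 0 < w x" and d: "r1 < d" "w d = 0"
  shows False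
proof -
  have "0 < W (\<theta> r1) w q d"
    using right_facts[OF lin r1 ell pos, of d r1 d] W_zero[of r1 w q] r1 d by simp
  then have "v (\<theta> r1) d * (d ^ k * q d) < 0" unfolding W_def using d by simp
  moreover have "v (\<theta> r1) d < 0"
    using v_eq[of d "\<theta> r1"] U_pos[of d] \<theta>_strict[of r1 d] r1 d by (simp add: mult_pos_neg)
  moreover have "0 < d ^ k" using r1 d by simp
  ultimately have "0 < q d" using r1 d by (simp add: mult_less_0_iff zero_less_mult_iff)
  then obtain e where e: "0 < e" "\<And>h. 0 < h \<Longrightarrow> h < e \<Longrightarrow> w (d - h) < w d"
    using DERIV_pos_inc_left[of w "q d" d] lin d r1 unfolding lin_sol_def by (metis less_trans)
  define h where "h = min (e / 2) ((d - r1) / 2)"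
  have "0 < h" "h < e" "r1 < d - h" using e d unfolding h_def by (auto simp: min_def field_simps)
  then show False using e(2)[of h] pos[of "d - h"] d by simp
qed

text \<open>Infinity takes the place of the second zero: the Wronskian increases strictly from 0 at
  r1, but tends to 0 because v and its derivative are \<open>rapid\<close>.\<close>

lemma no_positive_right_tempered:
  assumes lin: "lin_sol w q" and r1: "0 < r1" "w r1 = 0" and ell: "0 \<le> ell (\<theta> r1) (U r1)"
    and pos: "\<And>x. r1 < x \<Longrightarrow> 0 < w x" and t: "tempered w" "tempered q"
  shows False
proof -
  let ?W = "W (\<theta> r1) w q"
  have inc: "?W x < ?W y" if "r1 \<le> x" "x < y" for x y
    using right_facts[OF lin r1 ell pos, of y x y] that by simp
  have "?W (r1 + 1) \<le> 0"
  proof (rule tendsto_lowerbound[OF W_lim_top[OF t, of "\<theta> r1"]])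
    show "\<forall>\<^sub>F x in at_top. ?W (r1 + 1) \<le> ?W x"
      using eventually_gt_at_top[of "r1 + 1"] by eventually_elim (use inc in \<open>auto intro!: less_imp_le\<close>)
  qed simp
  then show False using inc[of r1 "r1 + 1"] W_zero[of r1 w q] r1 by simp
qed

text \<open>A negative source at r1 would permit the comparison on the left, applied to w or - w on
  its sign interval ending at r1, and that comparison is contradictory.\<close>

lemma zero_alternative:
  assumes lin: "lin_sol w q" and r1: "0 < r1" "w r1 = 0"
  shows "0 \<le> ell (\<theta> r1) (U r1)"
proof (rule ccontr)
  assume n: "\<not> ?thesis"
  have iso: "\<forall>\<^sub>F x in at_left r1. w x \<noteq> 0" using lin_sol_isolated[OF lin r1] unfolding eventually_at_split by simp
  obtain a where a: "0 \<le> a" "a < r1" "a = 0 \<or> w a = 0"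
     "(\<forall>x. a < x \<longrightarrow> x < r1 \<longrightarrow> w x > 0) \<or> (\<forall>x. a < x \<longrightarrow> x < r1 \<longrightarrow> w x < 0)"
    by (rule sign_interval_left[OF r1(1) lin_sol_isCont(1)[OF lin] iso])
  from a(4) show False
  proof
    assume "\<forall>x. a < x \<longrightarrow> x < r1 \<longrightarrow> w x > 0"
    then show False using no_positive_left[OF lin a(1,2) r1(2) a(3)] n by auto
  next
    assume "\<forall>x. a < x \<longrightarrow> x < r1 \<longrightarrow> w x < 0"
    then show False using no_positive_left[OF lin_sol_minus[OF lin] a(1,2)] a(3) r1(2) n by auto
  qed
qed

lemma after_zero:
  assumes lin: "lin_sol w q" and r1: "0 < r1" "w r1 = 0"
  shows "(\<forall>x>r1. w x > 0) \<or> (\<forall>x>r1. w x < 0)" and "\<not> (tempered w \<and> tempered q)"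
proof -
  have ell: "0 \<le> ell (\<theta> r1) (U r1)" by (rule zero_alternative[OF lin r1])
  have m: "lin_sol (\<lambda>r. - w r) (\<lambda>r. - q r)" by (rule lin_sol_minus[OF lin])
  have iso: "\<forall>\<^sub>F x in at_right r1. w x \<noteq> 0" using lin_sol_isolated[OF lin r1] unfolding eventually_at_split by simp
  have c: "continuous_on {r1..} w" using lin_sol_isCont(1)[OF lin] by (rule continuous_on_subset) (use r1 in auto)
  have "\<not> (\<exists>d>r1. w d = 0 \<and> ((\<forall>x. r1 < x \<longrightarrow> x < d \<longrightarrow> w x > 0) \<or> (\<forall>x. r1 < x \<longrightarrow> x < d \<longrightarrow> w x < 0)))"
    using no_positive_right[OF lin r1 ell] no_positive_right[OF m r1(1) _ ell] r1(2) by auto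
  then show 1: "(\<forall>x>r1. w x > 0) \<or> (\<forall>x>r1. w x < 0)"
    using sign_interval_right[OF c iso] by blast
  show "\<not> (tempered w \<and> tempered q)"
  proof
    assume t: "tempered w \<and> tempered q"
    then have "tempered (\<lambda>r. - w r)" "tempered (\<lambda>r. - q r)" unfolding tempered_def by auto
    then show False using 1 no_positive_right_tempered[OF lin r1 ell] no_positive_right_tempered[OF m r1(1) _ ell] r1(2) t by auto
  qed
qed

section \<open>Comparison with U' for solutions without zeros\<close>

definition dP where "dP r = - (real k / r) * P r - g (U r)"
text \<open>The weighted Wronskian of P and w. Differentiating the radial equation shows that P
  solves the linearized equation up to the term k P / r^2, whose sign is known since P < 0.\<close>

definition B where "B w q r = (r ^ k * dP r) * w r - P r * (r ^ k * q r)"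

lemma kdP_deriv: assumes r: "0 < r"
  shows "((\<lambda>r. r ^ k * dP r) has_real_derivative real k * r ^ k / r\<^sup>2 * P r - r ^ k * (g' (U r) * P r)) (at r)"
proof -
  have pw: "((\<lambda>r. r ^ k) has_real_derivative real k * r ^ k / r) (at r)"
  proof -
    have "real k * r ^ (k - Suc 0) = real k * r ^ k / r" using r k1 by (cases k) auto
    then show ?thesis using DERIV_pow[of k r] by simp
  qed
  have "((\<lambda>r. - real k * ((r ^ k * P r) / r) - r ^ k * g (U r)) has_real_derivative
     - real k * ((- (r ^ k * g (U r)) * r - (r ^ k * P r) * 1) / (r * r)) - (real k * r ^ k / r * g (U r) + g' (U r) * P r * r ^ k)) (at r)"
    by (intro DERIV_diff DERIV_cmult DERIV_divide DERIV_mult DERIV_ident pw kP_deriv gU_deriv r) (use r in simp)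
  moreover have "- real k * ((- (r ^ k * g (U r)) * r - (r ^ k * P r) * 1) / (r * r)) - (real k * r ^ k / r * g (U r) + g' (U r) * P r * r ^ k)
     = real k * r ^ k / r\<^sup>2 * P r - r ^ k * (g' (U r) * P r)"
    using r by (simp add: field_simps power2_eq_square)
  moreover have "(\<lambda>r. - real k * ((r ^ k * P r) / r) - r ^ k * g (U r)) = (\<lambda>r. r ^ k * dP r)"
    unfolding dP_def by (auto simp: algebra_simps)
  ultimately show ?thesis by metis
qed

lemma B_deriv: assumes "lin_sol w q" "0 < r"
  shows "(B w q has_real_derivative real k * r ^ k / r\<^sup>2 * P r * w r) (at r)"
proof -
  have dPd: "(P has_real_derivative dP r) (at r)" unfolding dP_def by (rule P_deriv[OF assms(2)])
  have "(B w q has_real_derivative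
     (real k * r ^ k / r\<^sup>2 * P r - r ^ k * (g' (U r) * P r)) * w r + q r * (r ^ k * dP r)
     - (dP r * (r ^ k * q r) + (- (r ^ k * (g' (U r) * w r))) * P r)) (at r)"
    unfolding B_def[abs_def] using assms(1)
    by (intro DERIV_diff DERIV_mult kdP_deriv dPd assms(2)) (auto simp: lin_sol_def assms(2))
  then show ?thesis by (simp add: algebra_simps)
qed

lemma rapid_dP: "rapid dP"
proof -
  have "tempered (\<lambda>r. - (real k / r))"
    by (rule temperedI[of 1 _ "real k" 0]) (auto simp: divide_le_eq mult_le_cancel_left1)
  from rapid_add[OF rapid_tempered_mult[OF rapid_P this] rapid_cmult[OF rapid_gU, of "-1"]]
  show ?thesis unfolding dP_def[abs_def] by simp
qed

context
  fixes w q assumes lin: "lin_sol w q" and pos: "\<And>r. 0 < r \<Longrightarrow> 0 < w r"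
begin

lemma B_dec: assumes "0 < x" "x < y" shows "B w q y < B w q x"
proof -
  have "- B w q x < - B w q y"
  proof (rule increasing_imp_isCont_less[where f = "\<lambda>x. - B w q x", OF assms(2)])
    fix z assume "x \<le> z" "z \<le> y"
    then show "((\<lambda>x. - B w q x) has_real_derivative - (real k * z ^ k / z\<^sup>2 * P z * w z)) (at z)"
      using B_deriv[OF lin, of z] assms by (intro DERIV_minus) auto
  next
    fix z assume z: "x < z" "z < y"
    have "0 < real k * z ^ k / z\<^sup>2 * (- P z) * w z"
      using P_neg[of z] pos[of z] z assms k1 by (intro mult_pos_pos divide_pos_pos) auto
    then show "0 < - (real k * z ^ k / z\<^sup>2 * P z * w z)" by simp
  qed
  then show ?thesis by simp
qed

text \<open>The term r^k dP w need not tend to 0 at the origin, since only r^(k+1) w is controlled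
  there. But dP tends to - g(U 0) / (k + 1) < 0, so this term is negative near 0, and the remaining
  one tends to 0; strict decrease then gives B < 0.\<close>

lemma B_neg: assumes "0 < x" shows "B w q x < 0"
proof -
  have "((\<lambda>r. - real k * (P r / r) - g (U r)) \<longlongrightarrow> - real k * (- g (U 0) / (real k + 1)) - g (U 0)) (at_right 0)"
    by (intro tendsto_intros P_slope U_right)
  moreover have "- real k * (- g (U 0) / (real k + 1)) - g (U 0) < 0" using g_U0 by (simp add: field_simps)
  ultimately have "\<forall>\<^sub>F r in at_right 0. - real k * (P r / r) - g (U r) < 0" by (rule order_tendstoD(2))
  then have dPn: "\<forall>\<^sub>F r in at_right 0. dP r < 0" by eventually_elim (simp add: dP_def)
  have "((\<lambda>r. - P r * (r ^ k * q r)) \<longlongrightarrow> - 0 * 0) (at_right 0)"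
    using lin unfolding lin_sol_def by (intro tendsto_intros U_right) auto
  then have l: "((\<lambda>r. - P r * (r ^ k * q r)) \<longlongrightarrow> 0) (at_right 0)" by simp
  have "B w q (x / 2) \<le> 0"
  proof (rule tendsto_lowerbound[OF l])
    have "\<forall>\<^sub>F y in at_right 0. y \<in> {0<..<x / 2}" by (rule eventually_at_right_real) (use assms in simp)
    then show "\<forall>\<^sub>F y in at_right 0. B w q (x / 2) \<le> - P y * (y ^ k * q y)"
      using dPn
    proof eventually_elim
      case (elim y)
      have "B w q (x / 2) < B w q y" using B_dec[of y "x / 2"] elim by simp
      moreover have "(y ^ k * dP y) * w y < 0" using elim pos[of y] by (simp add: mult_pos_neg mult_neg_pos)
      ultimately show ?case unfolding B_def by simp
    qed
  qed simp
  then show ?thesis using B_dec[of "x / 2" x] assms by simp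
qed

text \<open>For tempered w and q the Wronskian would tend to 0 at infinity, whereas it is negative
  and decreasing.\<close>

lemma positive_not_tempered: "\<not> (tempered w \<and> tempered q)"
proof
  assume t: "tempered w \<and> tempered q"
  have 1: "rapid (\<lambda>r. (r ^ k * w r) * dP r)"
    by (rule rapid_tempered_mult[OF rapid_dP tempered_mult[OF tempered_power]]) (use t in simp)
  have 2: "rapid (\<lambda>r. (r ^ k * q r) * P r)"
    by (rule rapid_tempered_mult[OF rapid_P tempered_mult[OF tempered_power]]) (use t in simp)
  have "((\<lambda>r. (r ^ k * w r) * dP r - (r ^ k * q r) * P r) \<longlongrightarrow> 0 - 0) at_top"
    by (intro tendsto_diff rapid_tendsto 1 2)
  then have l: "(B w q \<longlongrightarrow> 0) at_top" unfolding B_def[abs_def] by (simp add: mult_ac)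
  have "0 \<le> B w q 1"
  proof (rule tendsto_upperbound[OF l])
    show "\<forall>\<^sub>F x in at_top. B w q x \<le> B w q 1"
      using eventually_gt_at_top[of 1] by eventually_elim (use B_dec in \<open>auto intro!: less_imp_le\<close>)
  qed simp
  then show False using B_neg[of 1] by simp
qed

text \<open>The derivative of w / (- P) has the sign of the Wronskian \<open>B\<close>, so this
  quotient is nonincreasing. It follows that a positive w is bounded by a multiple of - P, which
  tends to 0.\<close>

lemma positive_bound: assumes "1 \<le> r" shows "w r \<le> (w 1 / (- P 1)) * (- P r)"
proof -
  have "w r / (- P r) \<le> w 1 / (- P 1)"
  proof (rule DERIV_nonpos_imp_nonincreasing[OF assms])
    fix x :: real assume "1 \<le> x" "x \<le> r"
    then have x: "0 < x" by simp
    have dPd: "(P has_real_derivative dP x) (at x)" unfolding dP_def by (rule P_deriv[OF x])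
    have wd: "(w has_real_derivative q x) (at x)" using lin x unfolding lin_sol_def by auto
    have d: "((\<lambda>x. w x / - P x) has_real_derivative (q x * - P x - w x * (- dP x)) / (- P x * - P x)) (at x)"
      by (intro DERIV_divide DERIV_minus dPd wd) (use P_neg[OF x] in simp)
    have "x ^ k * (q x * - P x - w x * (- dP x)) = B w q x" unfolding B_def by (simp add: algebra_simps)
    then have "x ^ k * (q x * - P x - w x * (- dP x)) < 0" using B_neg[OF x] by simp
    then have "q x * - P x - w x * (- dP x) < 0" using x by (simp add: mult_less_0_iff)
    then have "(q x * - P x - w x * (- dP x)) / (- P x * - P x) \<le> 0"
      by (intro divide_nonpos_nonneg) auto
    then show "\<exists>y. ((\<lambda>x. w x / - P x) has_real_derivative y) (at x) \<and> y \<le> 0" using d by blast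
  qed
  then show ?thesis using P_neg[of r] assms by (simp only: pos_divide_le_eq neg_0_less_iff_less)
qed

end

theorem lin_sol_not_tempered: assumes "lin_sol w q" shows "\<not> (tempered w \<and> tempered q)"
proof (cases "\<exists>r>0. w r = 0")
  case True then show ?thesis using after_zero(2)[OF assms] by auto
next
  case False
  have "(\<forall>r\<in>{0<..}. 0 < w r) \<or> (\<forall>r\<in>{0<..}. w r < 0)"
    by (rule connected_nonzero_sign) (use False lin_sol_isCont[OF assms] in auto)
  then have "(\<forall>r>0. 0 < w r) \<or> (\<forall>r>0. w r < 0)" by auto
  then show ?thesis
  proof
    assume "\<forall>r>0. 0 < w r" then show ?thesis using positive_not_tempered[OF assms] by blast
  next
    assume "\<forall>r>0. w r < 0"
    then have "\<not> (tempered (\<lambda>r. - w r) \<and> tempered (\<lambda>r. - q r))"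
      using positive_not_tempered[OF lin_sol_minus[OF assms]] by auto
    then show ?thesis unfolding tempered_def by simp
  qed
qed

text \<open>Far out g'(U) <= 0, so w cannot oscillate: as soon as w w' > 0, it stays so. That this
  happens at all follows because otherwise w would be tempered. Of the two resulting signs, the
  positive one is excluded by the Sturm comparison if w has a zero and by
  \<open>positive_bound\<close> if it has none.\<close>

theorem lin_sol_eventually_neg:
  assumes lin: "lin_sol w q" and near: "\<forall>\<^sub>F r in at_right 0. 0 < w r"
  obtains R where "0 < R" "\<And>r. R \<le> r \<Longrightarrow> w r < 0" "\<And>r. R \<le> r \<Longrightarrow> q r < 0"
proof -
  obtain a \<delta> where a: "0 < a" "0 < \<delta>" "\<And>s. 0 \<le> s \<Longrightarrow> s \<le> \<delta> \<Longrightarrow> g' s \<le> - a" using g_small by metis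
  have "\<forall>\<^sub>F r in at_top. U r < \<delta>" by (rule order_tendstoD(2)[OF U_lim a(2)])
  then obtain R0 where R0: "\<And>r. r \<ge> R0 \<Longrightarrow> U r < \<delta>" unfolding eventually_at_top_linorder by auto
  define R1 where "R1 = max R0 1"
  have R1: "1 \<le> R1" using R0 unfolding R1_def by auto
  have g'n: "g' (U r) \<le> 0" if "r \<ge> R1" for r
    using R0[of r] a(3)[of "U r"] a(1) U_pos[of r] that unfolding R1_def by simp
  have wd: "(w has_real_derivative q r) (at r)" if "0 < r" for r using lin that unfolding lin_sol_def by auto
  have qd: "((\<lambda>r. r ^ k * q r) has_real_derivative - (r ^ k * (g' (U r) * w r))) (at r)" if "0 < r" for r
    using lin that unfolding lin_sol_def by auto
  \<comment> \<open>Otherwise w^2 is nonincreasing, so w is bounded; integrating the equation for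
    r^k q then bounds q by a power, and \<open>lin_sol_not_tempered\<close> is violated.\<close>
  have "\<exists>R\<ge>R1. 0 < w R * q R"
  proof (rule ccontr)
    assume "\<not> ?thesis"
    then have np: "w r * q r \<le> 0" if "r \<ge> R1" for r using that by force
    have wb: "\<bar>w r\<bar> \<le> \<bar>w R1\<bar>" if "r \<ge> R1" for r
    proof -
      have "(w r)\<^sup>2 \<le> (w R1)\<^sup>2"
      proof (rule DERIV_nonpos_imp_nonincreasing[OF that])
        fix x assume x: "R1 \<le> x" "x \<le> r"
        then have "((\<lambda>r. (w r)\<^sup>2) has_real_derivative 2 * (w x * q x)) (at x)"
          using R1 by (auto intro!: derivative_eq_intros wd)
        then show "\<exists>y. ((\<lambda>r. (w r)\<^sup>2) has_real_derivative y) (at x) \<and> y \<le> 0" using np[OF x(1)] by (intro exI[of _ "2 * (w x * q x)"]) (simp add: mult.commute)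
      qed
      then show ?thesis by (simp add: abs_le_square_iff)
    qed
    obtain L where L: "0 \<le> L" "\<And>r. 0 \<le> r \<Longrightarrow> \<bar>g' (U r)\<bar> \<le> L" using U_lipschitz_bound by metis
    let ?M = "L * \<bar>w R1\<bar>"
    have "tempered w" by (rule temperedI[of R1 _ "\<bar>w R1\<bar>" 0]) (use wb in auto)
    moreover have "tempered q"
    proof (rule temperedI[of R1 _ "\<bar>R1 ^ k * q R1\<bar> + ?M" "k + 1"])
      fix r assume r: "r \<ge> R1"
      have "\<bar>r ^ k * q r - R1 ^ k * q R1\<bar> \<le> ?M * r ^ (k + 1) - ?M * R1 ^ (k + 1)"
      proof (rule deriv_bound_compare[OF r, where f = "\<lambda>r. r ^ k * q r" and B = "\<lambda>r. ?M * r ^ (k + 1)"])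
        show "continuous_on {R1..r} (\<lambda>r. r ^ k * q r)"
          by (intro continuous_intros continuous_on_subset[OF lin_sol_isCont(2)[OF lin]]) (use R1 in auto)
        show "continuous_on {R1..r} (\<lambda>r. ?M * r ^ (k + 1))" by (intro continuous_intros)
        fix x assume x: "R1 < x" "x < r"
        show "((\<lambda>r. r ^ k * q r) has_real_derivative - (x ^ k * (g' (U x) * w x))) (at x)" using qd[of x] x R1 by simp
        show "((\<lambda>r. ?M * r ^ (k + 1)) has_real_derivative ?M * ((real k + 1) * x ^ k)) (at x)"
          by (intro DERIV_cmult power_Suc_deriv)
        have "\<bar>g' (U x)\<bar> * \<bar>w x\<bar> \<le> L * \<bar>w R1\<bar>" using L wb[of x] x R1 by (intro mult_mono) auto
        then have "x ^ k * (\<bar>g' (U x)\<bar> * \<bar>w x\<bar>) \<le> x ^ k * ?M" using x R1 by (intro mult_left_mono) auto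
        also have "\<dots> \<le> ?M * ((real k + 1) * x ^ k)" using x R1 L(1) by (simp add: algebra_simps)
        finally show "\<bar>- (x ^ k * (g' (U x) * w x))\<bar> \<le> ?M * ((real k + 1) * x ^ k)"
          using x R1 by (simp add: abs_mult)
      qed
      moreover have "0 \<le> ?M * R1 ^ (k + 1)" using L R1 by (intro mult_nonneg_nonneg) auto
      moreover have "1 \<le> r ^ (k + 1)" by (rule one_le_power) (use r R1 in simp)
      then have "\<bar>R1 ^ k * q R1\<bar> * 1 \<le> \<bar>R1 ^ k * q R1\<bar> * r ^ (k + 1)" by (intro mult_left_mono) auto
      ultimately have "\<bar>r ^ k * q r\<bar> \<le> (\<bar>R1 ^ k * q R1\<bar> + ?M) * r ^ (k + 1)" by (simp only: distrib_right)
      moreover have "\<bar>q r\<bar> * 1 \<le> \<bar>q r\<bar> * r ^ k" by (intro mult_left_mono one_le_power) (use r R1 in auto)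
      then have "\<bar>q r\<bar> \<le> \<bar>r ^ k * q r\<bar>" using r R1 by (simp add: abs_mult mult.commute)
      ultimately show "\<bar>q r\<bar> \<le> (\<bar>R1 ^ k * q R1\<bar> + ?M) * r ^ (k + 1)" by simp
    qed
    ultimately show False using lin_sol_not_tempered[OF lin] by simp
  qed
  then obtain R where R: "R1 \<le> R" "0 < w R * q R" by auto
  have R0: "0 < R" using R R1 by simp
  \<comment> \<open>The derivative of r^k q w is r^k (q^2 - g'(U) w^2), which is nonnegative in this
    range.\<close>
  have wq: "0 < w r * q r" if "R \<le> r" for r
  proof -
    have "R ^ k * q R * w R \<le> r ^ k * q r * w r"
    proof (rule DERIV_nonneg_imp_nondecreasing[OF that, of "\<lambda>r. r ^ k * q r * w r"])
      fix x assume x: "R \<le> x" "x \<le> r"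
      then have x0: "0 < x" "R1 \<le> x" using R0 R by auto
      have "((\<lambda>r. r ^ k * q r * w r) has_real_derivative - (x ^ k * (g' (U x) * w x)) * w x + q x * (x ^ k * q x)) (at x)"
        by (intro DERIV_mult qd wd x0)
      moreover have "0 \<le> (- g' (U x)) * (w x * w x)"
        using g'n[OF x0(2)] by (intro mult_nonneg_nonneg[OF _ zero_le_square]) auto
      then have "0 \<le> x ^ k * ((- g' (U x)) * (w x * w x) + q x * q x)"
        using x0 by (intro mult_nonneg_nonneg[OF zero_le_power add_nonneg_nonneg[OF _ zero_le_square]]) auto
      ultimately show "\<exists>y. ((\<lambda>r. r ^ k * q r * w r) has_real_derivative y) (at x) \<and> 0 \<le> y"
        by (intro exI conjI) (assumption, simp add: algebra_simps)
    qed
    moreover have "0 < R ^ k * (q R * w R)" using R R0 by (simp add: mult.commute)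
    ultimately have "0 < r ^ k * (q r * w r)" by (simp add: mult.assoc)
    then show ?thesis using that R0 by (simp add: zero_less_mult_iff mult.commute)
  qed
  \<comment> \<open>If w(R) were positive, a zero r1 would lie before R and force a second zero,
    because w is positive near 0 and at R but changes sign at r1. Without zeros, w would be
    increasing from R on and yet tend to 0.\<close>
  have wn: "w R < 0"
  proof (rule ccontr)
    assume "\<not> w R < 0"
    then have wR: "0 < w R" using R by (auto simp: zero_less_mult_iff)
    have zero_between: "\<exists>z. x < z \<and> z < y \<and> w z = 0" if "0 < x" "x < y" "w x * w y < 0" for x y
    proof -
      have c: "continuous_on {x..y} w" using lin_sol_isCont(1)[OF lin] by (rule continuous_on_subset) (use that in auto)
      have "\<exists>z\<ge>x. z \<le> y \<and> w z = 0"
        using IVT'[of w x 0 y, OF _ _ _ c] IVT2'[of w y 0 x, OF _ _ _ c] that by (fastforce simp: mult_less_0_iff)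
      then show ?thesis using that by (metis less_irrefl mult_zero_left mult_zero_right order_le_less)
    qed
    obtain e where e: "0 < e" "\<And>x. 0 < x \<Longrightarrow> x < e \<Longrightarrow> 0 < w x"
      using near unfolding eventually_at_right_field by auto
    show False
    proof (cases "\<exists>r>0. w r = 0")
      case True
      then obtain r1 where r1: "0 < r1" "w r1 = 0" by auto
      have nz: "w x \<noteq> 0" if "r1 < x" for x using after_zero(1)[OF lin r1] that by force
      have "r1 < R"
      proof (rule ccontr)
        assume "\<not> r1 < R" then show False using wq[of r1] r1 by simp
      qed
      have er: "e \<le> r1" using e(2)[of r1] r1 by force
      have q0: "q r1 \<noteq> 0" by (rule lin_sol_simple_zero[OF lin r1])
      \<comment> \<open>A simple zero is a sign change. If q(r1) > 0, w is negative just before r1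
        and an earlier zero exists; if q(r1) < 0, w is negative just after r1 and a later zero
        exists. Both contradict \<open>after_zero\<close>.\<close>
      show False
      proof (cases "0 < q r1")
        case True
        then obtain d where d: "0 < d" "\<And>h. 0 < h \<Longrightarrow> h < d \<Longrightarrow> w (r1 - h) < w r1"
          using DERIV_pos_inc_left[OF wd[OF r1(1)]] by auto
        define h where "h = min (d / 2) (r1 / 2)"
        define y where "y = min (e / 2) ((r1 - h) / 2)"
        have h: "0 < h" "h < d" "h < r1" using d r1 unfolding h_def by auto
        have y: "0 < y" "y < e" "y < r1 - h" using e h unfolding y_def by (auto simp: min_def field_simps)
        have "w y * w (r1 - h) < 0" using e(2)[OF y(1,2)] d(2)[OF h(1,2)] r1 by (simp add: mult_pos_neg)
        then obtain z where z: "y < z" "z < r1 - h" "w z = 0" using zero_between[of y "r1 - h"] y by auto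
        have "0 < z" "z < r1" using z y h by auto
        then have "0 < w r1 \<or> w r1 < 0" using after_zero(1)[OF lin _ z(3)] by blast
        then show False using r1 by simp
      next
        case False
        then have "q r1 < 0" using q0 by simp
        then obtain d where d: "0 < d" "\<And>h. 0 < h \<Longrightarrow> h < d \<Longrightarrow> w (r1 + h) < w r1"
          using DERIV_neg_dec_right[OF wd[OF r1(1)]] by auto
        define h where "h = min (d / 2) ((R - r1) / 2)"
        have h: "0 < h" "h < d" "r1 + h < R" using d \<open>r1 < R\<close> unfolding h_def by (auto simp: min_def field_simps)
        have "w (r1 + h) * w R < 0" using d(2)[OF h(1,2)] r1 wR by (simp add: mult_neg_pos)
        then obtain z where "r1 + h < z" "w z = 0" using zero_between[of "r1 + h" R] h r1 by auto
        then show False using nz[of z] h by simp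
      qed
    next
      case False
      have pos: "0 < w r" if "0 < r" for r
      proof (rule ccontr)
        assume "\<not> 0 < w r"
        then have "w r < 0" using False that by force
        define y where "y = min (e / 2) (r / 2)"
        have y: "0 < y" "y < e" "y < r" using e that unfolding y_def by auto
        have "w y * w r < 0" using e(2)[OF y(1,2)] \<open>w r < 0\<close> by (simp add: mult_pos_neg)
        then show False using zero_between[of y r] y False by (meson less_trans)
      qed
      have qp: "0 < q r" if "R \<le> r" for r using wq[OF that] pos[of r] that R0 by (simp add: zero_less_mult_iff)
      have "w R \<le> w r" if "R \<le> r" for r
      proof (rule DERIV_nonneg_imp_nondecreasing[OF that, of w])
        fix x assume "R \<le> x" "x \<le> r"
        then show "\<exists>y. (w has_real_derivative y) (at x) \<and> 0 \<le> y" using wd[of x] qp[of x] R0 by (auto intro: less_imp_le)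
      qed
      then have lb: "w R \<le> (w 1 / (- P 1)) * (- P r)" if "R \<le> r" for r
        using positive_bound[OF lin pos, of r] that R R1 by force
      have "((\<lambda>r. (w 1 / (- P 1)) * (- P r)) \<longlongrightarrow> (w 1 / (- P 1)) * (- 0)) at_top"
        by (intro tendsto_intros rapid_tendsto[OF rapid_P])
      then have "w R \<le> (w 1 / (- P 1)) * (- 0)"
        by (rule tendsto_lowerbound) (rule eventually_mono[OF eventually_ge_at_top[of R] lb], simp_all)
      then show False using wR by simp
    qed
  qed
  have neg: "w r < 0" if rR: "R \<le> r" for r
  proof (rule ccontr)
    assume n: "\<not> w r < 0"
    have c: "continuous_on {R..r} w" using lin_sol_isCont(1)[OF lin] by (rule continuous_on_subset) (use R0 in auto)
    obtain z where "R \<le> z" "w z = 0" using IVT'[of w R 0 r, OF _ _ rR c] wn n by auto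
    then show False using wq[of z] by simp
  qed
  show thesis
  proof (rule that[OF R0 neg])
    fix r assume "R \<le> r" then show "q r < 0" using wq[of r] neg[of r] by (auto simp: zero_less_mult_iff)
  qed
qed

end

section \<open>Existence for the radial initial value problem\<close>

text \<open>Solves (r^k p)' = r^k h with p(0) = 0; the value 0 for r <= 0 is the limit at the
  origin.\<close>

definition radial_avg :: "nat \<Rightarrow> (real \<Rightarrow> real) \<Rightarrow> real \<Rightarrow> real" where
  "radial_avg k h r = (if r \<le> 0 then 0 else integral {0..r} (\<lambda>s. s ^ k * h s) / r ^ k)"

lemma has_derivative_integral_Ici:
  fixes f :: "real \<Rightarrow> real"
  assumes "continuous_on {0..} f" "0 < r"
  shows "((\<lambda>x. integral {0..x} f) has_real_derivative f r) (at r)"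
proof -
  have "((\<lambda>x. integral {0..x} f) has_real_derivative f r) (at r within {0..r+1})"
    by (rule integral_has_real_derivative) (use assms in \<open>auto intro: continuous_on_subset[OF assms(1)]\<close>)
  then show ?thesis using at_within_interior[of r "{0..r+1}"] assms by simp
qed

lemma continuous_on_integral_Ici:
  fixes f :: "real \<Rightarrow> real"
  assumes "continuous_on {0..} f"
  shows "continuous_on {0..} (\<lambda>x. integral {0..x} f)"
proof -
  have "continuous_on {0..c} (\<lambda>x. integral {0..x} f)" for c
    by (rule indefinite_integral_continuous_1 integrable_continuous_interval)+
       (rule continuous_on_subset[OF assms], auto)
  then have "continuous (at x within {0..}) (\<lambda>x. integral {0..x} f)" if "0 \<le> x" for x
  proof -
    have "continuous (at x within {0..x+1}) (\<lambda>x. integral {0..x} f)"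
      using \<open>\<And>c. continuous_on {0..c} (\<lambda>x. integral {0..x} f)\<close>[of "x+1"] that
      by (auto simp: continuous_on_eq_continuous_within)
    moreover have "at x within {0..x+1} = at x within {0..}"
      by (rule at_within_nhd[of x "{..<x+1}"]) auto
    ultimately show ?thesis by (simp add: continuous_within)
  qed
  then show ?thesis by (auto simp: continuous_on_eq_continuous_within)
qed

lemma radial_avg_deriv:
  assumes "continuous_on {0..} h" "0 < r"
  shows "((\<lambda>r. r ^ k * radial_avg k h r) has_real_derivative r ^ k * h r) (at r)"
proof (rule has_field_derivative_transform_within_open[where S = "{0<..}"])
  show "((\<lambda>x. integral {0..x} (\<lambda>s. s ^ k * h s)) has_real_derivative r ^ k * h r) (at r)"
    by (rule has_derivative_integral_Ici[OF _ assms(2)]) (intro continuous_intros assms(1))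
qed (use assms in \<open>auto simp: radial_avg_def\<close>)

text \<open>As (x^k \<beta>)' >= x^k \<beta>' for \<beta> >= 0, any such primitive of a bound for
  |h| bounds the average; the weight r^k drops out.\<close>

lemma radial_avg_bound:
  assumes h: "continuous_on {0..} h" and \<beta>: "\<And>x. 0 < x \<Longrightarrow> x < r \<Longrightarrow> (\<beta> has_real_derivative \<beta>' x) (at x)"
    "continuous_on {0..} \<beta>" "\<And>x. 0 \<le> x \<Longrightarrow> x \<le> r \<Longrightarrow> 0 \<le> \<beta> x" and le: "\<And>x. 0 < x \<Longrightarrow> x < r \<Longrightarrow> \<bar>h x\<bar> \<le> \<beta>' x" and "0 \<le> r"
  shows "\<bar>radial_avg k h r\<bar> \<le> \<beta> r"
proof (cases "r = 0")
  case True then show ?thesis using \<beta>(3)[of 0] by (simp add: radial_avg_def)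
next
  case False
  then have r: "0 < r" using assms by simp
  let ?I = "\<lambda>x. integral {0..x} (\<lambda>s. s ^ k * h s)"
  have c: "continuous_on {0..} (\<lambda>s. s ^ k * h s)" by (intro continuous_intros h)
  have "\<bar>?I r - ?I 0\<bar> \<le> r ^ k * \<beta> r - 0 ^ k * \<beta> 0"
  proof (rule deriv_bound_compare[where f = ?I and B = "\<lambda>x. x ^ k * \<beta> x"])
    show "0 \<le> r" by fact
    show "continuous_on {0..r} ?I"
      by (rule continuous_on_subset[OF continuous_on_integral_Ici[OF c]]) auto
    show "continuous_on {0..r} (\<lambda>x. x ^ k * \<beta> x)"
      by (intro continuous_intros continuous_on_subset[OF \<beta>(2)]) auto
    fix x assume x: "0 < x" "x < r"
    show "(?I has_real_derivative x ^ k * h x) (at x)" by (rule has_derivative_integral_Ici[OF c x(1)])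
    show "((\<lambda>x. x ^ k * \<beta> x) has_real_derivative real k * x ^ (k - 1) * \<beta> x + \<beta>' x * x ^ k) (at x)"
      using DERIV_mult[OF DERIV_pow \<beta>(1)[OF x], of k] by simp
    have "\<bar>x ^ k\<bar> * \<bar>h x\<bar> \<le> \<beta>' x * x ^ k" using mult_left_mono[OF le[OF x], of "x ^ k"] x by (simp add: mult.commute)
    moreover have "0 \<le> real k * x ^ (k - 1) * \<beta> x" using x \<beta>(3)[of x] by simp
    ultimately show "\<bar>x ^ k * h x\<bar> \<le> real k * x ^ (k - 1) * \<beta> x + \<beta>' x * x ^ k"
      unfolding abs_mult by linarith
  qed
  moreover have "0 \<le> 0 ^ k * \<beta> 0" using \<beta>(3)[of 0] r by simp
  ultimately have "\<bar>?I r\<bar> \<le> r ^ k * \<beta> r" by simp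
  then show ?thesis using r by (simp add: radial_avg_def abs_mult divide_le_eq mult.commute)
qed

lemma radial_avg_cont:
  assumes h: "continuous_on {0..} h"
  shows "continuous_on {0..} (radial_avg k h)"
proof -
  have "continuous (at x within {0..}) (radial_avg k h)" if "0 \<le> x" for x
  proof (cases "x = 0")
    case False
    then have x: "0 < x" using that by simp
    have "((\<lambda>r. (r ^ k * radial_avg k h r) / r ^ k) has_real_derivative
       (x ^ k * h x * x ^ k - (x ^ k * radial_avg k h x) * (real k * x ^ (k - Suc 0))) / (x ^ k * x ^ k)) (at x)"
      by (rule DERIV_divide[OF radial_avg_deriv[OF h x] DERIV_pow]) (use x in simp)
    then have "(radial_avg k h has_real_derivative
       (x ^ k * h x * x ^ k - (x ^ k * radial_avg k h x) * (real k * x ^ (k - Suc 0))) / (x ^ k * x ^ k)) (at x)"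
      by (rule has_field_derivative_transform_within_open[where S = "{0<..}"]) (use x in auto)
    then show ?thesis by (metis DERIV_isCont continuous_at_imp_continuous_at_within)
  next
    case True
    have "compact (h ` {0..1})"
      by (rule compact_continuous_image) (auto intro: continuous_on_subset[OF h])
    then obtain M where M: "\<And>x. x \<in> {0..1} \<Longrightarrow> \<bar>h x\<bar> \<le> M"
      by (metis compact_imp_bounded bounded_iff imageI real_norm_def)
    have M0: "0 \<le> M" using M[of 0] by auto
    have le: "\<bar>radial_avg k h r\<bar> \<le> M * r" if "0 \<le> r" "r \<le> 1" for r
      by (rule radial_avg_bound[OF h, where \<beta>' = "\<lambda>_. M"])
         (use that M M0 in \<open>auto intro!: derivative_eq_intros continuous_intros\<close>)
    have "(radial_avg k h \<longlongrightarrow> 0) (at 0 within {0..})"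
    proof (rule Lim_null_comparison)
      show "((\<lambda>r. M * r) \<longlongrightarrow> 0) (at 0 within {0..})" by (auto intro!: tendsto_eq_intros)
      have "\<forall>\<^sub>F r in at 0 within {0..}. (r::real) \<in> {0..} \<and> r < 1"
        unfolding eventually_at by (intro exI[of _ 1]) (auto simp: dist_real_def)
      then show "\<forall>\<^sub>F r in at 0 within {0..}. norm (radial_avg k h r) \<le> M * r"
        by eventually_elim (use le in auto)
    qed
    then show ?thesis using True by (simp add: continuous_within radial_avg_def)
  qed
  then show ?thesis by (auto simp: continuous_on_eq_continuous_within)
qed

text \<open>Each of the two integrations of exp(\<kappa> x) gains a factor 1 / \<kappa>, which
  produces the contraction in the existence proof.\<close>

lemma integral_radial_avg_bound:
  assumes h: "continuous_on {0..} h" and le: "\<And>x. 0 \<le> x \<Longrightarrow> \<bar>h x\<bar> \<le> D * exp (\<kappa> * x)" and "0 < \<kappa>" "0 \<le> D" "0 \<le> r"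
  shows "\<bar>integral {0..r} (radial_avg k h)\<bar> \<le> D / \<kappa>\<^sup>2 * exp (\<kappa> * r)"
proof -
  have 1: "\<bar>radial_avg k h x\<bar> \<le> D / \<kappa> * exp (\<kappa> * x)" if "0 \<le> x" for x
    by (rule radial_avg_bound[OF h, where \<beta>' = "\<lambda>x. D * exp (\<kappa> * x)"])
       (use assms that in \<open>auto intro!: derivative_eq_intros continuous_intros\<close>)
  note c = radial_avg_cont[OF h, of k]
  have "\<bar>integral {0..r} (radial_avg k h) - integral {0..0} (radial_avg k h)\<bar> \<le> D / \<kappa>\<^sup>2 * exp (\<kappa> * r) - D / \<kappa>\<^sup>2 * exp (\<kappa> * 0)"
  proof (rule deriv_bound_compare[where f = "\<lambda>x. integral {0..x} (radial_avg k h)" and B = "\<lambda>x. D / \<kappa>\<^sup>2 * exp (\<kappa> * x)"])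
    show "0 \<le> r" by fact
    show "continuous_on {0..r} (\<lambda>x. integral {0..x} (radial_avg k h))"
      by (rule continuous_on_subset[OF continuous_on_integral_Ici[OF c]]) auto
    show "continuous_on {0..r} (\<lambda>x. D / \<kappa>\<^sup>2 * exp (\<kappa> * x))" by (intro continuous_intros)
    fix x assume x: "0 < x" "x < r"
    show "((\<lambda>x. integral {0..x} (radial_avg k h)) has_real_derivative radial_avg k h x) (at x)"
      by (rule has_derivative_integral_Ici[OF c x(1)])
    show "((\<lambda>x. D / \<kappa>\<^sup>2 * exp (\<kappa> * x)) has_real_derivative D / \<kappa> * exp (\<kappa> * x)) (at x)"
      using assms(3) by (auto intro!: derivative_eq_intros simp: power2_eq_square)
    show "\<bar>radial_avg k h x\<bar> \<le> D / \<kappa> * exp (\<kappa> * x)" using 1[of x] x by simp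
  qed
  moreover have "0 \<le> D / \<kappa>\<^sup>2" using assms by simp
  ultimately show ?thesis by simp
qed

lemma radial_avg_diff:
  assumes "continuous_on {0..} h" "continuous_on {0..} f"
  shows "radial_avg k (\<lambda>x. h x - f x) r = radial_avg k h r - radial_avg k f r"
proof -
  have "(\<lambda>s. s ^ k * h s) integrable_on {0..r}" "(\<lambda>s. s ^ k * f s) integrable_on {0..r}"
    by (intro integrable_continuous_interval continuous_intros continuous_on_subset[OF assms(1)]
          continuous_on_subset[OF assms(2)]; force)+
  from integral_diff[OF this] show ?thesis
    unfolding radial_avg_def by (simp add: right_diff_distrib diff_divide_distrib)
qed

text \<open>Banach's fixed point theorem for z = exp(- \<kappa> r) u in the bounded continuous
  functions. In this weighted norm the solution operator has Lipschitz constant L / \<kappa>^2 <=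
  1/2, so a global Lipschitz bound yields a solution on the whole half-line at once.\<close>

theorem rad_ode_exists:
  fixes f :: "real \<Rightarrow> real \<Rightarrow> real"
  assumes cont: "\<And>u. continuous_on {0..} u \<Longrightarrow> continuous_on {0..} (\<lambda>r. f r (u r))"
    and lip: "\<And>r x y. 0 \<le> r \<Longrightarrow> \<bar>f r x - f r y\<bar> \<le> L * \<bar>x - y\<bar>"
    and bd: "\<And>r. 0 \<le> r \<Longrightarrow> \<bar>f r 0\<bar> \<le> M"
  obtains u p where "rad_ode k u p (\<lambda>r. f r (u r))" "u 0 = d"
proof -
  have L0: "0 \<le> L" using lip[of 0 1 0] by auto
  have M0: "0 \<le> M" using bd[of 0] by auto
  define \<kappa> where "\<kappa> = 2 * L + 1"
  have \<kappa>: "0 < \<kappa>" "L / \<kappa>\<^sup>2 \<le> 1 / 2" "1 \<le> \<kappa>"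
  proof -
    show "0 < \<kappa>" "1 \<le> \<kappa>" using L0 unfolding \<kappa>_def by auto
    have "2 * L \<le> \<kappa>\<^sup>2" using L0 unfolding \<kappa>_def by (simp add: power2_eq_square algebra_simps)
    then show "L / \<kappa>\<^sup>2 \<le> 1 / 2" using \<open>0 < \<kappa>\<close> by (simp add: divide_le_eq)
  qed
  define \<psi> :: "(real \<Rightarrow>\<^sub>C real) \<Rightarrow> real \<Rightarrow> real" where "\<psi> z = (\<lambda>r. exp (\<kappa> * r) * apply_bcontfun z r)" for z
  define hh where "hh z = (\<lambda>r. f r (\<psi> z r))" for z
  have \<psi>c: "continuous_on {0..} (\<psi> z)" for z unfolding \<psi>_def by (intro continuous_intros) auto
  have hc: "continuous_on {0..} (hh z)" for z unfolding hh_def by (rule cont[OF \<psi>c])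
  define TT where "TT z = (\<lambda>r. d - integral {0..r} (radial_avg k (hh z)))" for z
  have TTc: "continuous_on {0..} (TT z)" for z unfolding TT_def
    by (intro continuous_intros continuous_on_integral_Ici radial_avg_cont hc)
  \<comment> \<open>The space consists of functions on the whole line; \<open>max 0 r\<close>
    extends the iterate from the half-line by a constant.\<close>
  define S where "S z = (\<lambda>r. exp (- \<kappa> * max 0 r) * TT z (max 0 r))" for z
  have Sb: "S z \<in> bcontfun" for z
  proof (rule bcontfun_normI)
    show "continuous_on UNIV (S z)" unfolding S_def
      by (intro continuous_intros continuous_on_compose2[OF TTc]) auto
    define D where "D = M + L * norm z"
    have D0: "0 \<le> D" unfolding D_def using M0 L0 by simp
    have hb: "\<bar>hh z x\<bar> \<le> D * exp (\<kappa> * x)" if "0 \<le> x" for x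
    proof -
      have "\<bar>hh z x\<bar> \<le> M + L * \<bar>\<psi> z x\<bar>" using lip[OF that, of "\<psi> z x" 0] bd[OF that] unfolding hh_def by auto
      also have "\<dots> \<le> M * exp (\<kappa> * x) + L * (exp (\<kappa> * x) * norm z)"
      proof (intro add_mono mult_left_mono L0)
        show "M \<le> M * exp (\<kappa> * x)" using M0 that \<kappa> by (simp add: mult_le_cancel_left1)
        show "\<bar>\<psi> z x\<bar> \<le> exp (\<kappa> * x) * norm z" unfolding \<psi>_def abs_mult
          using norm_bounded[of z x] by (intro mult_mono) auto
      qed
      finally show ?thesis unfolding D_def by (simp add: algebra_simps)
    qed
    fix r :: real
    let ?m = "max 0 r"
    have "\<bar>TT z ?m\<bar> \<le> \<bar>d\<bar> + D / \<kappa>\<^sup>2 * exp (\<kappa> * ?m)"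
      using integral_radial_avg_bound[OF hc hb \<kappa>(1) D0, of ?m k] unfolding TT_def by auto
    then have "exp (- \<kappa> * ?m) * \<bar>TT z ?m\<bar> \<le> exp (- \<kappa> * ?m) * (\<bar>d\<bar> + D / \<kappa>\<^sup>2 * exp (\<kappa> * ?m))"
      by (intro mult_left_mono) auto
    also have "\<dots> = exp (- \<kappa> * ?m) * \<bar>d\<bar> + D / \<kappa>\<^sup>2" by (simp add: algebra_simps exp_minus)
    also have "exp (- \<kappa> * ?m) * \<bar>d\<bar> \<le> 1 * \<bar>d\<bar>" using \<kappa>(1) by (intro mult_right_mono) auto
    finally show "norm (S z r) \<le> \<bar>d\<bar> + D / \<kappa>\<^sup>2" unfolding S_def by (simp add: abs_mult)
  qed
  define F where "F z = Bcontfun (S z)" for z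
  have F: "apply_bcontfun (F z) = S z" for z unfolding F_def by (rule Bcontfun_inverse[OF Sb])
  have "\<exists>!z. F z = z"
  proof (rule banach_fix_type[of "1/2"])
    show "\<forall>x y. dist (F x) (F y) \<le> 1 / 2 * dist x y"
    proof (intro allI dist_bound)
      fix y z :: "real \<Rightarrow>\<^sub>C real" and r :: real
      let ?m = "max 0 r" let ?D = "L * dist y z"
      have hb: "\<bar>hh y x - hh z x\<bar> \<le> ?D * exp (\<kappa> * x)" if "0 \<le> x" for x
      proof -
        have "\<bar>hh y x - hh z x\<bar> \<le> L * \<bar>\<psi> y x - \<psi> z x\<bar>" unfolding hh_def by (rule lip[OF that])
        also have "\<bar>\<psi> y x - \<psi> z x\<bar> = exp (\<kappa> * x) * \<bar>y x - z x\<bar>"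
          unfolding \<psi>_def by (simp add: right_diff_distrib[symmetric] abs_mult)
        also have "L * \<dots> \<le> L * (exp (\<kappa> * x) * dist y z)"
          using dist_bounded[of y x z] L0 by (intro mult_left_mono) (auto simp: dist_real_def)
        finally show ?thesis by (simp add: algebra_simps)
      qed
      have int: "radial_avg k (hh z) integrable_on {0..?m}" for z
        by (intro integrable_continuous_interval continuous_on_subset[OF radial_avg_cont[OF hc]]) auto
      have "TT z ?m - TT y ?m = integral {0..?m} (radial_avg k (\<lambda>x. hh y x - hh z x))"
        unfolding TT_def radial_avg_diff[OF hc hc, abs_def] using integral_diff[OF int[of y] int[of z]] by simp
      moreover have "\<bar>integral {0..?m} (radial_avg k (\<lambda>x. hh y x - hh z x))\<bar> \<le> ?D / \<kappa>\<^sup>2 * exp (\<kappa> * ?m)"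
        by (rule integral_radial_avg_bound[OF _ hb \<kappa>(1)]) (auto intro!: continuous_intros hc mult_nonneg_nonneg L0)
      ultimately have "\<bar>TT y ?m - TT z ?m\<bar> \<le> ?D / \<kappa>\<^sup>2 * exp (\<kappa> * ?m)" unfolding abs_minus_commute[of "TT y ?m"] by simp
      then have "exp (- \<kappa> * ?m) * \<bar>TT y ?m - TT z ?m\<bar> \<le> exp (- \<kappa> * ?m) * (?D / \<kappa>\<^sup>2 * exp (\<kappa> * ?m))"
        by (intro mult_left_mono) auto
      also have "\<dots> = (L / \<kappa>\<^sup>2) * dist y z" by (simp add: exp_minus)
      also have "\<dots> \<le> 1 / 2 * dist y z" using \<kappa>(2) by (intro mult_right_mono) auto
      finally show "dist (F y r) (F z r) \<le> 1 / 2 * dist y z"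
        unfolding F S_def dist_real_def by (simp add: right_diff_distrib[symmetric] abs_mult)
    qed
  qed auto
  then obtain z where z: "F z = z" by auto
  have fp: "TT z r = \<psi> z r" if "0 \<le> r" for r
  proof -
    have "apply_bcontfun z r = exp (- \<kappa> * r) * TT z r" using F[of z] that unfolding z S_def by simp
    then show ?thesis unfolding \<psi>_def by (simp add: exp_minus)
  qed
  have "rad_ode k (TT z) (\<lambda>r. - radial_avg k (hh z) r) (\<lambda>r. f r (TT z r))"
    unfolding rad_ode_def
  proof (intro conjI allI impI)
    show "continuous_on {0..} (TT z)" by (rule TTc)
    show "continuous_on {0..} (\<lambda>r. - radial_avg k (hh z) r)" by (intro continuous_intros radial_avg_cont hc)
    show "- radial_avg k (hh z) 0 = 0" by (simp add: radial_avg_def)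
    fix r :: real assume r: "0 < r"
    have "(TT z has_real_derivative 0 - radial_avg k (hh z) r) (at r)" unfolding TT_def
      by (intro DERIV_diff DERIV_const has_derivative_integral_Ici radial_avg_cont hc r)
    then show "(TT z has_real_derivative - radial_avg k (hh z) r) (at r)" by simp
    have "((\<lambda>r. - (r ^ k * radial_avg k (hh z) r)) has_real_derivative - (r ^ k * hh z r)) (at r)"
      by (intro DERIV_minus radial_avg_deriv hc r)
    moreover have "hh z r = f r (TT z r)" unfolding hh_def using fp[of r] r by simp
    ultimately show "((\<lambda>r. r ^ k * - radial_avg k (hh z) r) has_real_derivative - (r ^ k * f r (TT z r))) (at r)" by simp
  qed
  moreover have "TT z 0 = d" unfolding TT_def by simp
  ultimately show thesis by (rule that)
qed

section \<open>Shooting\<close>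

lemma drift_contradiction:
  fixes U :: "real \<Rightarrow> real"
  assumes "0 < c" "\<And>r. R \<le> r \<Longrightarrow> (U has_real_derivative p r) (at r)" "\<And>r. R \<le> r \<Longrightarrow> p r \<le> - c" "\<And>r. R \<le> r \<Longrightarrow> 0 < U r"
  shows False
proof -
  define r where "r = R + U R / c"
  have UR: "0 < U R" using assms by simp
  have r: "R \<le> r" using UR assms(1) unfolding r_def by simp
  have "U r + c * r \<le> U R + c * R"
  proof (rule DERIV_nonpos_imp_nonincreasing[OF r, of "\<lambda>x. U x + c * x"])
    fix x assume "R \<le> x" "x \<le> r"
    then show "\<exists>y. ((\<lambda>x. U x + c * x) has_real_derivative y) (at x) \<and> y \<le> 0"
      using assms(3)[of x] by (intro exI[of _ "p x + c"]) (auto intro!: derivative_eq_intros assms(2))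
  qed
  moreover have "c * r = c * R + U R" unfolding r_def using assms(1) by (simp add: field_simps)
  ultimately show False using assms(4)[OF r] by simp
qed

text \<open>Integration gives growth of order r^(k+1), one power more than claimed, which absorbs
  both the constant of integration and the factor c / (k + 1).\<close>

lemma power_growth:
  fixes f :: "real \<Rightarrow> real"
  assumes "0 < c" "0 < R" "\<And>r. R \<le> r \<Longrightarrow> (f has_real_derivative f' r) (at r)" "\<And>r. R \<le> r \<Longrightarrow> c * r ^ k \<le> f' r"
  obtains S where "R \<le> S" "\<And>r. S \<le> r \<Longrightarrow> r ^ k \<le> f r"
proof -
  define C where "C = \<bar>f R - c / (real k + 1) * R ^ (k + 1)\<bar>"
  have lb: "c / (real k + 1) * r ^ (k + 1) - C \<le> f r" if r: "R \<le> r" for r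
  proof -
    have "(\<lambda>x. f x - c / (real k + 1) * x ^ (k + 1)) R \<le> (\<lambda>x. f x - c / (real k + 1) * x ^ (k + 1)) r"
    proof (rule DERIV_nonneg_imp_nondecreasing[OF r])
      fix x assume x: "R \<le> x" "x \<le> r"
      have "((\<lambda>x. f x - c / (real k + 1) * x ^ (k + 1)) has_real_derivative f' x - c / (real k + 1) * (real (k + 1) * x ^ (k + 1 - Suc 0))) (at x)"
        by (intro DERIV_diff DERIV_cmult assms(3) DERIV_pow x)
      moreover have "c / (real k + 1) * (real (k + 1) * x ^ (k + 1 - Suc 0)) = c * x ^ k" by (simp add: field_simps)
      ultimately show "\<exists>y. ((\<lambda>x. f x - c / (real k + 1) * x ^ (k + 1)) has_real_derivative y) (at x) \<and> 0 \<le> y"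
        using assms(4)[OF x(1)] by (intro exI conjI) auto
    qed
    then show ?thesis unfolding C_def by simp
  qed
  \<comment> \<open>From here on c r / (k + 1) >= 1 + C, and r^k >= 1 allows the constant C to be
    charged to C r^k.\<close>
  define S where "S = max (max R 1) ((real k + 1) * (1 + C) / c)"
  show thesis
  proof (rule that[of S])
    show "R \<le> S" unfolding S_def by simp
    fix r assume "S \<le> r"
    then have r: "R \<le> r" "1 \<le> r" "(real k + 1) * (1 + C) / c \<le> r" unfolding S_def by auto
    have 1: "1 \<le> r ^ k" using r(2) by simp
    have "1 + C \<le> c / (real k + 1) * r" using r(3) assms(1) by (simp add: field_simps)
    then have "(1 + C) * r ^ k \<le> c / (real k + 1) * r * r ^ k" using 1 by (intro mult_right_mono) auto
    moreover have "C * 1 \<le> C * r ^ k" using 1 unfolding C_def by (intro mult_left_mono) auto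
    ultimately show "r ^ k \<le> f r" using lb[OF r(1)] by (simp add: algebra_simps)
  qed
qed

text \<open>
  \<open>gx\<close> freezes \<open>g\<close> outside \<open>[0, D]\<close>, which makes it globally Lipschitz without affecting solutions
  with values in \<open>[0, D]\<close>.
\<close>

locale shooting = nonlinearity +
  fixes k :: nat and D :: real and U p :: "real \<Rightarrow> real \<Rightarrow> real" and gx :: "real \<Rightarrow> real" and L :: real
  assumes k1: "1 \<le> k" and bD: "b < D" and Dbt: "ereal D < bt"
    and gx_def: "gx = (\<lambda>s. g (max 0 (min D s)))"
    and L0: "0 \<le> L" and gL: "\<And>x y. x \<in> {0..D} \<Longrightarrow> y \<in> {0..D} \<Longrightarrow> \<bar>g x - g y\<bar> \<le> L * \<bar>x - y\<bar>"
    and g'L: "\<And>x. x \<in> {0..D} \<Longrightarrow> \<bar>g' x\<bar> \<le> L"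
    and flow: "\<And>d. rad_ode k (U d) (p d) (\<lambda>r. gx (U d r))" and U0: "\<And>d. U d 0 = d"
begin

lemma gx_eq: "0 \<le> s \<Longrightarrow> s \<le> D \<Longrightarrow> gx s = g s" unfolding gx_def by simp

lemma gx_lip: "\<bar>gx x - gx y\<bar> \<le> L * \<bar>x - y\<bar>"
proof -
  have D0: "0 < D" using b_pos bD by simp
  have "\<bar>gx x - gx y\<bar> \<le> L * \<bar>max 0 (min D x) - max 0 (min D y)\<bar>" unfolding gx_def by (rule gL) (use D0 in auto)
  also have "\<dots> \<le> L * \<bar>x - y\<bar>" by (rule mult_left_mono[OF _ L0]) (auto simp: max_def min_def)
  finally show ?thesis .
qed

lemma gx_cont: "continuous_on A gx"
proof -
  have "isCont gx x" for x
  proof -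
    have "((\<lambda>y. gx y) \<longlongrightarrow> gx x) (at x)"
    proof (rule LIM_zero_cancel, rule Lim_null_comparison)
      show "\<forall>\<^sub>F y in at x. norm (gx y - gx x) \<le> L * \<bar>y - x\<bar>" using gx_lip by (intro always_eventually) auto
      show "((\<lambda>y. L * \<bar>y - x\<bar>) \<longlongrightarrow> 0) (at x)" by (auto intro!: tendsto_eq_intros)
    qed
    then show ?thesis by (simp add: isCont_def)
  qed
  then show ?thesis by (simp add: continuous_at_imp_continuous_on)
qed

lemma Uc: "continuous_on {0..} (U d)" and pc: "continuous_on {0..} (p d)" and p0: "p d 0 = 0"
  and Ud: "0 < r \<Longrightarrow> (U d has_real_derivative p d r) (at r)"
  and kpd: "0 < r \<Longrightarrow> ((\<lambda>r. r ^ k * p d r) has_real_derivative - (r ^ k * gx (U d r))) (at r)"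
  using flow[of d] unfolding rad_ode_def by auto

lemmas pd = rad_ode_p_deriv[OF flow]

lemma flow_lip:
  assumes "0 \<le> r" "r \<le> R"
  shows "\<bar>U d r - U e r\<bar> \<le> gw_const L R * \<bar>d - e\<bar>" "\<bar>p d r - p e r\<bar> \<le> gw_const L R * \<bar>d - e\<bar>"
proof -
  have o: "rad_ode k (\<lambda>r. U d r - 1 * U e r) (\<lambda>r. p d r - 1 * p e r) (\<lambda>r. gx (U d r) - 1 * gx (U e r))"
    by (rule rad_ode_diff[OF flow flow])
  have R: "0 \<le> R" using assms by simp
  have h: "\<bar>gx (U d r) - 1 * gx (U e r)\<bar> \<le> L * \<bar>U d r - 1 * U e r\<bar> + 0" for r using gx_lip by simp
  show "\<bar>U d r - U e r\<bar> \<le> gw_const L R * \<bar>d - e\<bar>" "\<bar>p d r - p e r\<bar> \<le> gw_const L R * \<bar>d - e\<bar>"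
    using rad_gronwall[OF o L0 order_refl R h assms] U0 by simp_all
qed

lemma gw_nonneg: "0 \<le> R \<Longrightarrow> 0 \<le> gw_const L R" unfolding gw_const_def by simp

definition Gx where "Gx s = integral {0..s} gx"

lemma Gx_deriv: "0 < s \<Longrightarrow> (Gx has_real_derivative gx s) (at s)"
  unfolding Gx_def[abs_def] by (rule has_derivative_integral_Ici[OF gx_cont])

lemma Gx_cont: "continuous_on {0..} Gx"
  unfolding Gx_def[abs_def] by (rule continuous_on_integral_Ici[OF gx_cont])

text \<open>On [0, D] the integrands agree; for negative s both integrals extend over an empty
  interval and are 0.\<close>

lemma Gx_eq: "s \<le> D \<Longrightarrow> Gx s = G s"
  unfolding Gx_def G_def by (rule integral_cong) (auto intro!: gx_eq)

section \<open>Energy, crossing heights and trapped heights\<close>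

definition Ex where "Ex d r = (p d r)\<^sup>2 / 2 + Gx (U d r)"

lemma Ex_antimono:
  assumes "0 \<le> r" "r \<le> t" "\<And>x. r \<le> x \<Longrightarrow> x < t \<Longrightarrow> 0 < U d x" "0 \<le> U d t"
  shows "Ex d t \<le> Ex d r"
proof (rule DERIV_nonpos_imp_decreasing_open[OF assms(2)])
  have U0: "0 \<le> U d x" if "r \<le> x" "x \<le> t" for x using assms(3)[of x] assms(4) that by (cases "x = t") auto
  show "continuous_on {r..t} (Ex d)" unfolding Ex_def[abs_def]
    by (intro continuous_intros continuous_on_subset[OF pc] continuous_on_compose2[OF Gx_cont continuous_on_subset[OF Uc]])
       (use assms U0 in auto)
  fix x assume x: "r < x" "x < t"
  then have x0: "0 < x" using assms by simp
  have Gd: "((\<lambda>r. Gx (U d r)) has_real_derivative gx (U d x) * p d x) (at x)"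
    by (rule DERIV_chain2[OF Gx_deriv Ud]) (use assms x x0 in auto)
  have "((\<lambda>r. p d r * p d r / 2 + Gx (U d r)) has_real_derivative
      ((- (real k / x) * p d x - gx (U d x)) * p d x + (- (real k / x) * p d x - gx (U d x)) * p d x) / 2 + gx (U d x) * p d x) (at x)"
    by (intro DERIV_add DERIV_cdivide DERIV_mult pd Gd x0)
  moreover have "((- (real k / x) * p d x - gx (U d x)) * p d x + (- (real k / x) * p d x - gx (U d x)) * p d x) / 2 + gx (U d x) * p d x
      = - (real k / x) * (p d x)\<^sup>2" using x0 by (simp add: power2_eq_square field_simps)
  moreover have "- (real k / x) * (p d x)\<^sup>2 \<le> 0" using x0 by simp
  ultimately show "\<exists>y. (Ex d has_real_derivative y) (at x) \<and> y \<le> 0"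
    unfolding Ex_def[abs_def] power2_eq_square by metis
qed

text \<open>As for ground states, but with nonnegative energy up to s as a hypothesis: at a critical
  point below the start it leaves G(U) >= 0, so U > b and the source is positive.\<close>

lemma p_neg_of_energy:
  assumes d: "b < d" "d < D" and s: "0 < s" and pos: "\<And>t. 0 \<le> t \<Longrightarrow> t \<le> s \<Longrightarrow> 0 < U d t" and E: "\<And>t. 0 < t \<Longrightarrow> t \<le> s \<Longrightarrow> 0 \<le> Ex d t"
  shows "p d s < 0"
proof (rule rad_ode_descends[OF flow _ _ s])
  have dbt: "ereal d < bt" using d(2) Dbt less_trans[of "ereal d" "ereal D" bt] by simp
  show "continuous_on {0..} (\<lambda>r. gx (U d r))" by (rule continuous_on_compose2[OF gx_cont Uc]) auto
  show "0 < gx (U d 0)" using gx_eq[of d] g_pos[OF d(1) dbt] d b_pos by (simp add: U0)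
  fix z assume z: "0 < z" "z \<le> s" "p d z = 0" "U d z < U d 0"
  then have Uz: "U d z < d" by (simp add: U0)
  have Uz0: "0 < U d z" using pos[of z] z by simp
  have "0 \<le> G (U d z)" using E[of z] z Gx_eq[of "U d z"] Uz d unfolding Ex_def by simp
  then have "b < U d z" using G_neg[of "U d z"] Uz0 by force
  moreover have "ereal (U d z) < bt" using Uz dbt less_trans[of "ereal (U d z)" "ereal d" bt] by simp
  ultimately have "0 < g (U d z)" by (rule g_pos)
  then show "0 < gx (U d z)" using gx_eq[of "U d z"] Uz Uz0 d by simp
qed

definition crossing where "crossing = {d. \<exists>r>0. U d r < 0}"
text \<open>Energy does not increase while U is positive, and at a zero of U it is p^2 / 2 >= 0. So
  once it is negative on a positive stretch, the solution can never reach 0.\<close>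

definition trapped where "trapped = {d. \<exists>r>0. (\<forall>t\<in>{0..r}. 0 < U d t) \<and> Ex d r < 0}"

lemma crossing_trapped_disjoint: "d \<in> crossing \<Longrightarrow> d \<in> trapped \<Longrightarrow> False"
proof -
  assume "d \<in> crossing" "d \<in> trapped"
  then obtain r s where r: "0 < r" "U d r < 0" and s: "0 < s" "\<And>t. 0 \<le> t \<Longrightarrow> t \<le> s \<Longrightarrow> 0 < U d t" "Ex d s < 0"
    unfolding crossing_def trapped_def by auto
  have sr: "s < r" using s(2)[of r] r by force
  obtain z where z: "s < z" "z \<le> r" "- U d z = 0" "\<And>x. s \<le> x \<Longrightarrow> x < z \<Longrightarrow> - U d x < 0"
    by (rule first_zero[of s r "\<lambda>x. - U d x"])
       (use sr s r in \<open>auto intro!: continuous_intros continuous_on_subset[OF Uc]\<close>)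
  have "Ex d z \<le> Ex d s" by (rule Ex_antimono) (use z s in auto)
  moreover have "0 \<le> Ex d z" unfolding Ex_def using z(3) by (simp add: Gx_def)
  ultimately show False using s(3) by simp
qed

lemma crossing_open: assumes "d \<in> crossing" obtains \<epsilon> where "0 < \<epsilon>" "\<And>e. \<bar>e - d\<bar> < \<epsilon> \<Longrightarrow> e \<in> crossing"
proof -
  obtain r where r: "0 < r" "U d r < 0" using assms unfolding crossing_def by auto
  define C where "C = gw_const L r + 1"
  have C: "0 < C" using gw_nonneg[of r] r unfolding C_def by simp
  show thesis
  proof (rule that[of "- U d r / C"])
    show "0 < - U d r / C" using C r by (simp add: divide_neg_pos)
    fix e assume e: "\<bar>e - d\<bar> < - U d r / C"
    have "\<bar>U e r - U d r\<bar> \<le> gw_const L r * \<bar>e - d\<bar>" by (rule flow_lip(1)) (use r in auto)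
    also have "\<dots> \<le> C * \<bar>e - d\<bar>" unfolding C_def by (intro mult_right_mono) auto
    also have "\<dots> < - U d r" using e C by (simp add: field_simps)
    finally show "e \<in> crossing" unfolding crossing_def using r by auto
  qed
qed

text \<open>Continuous dependence on [0, r]: positivity survives because U has a positive minimum
  there, and the energy at the single radius r depends continuously on the height.\<close>

lemma trapped_open: assumes "d \<in> trapped" obtains \<epsilon> where "0 < \<epsilon>" "\<And>e. \<bar>e - d\<bar> < \<epsilon> \<Longrightarrow> e \<in> trapped"
proof -
  obtain r where r: "0 < r" "\<And>t. 0 \<le> t \<Longrightarrow> t \<le> r \<Longrightarrow> 0 < U d t" "Ex d r < 0" using assms unfolding trapped_def by auto
  have "\<exists>x\<in>{0..r}. \<forall>y\<in>{0..r}. U d x \<le> U d y"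
    by (rule continuous_attains_inf) (use r in \<open>auto intro: continuous_on_subset[OF Uc]\<close>)
  then obtain x0 where x0: "x0 \<in> {0..r}" "\<And>y. y \<in> {0..r} \<Longrightarrow> U d x0 \<le> U d y" by auto
  define m where "m = U d x0"
  have m: "0 < m" "\<And>y. 0 \<le> y \<Longrightarrow> y \<le> r \<Longrightarrow> m \<le> U d y" using x0 r(2)[of x0] unfolding m_def by auto
  have lim: "((\<lambda>e. U e t) \<longlongrightarrow> U d t) (at d)" "((\<lambda>e. p e t) \<longlongrightarrow> p d t) (at d)" if "0 \<le> t" "t \<le> r" for t
  proof -
    have l: "((\<lambda>e. gw_const L r * \<bar>e - d\<bar>) \<longlongrightarrow> 0) (at d)" by (auto intro!: tendsto_eq_intros)
    show "((\<lambda>e. U e t) \<longlongrightarrow> U d t) (at d)"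
      by (rule LIM_zero_cancel, rule Lim_null_comparison[OF _ l]) (use flow_lip(1)[OF that] in \<open>auto intro!: always_eventually\<close>)
    show "((\<lambda>e. p e t) \<longlongrightarrow> p d t) (at d)"
      by (rule LIM_zero_cancel, rule Lim_null_comparison[OF _ l]) (use flow_lip(2)[OF that] in \<open>auto intro!: always_eventually\<close>)
  qed
  have "isCont Gx (U d r)" using Gx_deriv[of "U d r"] r(2)[of r] r(1) by (auto intro: DERIV_isCont)
  then have "((\<lambda>e. Gx (U e r)) \<longlongrightarrow> Gx (U d r)) (at d)"
    by (rule isCont_tendsto_compose) (rule lim, use r in auto)
  then have "((\<lambda>e. Ex e r) \<longlongrightarrow> Ex d r) (at d)" unfolding Ex_def
    by (intro tendsto_intros lim) (use r in auto)
  then have "\<forall>\<^sub>F e in at d. Ex e r < 0" by (rule order_tendstoD(2)[OF _ r(3)])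
  then obtain \<epsilon>1 where \<epsilon>1: "0 < \<epsilon>1" "\<And>e. e \<noteq> d \<Longrightarrow> dist e d < \<epsilon>1 \<Longrightarrow> Ex e r < 0" unfolding eventually_at by auto
  define C where "C = gw_const L r + 1"
  have C: "0 < C" using gw_nonneg[of r] r unfolding C_def by simp
  show thesis
  proof (rule that[of "min \<epsilon>1 (m / C)"])
    show "0 < min \<epsilon>1 (m / C)" using \<epsilon>1 m C by simp
    fix e assume e: "\<bar>e - d\<bar> < min \<epsilon>1 (m / C)"
    have "Ex e r < 0" using \<epsilon>1(2)[of e] e r(3) by (cases "e = d") (auto simp: dist_real_def)
    moreover have "0 < U e t" if "0 \<le> t" "t \<le> r" for t
    proof -
      have "\<bar>U e t - U d t\<bar> \<le> gw_const L r * \<bar>e - d\<bar>" by (rule flow_lip(1)[OF that])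
      also have "\<dots> \<le> C * \<bar>e - d\<bar>" unfolding C_def by (intro mult_right_mono) auto
      also have "\<dots> < m" using e C by (simp add: field_simps)
      finally show ?thesis using m(2)[OF that] by auto
    qed
    ultimately show "e \<in> trapped" unfolding trapped_def using r(1) by auto
  qed
qed

end

section \<open>Classification of heights and perturbation of a ground state\<close>

context shooting begin

lemma ground_state_flow:
  assumes "\<And>r. 0 \<le> r \<Longrightarrow> 0 < U d r" "\<And>r. 0 \<le> r \<Longrightarrow> U d r \<le> D" "(U d \<longlongrightarrow> 0) at_top"
  shows "ground_state g g' b bt k (U d) (p d)"
proof unfold_locales
  show "rad_ode k (U d) (p d) (\<lambda>r. g (U d r))"
    using flow[of d] assms(1,2) gx_eq unfolding rad_ode_def by (auto simp: less_imp_le)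
qed (use k1 assms in auto)

text \<open>A solution that never becomes negative is positive, since touching 0 would be a double
  zero. Nonnegative energy makes it strictly decreasing, so it has a limit l in [0, d) with g(l) =
  0. The value l = b is impossible because G(b) < 0 and nonnegative energy would keep |p| away from
  0; this leaves l = 0.\<close>

lemma trichotomy:
  assumes d: "b < d" "d < D" and nc: "d \<notin> crossing" and nt: "d \<notin> trapped"
  shows "ground_state g g' b bt k (U d) (p d)"
proof -
  have nonneg: "0 \<le> U d r" if "0 \<le> r" for r
  proof (cases "r = 0")
    case False
    then have "0 < r" using that by simp
    then show ?thesis using nc unfolding crossing_def by force
  qed (use U0[of d] d b_pos in simp)
  have pos: "0 < U d r" if r: "0 \<le> r" for r
  proof (rule ccontr)
    assume "\<not> 0 < U d r"
    then have z: "U d r = 0" using nonneg[OF r] by simp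
    then have r0: "0 < r" using r U0[of d] d b_pos by (cases "r = 0") auto
    \<comment> \<open>A zero of a nonnegative function is a minimum, hence a double zero, and
      \<open>second_order_zero\<close> would make the solution vanish identically for r > 0.\<close>
    have "p d r = 0"
    proof (rule DERIV_local_min[OF Ud[OF r0] r0])
      show "\<forall>y. \<bar>r - y\<bar> < r \<longrightarrow> U d r \<le> U d y" using z nonneg by auto
    qed
    have zero: "U d x = 0" if "0 < x" for x
    proof (rule second_order_zero[of "U d" "p d" k "\<lambda>x. gx (U d x)" L r x])
      fix y :: real assume y: "0 < y"
      show "\<bar>gx (U d y)\<bar> \<le> L * \<bar>U d y\<bar>" using gx_lip[of "U d y" 0] gx_eq[of 0] g0 b_pos bD by simp
    qed (use Ud pd L0 r0 z \<open>p d r = 0\<close> that in auto)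
    have "(U d \<longlongrightarrow> U d 0) (at_right 0)"
      using Uc[of d] unfolding continuous_on by (metis atLeast_iff order_refl at_within_Ici_at_right)
    then have "((\<lambda>_. 0) \<longlongrightarrow> U d 0) (at_right (0::real))"
      by (rule Lim_transform_eventually) (rule eventually_mono[OF eventually_at_right_less[of 0]], simp add: zero)
    then have "U d 0 = 0" using tendsto_unique[OF trivial_limit_at_right_real _ tendsto_const] by blast
    then show False using U0[of d] d b_pos by simp
  qed
  have E: "0 \<le> Ex d r" if "0 < r" for r using nt that pos unfolding trapped_def by force
  have neg: "p d r < 0" if "0 < r" for r by (rule p_neg_of_energy[OF d that]) (use pos E in auto)
  have dec: "U d t < U d r" if rt: "0 \<le> r" "r < t" for r t
  proof (rule DERIV_neg_imp_decreasing_open[OF rt(2)])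
    fix x assume "r < x" "x < t"
    then show "\<exists>y. (U d has_real_derivative y) (at x) \<and> y < 0" using Ud[of x d] neg[of x] rt by auto
  qed (use rt in \<open>auto intro: continuous_on_subset[OF Uc]\<close>)
  have led: "U d r \<le> d" if "0 \<le> r" for r using dec[of 0 r] U0[of d] that by (cases "r = 0") auto
  define l where "l = Inf (U d ` {0..})"
  have bdd: "bdd_below (U d ` {0..})" using nonneg by (auto intro!: bdd_belowI[of _ 0])
  have l_le: "l \<le> U d r" if "0 \<le> r" for r unfolding l_def by (rule cInf_lower[OF _ bdd]) (use that in auto)
  have l0: "0 \<le> l" unfolding l_def by (rule cInf_greatest) (use nonneg in auto)
  have lim: "(U d \<longlongrightarrow> l) at_top"
  proof (rule order_tendstoI)
    fix a assume "a < l"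
    then show "\<forall>\<^sub>F x in at_top. a < U d x"
      by (intro eventually_mono[OF eventually_ge_at_top[of 0]]) (use l_le in force)
  next
    fix a assume "l < a"
    then obtain r where r: "0 \<le> r" "U d r < a" unfolding l_def using cInf_lessD[of "U d ` {0..}" a] by auto
    show "\<forall>\<^sub>F x in at_top. U d x < a"
      by (intro eventually_mono[OF eventually_gt_at_top[of r]]) (use dec[of r] r in force)
  qed
  have ld: "l < d" using l_le[of 1] dec[of 0 1] U0[of d] by simp
  have gl: "((\<lambda>r. gx (U d r)) \<longlongrightarrow> gx l) at_top"
    using isCont_tendsto_compose[OF _ lim, of gx] gx_cont[of UNIV] by (simp add: continuous_on_eq_continuous_at)
  \<comment> \<open>Otherwise r^k p grows like r^(k+1) in modulus. A negative limit would make p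
    positive; a positive one pushes p below - 1, and U would reach 0.\<close>
  have gl0: "gx l = 0"
  proof (rule ccontr)
    assume "gx l \<noteq> 0"
    then consider "0 < gx l" | "gx l < 0" by linarith
    then show False
    proof cases
      case 1
      then have "\<forall>\<^sub>F r in at_top. gx l / 2 < gx (U d r)" by (intro order_tendstoD(1)[OF gl]) simp
      then obtain R0 where R0: "\<And>r. R0 \<le> r \<Longrightarrow> gx l / 2 < gx (U d r)" unfolding eventually_at_top_linorder by auto
      define R where "R = max R0 1"
      have R: "0 < R" "\<And>r. R \<le> r \<Longrightarrow> gx l / 2 < gx (U d r)" using R0 unfolding R_def by auto
      obtain S where S: "R \<le> S" "\<And>r. S \<le> r \<Longrightarrow> r ^ k \<le> - (r ^ k * p d r)"
      proof (rule power_growth[of "gx l / 2" R "\<lambda>r. - (r ^ k * p d r)" "\<lambda>r. r ^ k * gx (U d r)" k])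
        fix r assume r: "R \<le> r"
        show "((\<lambda>r. - (r ^ k * p d r)) has_real_derivative r ^ k * gx (U d r)) (at r)"
          using DERIV_minus[OF kpd[of r d]] r R(1) by simp
        show "gx l / 2 * r ^ k \<le> r ^ k * gx (U d r)"
          using mult_left_mono[OF less_imp_le[OF R(2)[OF r]], of "r ^ k"] r R(1) by (simp add: mult.commute)
      qed (use 1 R in auto)
      show False
      proof (rule drift_contradiction[of 1 S "U d" "p d"])
        fix r assume r: "S \<le> r"
        then have r0: "0 < r" using S(1) R(1) by simp
        show "(U d has_real_derivative p d r) (at r)" by (rule Ud[OF r0])
        have "r ^ k * 1 \<le> r ^ k * (- p d r)" using S(2)[OF r] by simp
        then have "1 \<le> - p d r" using r0 by (simp only: mult_le_cancel_left_pos zero_less_power)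
        then show "p d r \<le> - 1" by simp
        show "0 < U d r" using pos r0 by simp
      qed simp
    next
      case 2
      then have "\<forall>\<^sub>F r in at_top. gx (U d r) < gx l / 2" by (intro order_tendstoD(2)[OF gl]) simp
      then obtain R0 where R0: "\<And>r. R0 \<le> r \<Longrightarrow> gx (U d r) < gx l / 2" unfolding eventually_at_top_linorder by auto
      define R where "R = max R0 1"
      have R: "0 < R" "\<And>r. R \<le> r \<Longrightarrow> gx (U d r) < gx l / 2" using R0 unfolding R_def by auto
      obtain S where S: "R \<le> S" "\<And>r. S \<le> r \<Longrightarrow> r ^ k \<le> r ^ k * p d r"
      proof (rule power_growth[of "- gx l / 2" R "\<lambda>r. r ^ k * p d r" "\<lambda>r. - (r ^ k * gx (U d r))" k])
        fix r assume r: "R \<le> r"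
        show "((\<lambda>r. r ^ k * p d r) has_real_derivative - (r ^ k * gx (U d r))) (at r)"
          using kpd[of r d] r R(1) by simp
        show "- gx l / 2 * r ^ k \<le> - (r ^ k * gx (U d r))"
          using mult_left_mono[OF less_imp_le[OF R(2)[OF r]], of "r ^ k"] r R(1) by (simp add: mult.commute)
      qed (use 2 R in auto)
      have "0 < S ^ k" using S(1) R(1) by simp
      then have "0 < S ^ k * p d S" using S(2)[of S] by simp
      then have "0 < p d S" using \<open>0 < S ^ k\<close> by (simp only: zero_less_mult_pos)
      then show False using neg[of S] S(1) R(1) by simp
    qed
  qed
  have dbt: "ereal d < bt" using d(2) Dbt less_trans[of "ereal d" "ereal D" bt] by simp
  have "l = 0"
  proof (rule ccontr)
    assume "l \<noteq> 0"
    then have lp: "0 < l" using l0 by simp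
    have gl1: "g l = 0" using gl0 gx_eq[of l] l0 ld d by simp
    have lb: "l = b"
    proof (rule ccontr)
      assume "l \<noteq> b"
      moreover have "ereal l < bt" using ld dbt less_trans[of "ereal l" "ereal d" bt] by simp
      ultimately show False using g_neg[OF lp] g_pos[of l] gl1 by (cases "l < b") auto
    qed
    \<comment> \<open>Near height b the potential is below G(b) / 2, so nonnegative energy means p^2
      >= - G(b) = c^2.\<close>
    define c where "c = sqrt (- G b)"
    have Gb: "G b < 0" using G_neg[of b] b_pos by simp
    have c: "0 < c" "c\<^sup>2 = - G b" using Gb unfolding c_def by auto
    have "isCont Gx b" using Gx_deriv[OF b_pos] by (rule DERIV_isCont)
    then have "((\<lambda>r. Gx (U d r)) \<longlongrightarrow> Gx b) at_top" using lim lb isCont_tendsto_compose by blast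
    then have "\<forall>\<^sub>F r in at_top. Gx (U d r) < G b / 2" using Gx_eq[of b] bD Gb by (intro order_tendstoD(2)) auto
    then obtain R0 where R0: "\<And>r. R0 \<le> r \<Longrightarrow> Gx (U d r) < G b / 2" unfolding eventually_at_top_linorder by auto
    show False
    proof (rule drift_contradiction[of c "max R0 1" "U d" "p d"])
      fix r assume r: "max R0 1 \<le> r"
      then have r0: "0 < r" by simp
      show "(U d has_real_derivative p d r) (at r)" by (rule Ud[OF r0])
      show "0 < U d r" using pos r0 by simp
      have "c\<^sup>2 \<le> (p d r)\<^sup>2" using E[OF r0] R0[of r] r c(2) unfolding Ex_def by simp
      then have "c \<le> \<bar>p d r\<bar>" using c(1) by (metis abs_le_square_iff abs_of_pos)
      then show "p d r \<le> - c" using neg[OF r0] by simp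
    qed (rule c(1))
  qed
  then show ?thesis using ground_state_flow[of d] pos led lim d by force
qed

text \<open>In the range of heights up to \<delta>, g is nonincreasing. So as long as the difference
  z of the two solutions is positive, r^k z' is nondecreasing; z and z' being positive at R, both
  remain so, and the gap never closes.\<close>

lemma separation:
  assumes R: "0 < R" "R \<le> c" and init: "U d R < U e R" "p d R < p e R"
    and \<delta>: "\<delta> \<le> D" "\<And>s. 0 \<le> s \<Longrightarrow> s \<le> \<delta> \<Longrightarrow> g' s \<le> 0"
    and lo: "\<And>r. R \<le> r \<Longrightarrow> r \<le> c \<Longrightarrow> 0 \<le> U d r" and hi: "\<And>r. R \<le> r \<Longrightarrow> r \<le> c \<Longrightarrow> U e r \<le> \<delta>"
  shows "U e R - U d R \<le> U e c - U d c"
proof -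
  define z where "z r = U e r - U d r" for r
  define y where "y r = r ^ k * (p e r - p d r)" for r
  have zd: "(z has_real_derivative (p e r - p d r)) (at r)" if "0 < r" for r
    unfolding z_def using Ud[OF that] by (intro DERIV_diff) auto
  have yd: "(y has_real_derivative - (r ^ k * (gx (U e r) - gx (U d r)))) (at r)" if "0 < r" for r
  proof -
    have "((\<lambda>r. r ^ k * p e r - r ^ k * p d r) has_real_derivative - (r ^ k * gx (U e r)) - (- (r ^ k * gx (U d r)))) (at r)"
      by (intro DERIV_diff kpd that)
    then show ?thesis unfolding y_def by (simp add: algebra_simps)
  qed
  have yc: "continuous_on {R..c} y"
    by (rule continuous_at_imp_continuous_on, rule ballI, rule DERIV_isCont, rule yd) (use R in auto)
  have yR: "0 < y R" unfolding y_def using init R by simp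
  have gmono: "gx v \<le> gx u" if "0 \<le> u" "u \<le> v" "v \<le> \<delta>" for u v
  proof -
    have "g v \<le> g u"
    proof (rule DERIV_nonpos_imp_decreasing_open[OF that(2)])
      fix x assume "u < x" "x < v"
      then show "\<exists>y. (g has_real_derivative y) (at x) \<and> y \<le> 0" using g_deriv[of x] \<delta>(2)[of x] that by auto
    qed (use that in \<open>auto intro: continuous_on_subset[OF g_cont]\<close>)
    then show ?thesis using gx_eq that \<delta>(1) by simp
  qed
  have zmono: "z R \<le> z s" if s: "R \<le> s" "\<And>x. R \<le> x \<Longrightarrow> x < s \<Longrightarrow> 0 < y x" for s
  proof (rule DERIV_nonneg_imp_increasing_open[OF s(1)])
    fix x assume x: "R < x" "x < s"
    then have "0 < x ^ k * (p e x - p d x)" using s(2)[of x] unfolding y_def by simp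
    then have "0 < p e x - p d x" using x R by (simp add: zero_less_mult_iff)
    then show "\<exists>y. (z has_real_derivative y) (at x) \<and> 0 \<le> y" using zd[of x] x R by (auto intro!: exI)
  next
    show "continuous_on {R..s} z"
      by (rule continuous_at_imp_continuous_on, rule ballI, rule DERIV_isCont, rule zd) (use R in auto)
  qed
  have ypos: "0 < y r" if r: "R \<le> r" "r \<le> c" for r
  proof (rule ccontr)
    assume n: "\<not> 0 < y r"
    obtain s where s: "R < s" "s \<le> r" "- y s = 0" "\<And>x. R \<le> x \<Longrightarrow> x < s \<Longrightarrow> - y x < 0"
      by (rule first_zero[of R r "\<lambda>x. - y x"])
         (use r n yR in \<open>auto intro!: continuous_intros continuous_on_subset[OF yc]\<close>)
    have zp: "0 < z x" if "R \<le> x" "x < s" for x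
      using zmono[of x] s(4) that init unfolding z_def by force
    have "y R \<le> y s"
    proof (rule DERIV_nonneg_imp_increasing_open[of R s])
      fix x assume x: "R < x" "x < s"
      have "gx (U e x) \<le> gx (U d x)"
        by (rule gmono) (use lo[of x] hi[of x] zp[of x] x s r in \<open>auto simp: z_def\<close>)
      then have "0 \<le> - (x ^ k * (gx (U e x) - gx (U d x)))" using x R by (simp add: mult_le_0_iff)
      then show "\<exists>d. (y has_real_derivative d) (at x) \<and> 0 \<le> d" using yd[of x] x R by auto
    qed (use s r in \<open>auto intro: continuous_on_subset[OF yc]\<close>)
    then show False using s(3) yR by simp
  qed
  show ?thesis using zmono[OF R(2) ypos] unfolding z_def by simp
qed

text \<open>Differentiability of the flow in the initial height, with derivative w. The remainder
  U(d + e) - U(d) - e w has zero initial value and solves a radial equation with a source error that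
  is small relative to |e|, by uniform continuity of g'; Gronwall passes this on to value and
  slope.\<close>

lemma linearization:
  assumes gs: "ground_state g g' b bt k (U d) (p d)" and dD: "d < D"
    and w: "rad_ode k w q (\<lambda>r. g' (U d r) * w r)" "w 0 = 1" and R: "0 < R" and \<eta>: "0 < \<eta>"
  obtains \<epsilon> where "0 < \<epsilon>" "\<And>e. \<bar>e\<bar> < \<epsilon> \<Longrightarrow> \<bar>U (d + e) R - U d R - e * w R\<bar> \<le> \<eta> * \<bar>e\<bar>"
    "\<And>e. \<bar>e\<bar> < \<epsilon> \<Longrightarrow> \<bar>p (d + e) R - p d R - e * q R\<bar> \<le> \<eta> * \<bar>e\<bar>"
    "\<And>e t. \<bar>e\<bar> < \<epsilon> \<Longrightarrow> 0 \<le> t \<Longrightarrow> t \<le> R \<Longrightarrow> 0 < U (d + e) t"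
proof -
  interpret gs: ground_state g g' b bt k "U d" "p d" by (rule gs)
  define C where "C = gw_const L R + 1"
  have C: "1 \<le> C" using gw_nonneg[of R] R unfolding C_def by simp
  define m where "m = U d R"
  have m: "0 < m" "\<And>t. 0 \<le> t \<Longrightarrow> t \<le> R \<Longrightarrow> m \<le> U d t" "\<And>t. 0 \<le> t \<Longrightarrow> U d t \<le> d"
    using gs.U_pos[of R] gs.U_strict[of _ R] gs.U_le U0[of d] R unfolding m_def by (force simp: order_le_less)+
  \<comment> \<open>One factor C is lost in |U(d + e) - U(d)| <= C |e|, the other in Gronwall's
    inequality for the remainder.\<close>
  define \<omega> where "\<omega> = \<eta> / C\<^sup>2"
  have \<omega>: "0 < \<omega>" unfolding \<omega>_def using \<eta> C by simp
  have "uniformly_continuous_on {0..D} g'"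
    by (rule compact_uniformly_continuous) (auto intro: continuous_on_subset[OF g'_cont])
  then obtain \<rho> where \<rho>: "0 < \<rho>" "\<And>x y. x \<in> {0..D} \<Longrightarrow> y \<in> {0..D} \<Longrightarrow> dist x y < \<rho> \<Longrightarrow> dist (g' x) (g' y) < \<omega>"
    unfolding uniformly_continuous_on_def using \<omega> by metis
  have taylor: "\<bar>g x - g y - g' y * (x - y)\<bar> \<le> \<omega> * \<bar>x - y\<bar>"
    if xy: "0 \<le> x" "x \<le> D" "0 \<le> y" "y \<le> D" "\<bar>x - y\<bar> < \<rho>" for x y
  proof -
    have d': "\<bar>g' t - g' y\<bar> \<le> \<omega>" if "t \<in> {0..D}" "\<bar>t - y\<bar> < \<rho>" for t
      using \<rho>(2)[of t y] that xy by (auto simp: dist_real_def)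
    have *: "\<bar>(g v - g' y * v) - (g u - g' y * u)\<bar> \<le> \<omega> * v - \<omega> * u" if uv: "u \<le> v" "(u = x \<and> v = y) \<or> (u = y \<and> v = x)" for u v
    proof (rule deriv_bound_compare[OF uv(1), where f = "\<lambda>t. g t - g' y * t" and f' = "\<lambda>t. g' t - g' y * 1" and B' = "\<lambda>t. \<omega> * 1"])
      show "continuous_on {u..v} (\<lambda>t. g t - g' y * t)"
        by (intro continuous_intros continuous_on_subset[OF g_cont]) (use uv xy in auto)
      show "continuous_on {u..v} (\<lambda>t. \<omega> * t)" by (intro continuous_intros)
      fix t assume t: "u < t" "t < v"
      then have t0: "0 < t" using uv xy by auto
      show "((\<lambda>t. g t - g' y * t) has_real_derivative g' t - g' y * 1) (at t)"
        by (intro DERIV_diff DERIV_cmult DERIV_ident g_deriv t0)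
      show "((\<lambda>t. \<omega> * t) has_real_derivative \<omega> * 1) (at t)" by (intro DERIV_cmult DERIV_ident)
      show "\<bar>g' t - g' y * 1\<bar> \<le> \<omega> * 1" using d'[of t] t uv xy by auto
    qed
    show ?thesis
    proof (cases "x \<le> y")
      case True then show ?thesis using *[of x y] by (simp add: algebra_simps abs_le_iff)
    next
      case False then show ?thesis using *[of y x] by (simp add: algebra_simps abs_le_iff)
    qed
  qed
  \<comment> \<open>The three bounds keep the perturbed solution, respectively, within the modulus
    of continuity of g', above 0 and below D on [0, R].\<close>
  define \<epsilon> where "\<epsilon> = min (min (\<rho> / C) (m / C)) ((D - d) / C)"
  have \<epsilon>: "0 < \<epsilon>" unfolding \<epsilon>_def using \<rho>(1) m(1) dD C by auto
  have close: "\<bar>U (d + e) t - U d t\<bar> \<le> C * \<bar>e\<bar>" if "0 \<le> t" "t \<le> R" for e t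
  proof -
    have "\<bar>U (d + e) t - U d t\<bar> \<le> gw_const L R * \<bar>d + e - d\<bar>" by (rule flow_lip(1)[OF that])
    also have "\<dots> \<le> C * \<bar>e\<bar>" unfolding C_def by (simp add: algebra_simps)
    finally show ?thesis .
  qed
  have small: "C * \<bar>e\<bar> < \<rho>" "C * \<bar>e\<bar> < m" "C * \<bar>e\<bar> < D - d" if "\<bar>e\<bar> < \<epsilon>" for e
    using that C unfolding \<epsilon>_def by (auto simp: field_simps)
  have range: "0 < U (d + e) t" "U (d + e) t \<le> D" if "\<bar>e\<bar> < \<epsilon>" "0 \<le> t" "t \<le> R" for e t
    using close[OF that(2,3), of e] small[OF that(1)] m(2)[OF that(2,3)] m(3)[OF that(2)] by auto
  have main: "\<bar>U (d + e) R - U d R - e * w R\<bar> \<le> \<eta> * \<bar>e\<bar>" "\<bar>p (d + e) R - p d R - e * q R\<bar> \<le> \<eta> * \<bar>e\<bar>" if e: "\<bar>e\<bar> < \<epsilon>" for e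
  proof -
    have "rad_ode k (\<lambda>r. (U (d + e) r - 1 * U d r) - e * w r) (\<lambda>r. (p (d + e) r - 1 * p d r) - e * q r)
       (\<lambda>r. (gx (U (d + e) r) - 1 * gx (U d r)) - e * (g' (U d r) * w r))"
      by (intro rad_ode_diff flow w(1))
    then have o: "rad_ode k (\<lambda>r. U (d + e) r - U d r - e * w r) (\<lambda>r. p (d + e) r - p d r - e * q r)
       (\<lambda>r. gx (U (d + e) r) - gx (U d r) - e * (g' (U d r) * w r))" by simp
    define \<mu> where "\<mu> = \<omega> * (C * \<bar>e\<bar>)"
    have \<mu>: "0 \<le> \<mu>" unfolding \<mu>_def using \<omega> C by simp
    have h: "\<bar>gx (U (d + e) r) - gx (U d r) - e * (g' (U d r) * w r)\<bar> \<le> L * \<bar>U (d + e) r - U d r - e * w r\<bar> + \<mu>"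
      if r: "0 < r" "r \<le> R" for r
    proof -
      let ?x = "U (d + e) r" let ?y = "U d r"
      have x: "0 \<le> ?x" "?x \<le> D" using range[OF e, of r] r by auto
      have y: "0 \<le> ?y" "?y \<le> D" using gs.U_pos[of r] m(3)[of r] dD r by auto
      have cl: "\<bar>?x - ?y\<bar> \<le> C * \<bar>e\<bar>" by (rule close) (use r in auto)
      have 1: "\<bar>g ?x - g ?y - g' ?y * (?x - ?y)\<bar> \<le> \<omega> * \<bar>?x - ?y\<bar>"
        by (rule taylor) (use x y cl small[OF e] in auto)
      have 2: "\<omega> * \<bar>?x - ?y\<bar> \<le> \<mu>" unfolding \<mu>_def using cl \<omega> by (intro mult_left_mono) auto
      have 3: "\<bar>g' ?y * (?x - ?y - e * w r)\<bar> \<le> L * \<bar>?x - ?y - e * w r\<bar>"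
        unfolding abs_mult by (rule mult_right_mono[OF g'L]) (use y in auto)
      have "gx ?x - gx ?y - e * (g' ?y * w r) = (g ?x - g ?y - g' ?y * (?x - ?y)) + g' ?y * (?x - ?y - e * w r)"
        using gx_eq x y by (simp add: algebra_simps)
      then show ?thesis using 1 2 3 by linarith
    qed
    have c: "gw_const L R * (\<bar>U (d + e) 0 - U d 0 - e * w 0\<bar> + \<mu>) \<le> \<eta> * \<bar>e\<bar>"
    proof -
      have "gw_const L R * (\<bar>U (d + e) 0 - U d 0 - e * w 0\<bar> + \<mu>) = gw_const L R * \<mu>" by (simp add: U0 w(2))
      also have "\<dots> \<le> C * \<mu>" unfolding C_def using \<mu> by (simp add: algebra_simps)
      also have "\<dots> = \<eta> * \<bar>e\<bar>" unfolding \<mu>_def \<omega>_def using C by (simp add: power2_eq_square)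
      finally show ?thesis .
    qed
    show "\<bar>U (d + e) R - U d R - e * w R\<bar> \<le> \<eta> * \<bar>e\<bar>"
      using rad_gronwall(1)[OF o L0 \<mu> _ h, of R R] R c by simp
    show "\<bar>p (d + e) R - p d R - e * q R\<bar> \<le> \<eta> * \<bar>e\<bar>"
      using rad_gronwall(2)[OF o L0 \<mu> _ h, of R R] R c by simp
  qed
  show thesis by (rule that[OF \<epsilon> main(1) main(2) range(1)])
qed

text \<open>At a large R both w and w' are negative, so a slightly higher start lies below the
  ground state there, in value and in slope, and a slightly lower start lies above it. By
  \<open>separation\<close> the gap persists. Hence the higher start cannot stay nonnegative under a
  profile that tends to 0; the lower start can neither tend to 0 nor reach 0 while staying above a
  positive profile, so it is trapped.\<close>

lemma neighbours:
  assumes gs: "ground_state g g' b bt k (U d) (p d)" and dD: "d < D"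
  obtains \<epsilon> where "0 < \<epsilon>" "\<And>e. 0 < e \<Longrightarrow> e < \<epsilon> \<Longrightarrow> d + e \<in> crossing" "\<And>e. 0 < e \<Longrightarrow> e < \<epsilon> \<Longrightarrow> d - e \<in> trapped"
proof -
  interpret gs: ground_state g g' b bt k "U d" "p d" by (rule gs)
  have bd: "b < d" using gs.U0_gt U0[of d] by simp
  have UD: "U d r \<in> {0..D}" if "0 \<le> r" for r using gs.U_pos[OF that] gs.U_le[OF that] U0[of d] dD by auto
  obtain w q where w: "rad_ode k w q (\<lambda>r. g' (U d r) * w r)" "w 0 = 1"
  proof (rule rad_ode_exists[of "\<lambda>r x. g' (U d r) * x" L 0 k 1])
    fix u :: "real \<Rightarrow> real" assume u: "continuous_on {0..} u"
    show "continuous_on {0..} (\<lambda>r. g' (U d r) * u r)"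
      by (intro continuous_intros u continuous_on_compose2[OF g'_cont Uc]) (use UD in auto)
  next
    fix r x y :: real assume "0 \<le> r"
    then have "\<bar>g' (U d r)\<bar> * \<bar>x - y\<bar> \<le> L * \<bar>x - y\<bar>" using g'L UD by (intro mult_right_mono) auto
    then show "\<bar>g' (U d r) * x - g' (U d r) * y\<bar> \<le> L * \<bar>x - y\<bar>" by (simp add: right_diff_distrib[symmetric] abs_mult)
  qed (use that in auto)
  have wl: "(w \<longlongrightarrow> 1) (at_right 0)" "(q \<longlongrightarrow> 0) (at_right 0)"
    using w unfolding rad_ode_def continuous_on by (metis atLeast_iff order_refl at_within_Ici_at_right)+
  have near: "\<forall>\<^sub>F r in at_right 0. 0 < w r" by (rule order_tendstoD(1)[OF wl(1)]) simp
  have lin: "gs.lin_sol w q"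
    unfolding gs.lin_sol_def
  proof (intro conjI)
    show "((\<lambda>r. r ^ k * q r) \<longlongrightarrow> 0) (at_right 0)" using wl by (auto intro!: tendsto_eq_intros)
    show "((\<lambda>r. r ^ (k + 1) * w r) \<longlongrightarrow> 0) (at_right 0)" using wl by (auto intro!: tendsto_eq_intros)
    obtain e where e: "0 < e" "\<And>x. 0 < x \<Longrightarrow> x < e \<Longrightarrow> 0 < w x" using near unfolding eventually_at_right_field by auto
    then have "0 < w (e / 2)" "0 < e / 2" by simp_all
    then show "\<exists>r>0. w r \<noteq> 0" by (metis less_irrefl)
  qed (use w(1) in \<open>auto simp: rad_ode_def\<close>)
  obtain R0 where R0: "0 < R0" "\<And>r. R0 \<le> r \<Longrightarrow> w r < 0" "\<And>r. R0 \<le> r \<Longrightarrow> q r < 0"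
    using gs.lin_sol_eventually_neg[OF lin near] by metis
  obtain a \<delta> where a: "0 < a" "0 < \<delta>" "\<delta> < b" "\<And>s. 0 \<le> s \<Longrightarrow> s \<le> \<delta> \<Longrightarrow> g' s \<le> - a" using g_small by metis
  have g'neg: "g' s \<le> 0" if "0 \<le> s" "s \<le> \<delta>" for s using a(4)[OF that] a(1) by simp
  have \<delta>D: "\<delta> \<le> D" using a(3) bD by simp
  have "\<forall>\<^sub>F r in at_top. U d r < \<delta>" by (rule order_tendstoD(2)[OF gs.U_lim a(2)])
  then obtain R1 where R1: "\<And>r. R1 \<le> r \<Longrightarrow> U d r < \<delta>" unfolding eventually_at_top_linorder by auto
  define R where "R = max R0 R1"
  have R: "0 < R" "w R < 0" "q R < 0" "\<And>r. R \<le> r \<Longrightarrow> U d r < \<delta>" using R0 R1 unfolding R_def by auto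
  \<comment> \<open>With half of the smaller modulus as error, w(R) + \<eta> and q(R) + \<eta> are
    still negative, so the linear term decides the sign.\<close>
  define \<eta> where "\<eta> = min (- w R) (- q R) / 2"
  have \<eta>: "0 < \<eta>" "\<eta> < - w R" "\<eta> < - q R" using R unfolding \<eta>_def by auto
  obtain \<epsilon>1 where \<epsilon>1: "0 < \<epsilon>1" "\<And>e. \<bar>e\<bar> < \<epsilon>1 \<Longrightarrow> \<bar>U (d + e) R - U d R - e * w R\<bar> \<le> \<eta> * \<bar>e\<bar>"
    "\<And>e. \<bar>e\<bar> < \<epsilon>1 \<Longrightarrow> \<bar>p (d + e) R - p d R - e * q R\<bar> \<le> \<eta> * \<bar>e\<bar>"
    "\<And>e t. \<bar>e\<bar> < \<epsilon>1 \<Longrightarrow> 0 \<le> t \<Longrightarrow> t \<le> R \<Longrightarrow> 0 < U (d + e) t"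
    using linearization[OF gs dD w R(1) \<eta>(1)] by blast
  define C where "C = gw_const L R + 1"
  have C: "1 \<le> C" using gw_nonneg[of R] R unfolding C_def by simp
  define \<epsilon> where "\<epsilon> = min \<epsilon>1 (min (d - b) ((\<delta> - U d R) / C))"
  have \<epsilon>: "0 < \<epsilon>" "\<epsilon> \<le> \<epsilon>1" "\<epsilon> \<le> d - b" "\<epsilon> \<le> (\<delta> - U d R) / C" using \<epsilon>1(1) bd R(4)[of R] C unfolding \<epsilon>_def by auto
  show thesis
  proof (rule that[OF \<epsilon>(1)])
    fix e assume e: "0 < e" "e < \<epsilon>"
    have ab: "\<bar>e\<bar> < \<epsilon>1" "\<bar>- e\<bar> < \<epsilon>1" using e \<epsilon>(2) by auto
    have me: "e * (w R + \<eta>) < 0" "e * (q R + \<eta>) < 0" using e \<eta> by (auto simp: mult_pos_neg)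
    show "d + e \<in> crossing"
    proof (rule ccontr)
      assume "d + e \<notin> crossing"
      then have nn: "0 \<le> U (d + e) r" if "0 < r" for r using that unfolding crossing_def by force
      have i: "U (d + e) R < U d R" "p (d + e) R < p d R"
        using \<epsilon>1(2)[OF ab(1)] \<epsilon>1(3)[OF ab(1)] me e(1) by (auto simp: algebra_simps abs_le_iff)
      have "U d R - U (d + e) R \<le> U d c" if c: "R \<le> c" for c
      proof -
        have "U d R - U (d + e) R \<le> U d c - U (d + e) c"
        proof (rule separation[OF R(1) c i \<delta>D g'neg])
          fix r assume "R \<le> r"
          then show "0 \<le> U (d + e) r" "U d r \<le> \<delta>" using nn[of r] R(1) R(4)[of r] by simp_all
        qed
        then show ?thesis using nn[of c] c R(1) by simp
      qed
      then have "U d R - U (d + e) R \<le> 0"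
        by (intro tendsto_lowerbound[OF gs.U_lim]) (auto intro: eventually_mono[OF eventually_ge_at_top[of R]])
      then show False using i by simp
    qed
    \<comment> \<open>The sum form lets the estimates for d + e be used with the increment -
      e.\<close>
    let ?v = "d + - e"
    have i: "U d R < U ?v R" "p d R < p ?v R"
      using \<epsilon>1(2)[OF ab(2)] \<epsilon>1(3)[OF ab(2)] me e(1) by (auto simp: algebra_simps abs_le_iff)
    have vR: "U ?v R \<le> \<delta>"
    proof -
      have "\<bar>U ?v R - U d R\<bar> \<le> gw_const L R * \<bar>?v - d\<bar>" by (rule flow_lip(1)) (use R in auto)
      also have "\<dots> \<le> C * e" using e unfolding C_def by (simp add: algebra_simps)
      also have "\<dots> \<le> C * \<epsilon>" using e C by (intro mult_left_mono) auto
      also have "\<dots> \<le> \<delta> - U d R" using \<epsilon>(4) C by (simp add: field_simps)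
      finally show ?thesis by simp
    qed
    have bv: "b < ?v" "?v < D" using e \<epsilon>(3) dD by auto
    have "?v \<in> trapped"
    proof (rule ccontr)
      assume nt: "?v \<notin> trapped"
      show False
      proof (cases "?v \<in> crossing")
        case False
        then have "ground_state g g' b bt k (U ?v) (p ?v)" using trichotomy[OF bv _ nt] by simp
        then interpret v: ground_state g g' b bt k "U ?v" "p ?v" .
        have le: "U ?v r \<le> \<delta>" if "R \<le> r" for r
          using v.U_strict[of R r] vR that R by (cases "R = r") auto
        have "U ?v R - U d R \<le> U ?v c - U d c" if "R \<le> c" for c
          by (rule separation[OF R(1) that i \<delta>D g'neg]) (use le gs.U_pos R in \<open>auto intro: less_imp_le\<close>)
        then have "U ?v R - U d R \<le> 0 - 0"
          by (intro tendsto_lowerbound[OF tendsto_diff[OF v.U_lim gs.U_lim]])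
             (auto intro: eventually_mono[OF eventually_ge_at_top[of R]])
        then show False using i by simp
      next
        case True
        then obtain r where r: "0 < r" "U ?v r < 0" unfolding crossing_def by auto
        obtain s where s: "0 < s" "s \<le> r" "- U ?v s = 0" "\<And>x. 0 \<le> x \<Longrightarrow> x < s \<Longrightarrow> - U ?v x < 0"
          by (rule first_zero[of 0 r "\<lambda>x. - U ?v x"])
             (use r U0[of ?v] bv b_pos in \<open>auto intro!: continuous_intros continuous_on_subset[OF Uc]\<close>)
        have sR: "R < s" using \<epsilon>1(4)[OF ab(2), of s] s by force
        have E: "0 \<le> Ex ?v t" if "0 < t" "t < s" for t
        proof (rule ccontr)
          assume "\<not> 0 \<le> Ex ?v t"
          then have "?v \<in> trapped" unfolding trapped_def using that s(4) by force
          then show False using nt by simp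
        qed
        have pn: "p ?v t < 0" if "0 < t" "t < s" for t
          by (rule p_neg_of_energy[OF bv that(1)]) (use s(4) E that in force)+
        have le: "U ?v t \<le> U ?v R" if "R \<le> t" "t \<le> s" for t
        proof (rule DERIV_nonpos_imp_decreasing_open[OF that(1)])
          fix x assume "R < x" "x < t"
          then show "\<exists>y. (U ?v has_real_derivative y) (at x) \<and> y \<le> 0" using Ud[of x ?v] pn[of x] R that by force
        qed (use R in \<open>auto intro: continuous_on_subset[OF Uc]\<close>)
        have "U ?v R - U d R \<le> U ?v s - U d s"
          by (rule separation[OF R(1) less_imp_le[OF sR] i \<delta>D g'neg]) (use le vR gs.U_pos R in \<open>force intro: less_imp_le\<close>)+
        then show False using i s(3) gs.U_pos[of s] s(1) by simp
      qed
    qed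
    then show "d - e \<in> trapped" by simp
  qed
qed

text \<open>Let m be the infimum of the noncrossing heights in (d, e]. By \<open>neighbours\<close>,
  m > d, and by openness m does not cross. If m is trapped, so are nearby heights; if m is a ground
  state, \<open>neighbours\<close> again makes the heights just below it trapped. But all heights
  between d and m cross.\<close>

lemma ground_heights_not_less:
  assumes 1: "ground_state g g' b bt k (U d) (p d)" and 2: "ground_state g g' b bt k (U e) (p e)" and de: "d < e" "e < D"
  shows False
proof -
  have bd: "b < d" using ground_state.U0_gt[OF 1] U0[of d] by simp
  have not_c: "x \<notin> crossing" if "ground_state g g' b bt k (U x) (p x)" for x

  proof
    assume "x \<in> crossing"
    then obtain r where "0 < r" "U x r < 0" unfolding crossing_def by auto
    then show False using ground_state.U_pos[OF that, of r] by simp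
  qed
  define A where "A = {x \<in> {d<..e}. x \<notin> crossing}"
  have A: "e \<in> A" "bdd_below A" unfolding A_def using de not_c[OF 2] by (auto intro!: bdd_belowI[of _ d])
  define m where "m = Inf A"
  obtain \<epsilon> where \<epsilon>: "0 < \<epsilon>" "\<And>h. 0 < h \<Longrightarrow> h < \<epsilon> \<Longrightarrow> d + h \<in> crossing"
    using neighbours[OF 1] de by (metis less_trans)
  have me: "m \<le> e" unfolding m_def by (rule cInf_lower[OF A])
  have "d + \<epsilon> \<le> m" unfolding m_def
  proof (rule cInf_greatest)
    fix x assume "x \<in> A"
    then show "d + \<epsilon> \<le> x" using \<epsilon>(2)[of "x - d"] unfolding A_def by force
  qed (use A in auto)
  then have dm: "d < m" using \<epsilon> by simp
  have below: "x \<in> crossing" if "d < x" "x < m" for x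
  proof (rule ccontr)
    assume "x \<notin> crossing"
    then have "x \<in> A" unfolding A_def using that me by auto
    then show False using cInf_lower[OF _ A(2), of x] that unfolding m_def by simp
  qed
  have mc: "m \<notin> crossing"
  proof
    assume "m \<in> crossing"
    then obtain \<epsilon>' where e': "0 < \<epsilon>'" "\<And>x. \<bar>x - m\<bar> < \<epsilon>' \<Longrightarrow> x \<in> crossing" using crossing_open by blast
    have "m + \<epsilon>' \<le> Inf A"
    proof (rule cInf_greatest)
      fix x assume x: "x \<in> A"
      then have "m \<le> x" unfolding m_def using A(2) by (rule cInf_lower)
      then show "m + \<epsilon>' \<le> x" using e'(2)[of x] x unfolding A_def by force
    qed (use A in auto)
    then show False using e'(1) unfolding m_def by simp
  qed
  have left_trapped: False if t: "0 < \<epsilon>'" "\<And>x. 0 < x \<Longrightarrow> x < \<epsilon>' \<Longrightarrow> m - x \<in> trapped" for \<epsilon>'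
  proof -
    define x where "x = min (\<epsilon>' / 2) ((m - d) / 2)"
    have x: "0 < x" "x < \<epsilon>'" "d < m - x" using t(1) dm unfolding x_def by (auto simp: min_def field_simps)
    show False using crossing_trapped_disjoint[OF below[of "m - x"] t(2)[of x]] x by simp
  qed
  show False
  proof (cases "m \<in> trapped")
    case True
    then obtain \<epsilon>' where e': "0 < \<epsilon>'" "\<And>x. \<bar>x - m\<bar> < \<epsilon>' \<Longrightarrow> x \<in> trapped" using trapped_open by blast
    show False by (rule left_trapped[OF e'(1)]) (use e'(2) in auto)
  next
    case False
    have "ground_state g g' b bt k (U m) (p m)" by (rule trichotomy) (use bd dm me de mc False in auto)
    then obtain \<epsilon>' where "0 < \<epsilon>'" "\<And>x. 0 < x \<Longrightarrow> x < \<epsilon>' \<Longrightarrow> m - x \<in> trapped"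
      using neighbours[of m] me de by (metis le_less_trans)
    then show False by (rule left_trapped)
  qed
qed

end

text \<open>D is placed strictly between both heights and bt, so both profiles stay where
  \<open>gx\<close> agrees with g. Gronwall with equal initial values identifies each profile with
  the shooting solution of its height, and two different heights are impossible.\<close>

theorem ground_state_unique:
  assumes 1: "ground_state g g' b bt k U1 P1" and 2: "ground_state g g' b bt k U2 P2" and r: "0 \<le> r"
  shows "U1 r = U2 r"
proof -
  interpret a: ground_state g g' b bt k U1 P1 by (rule 1)
  interpret c: ground_state g g' b bt k U2 P2 by (rule 2)
  define M where "M = max (U1 0) (U2 0)"
  have "ereal M < bt" using a.U0_less c.U0_less unfolding M_def by (auto simp: max_def)
  then obtain D where D: "M < D" "ereal D < bt" using ereal_dense2[of "ereal M" bt] by auto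
  have bD: "b < D" using D a.U0_gt unfolding M_def by simp
  then have D0: "0 \<le> D" using a.b_pos by simp
  obtain L where L: "0 \<le> L" "\<And>x y. x \<in> {0..D} \<Longrightarrow> y \<in> {0..D} \<Longrightarrow> \<bar>g x - g y\<bar> \<le> L * \<bar>x - y\<bar>"
    "\<And>x. x \<in> {0..D} \<Longrightarrow> \<bar>g' x\<bar> \<le> L" by (rule a.g_lipschitz[OF D0]) blast
  define gx where "gx = (\<lambda>s. g (max 0 (min D s)))"
  have gxL: "\<bar>gx x - gx y\<bar> \<le> L * \<bar>x - y\<bar>" for x y
  proof -
    have "\<bar>gx x - gx y\<bar> \<le> L * \<bar>max 0 (min D x) - max 0 (min D y)\<bar>" unfolding gx_def by (rule L(2)) (use D0 in auto)
    also have "\<dots> \<le> L * \<bar>x - y\<bar>" by (rule mult_left_mono[OF _ L(1)]) (auto simp: max_def min_def)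
    finally show ?thesis .
  qed
  have gxc: "continuous_on UNIV gx" unfolding gx_def
    by (intro continuous_on_compose2[OF a.g_cont] continuous_intros) auto
  have "\<exists>u q. rad_ode k u q (\<lambda>r. gx (u r)) \<and> u 0 = d" for d
    by (rule rad_ode_exists[of "\<lambda>r x. gx x" L "\<bar>gx 0\<bar>" k d])
       (use gxL in \<open>auto intro: continuous_on_compose2[OF gxc]\<close>)
  then obtain U p where fl: "\<And>d. rad_ode k (U d) (p d) (\<lambda>r. gx (U d r))" "\<And>d. U d 0 = d" by metis
  interpret sh: shooting g g' b bt k D U p gx L
    by unfold_locales (use a.k1 bD D(2) gx_def L fl in auto)
  have same: "U (V 0) t = V t" if V: "ground_state g g' b bt k V Q" "V 0 < D" and t: "0 \<le> t" for V Q t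
  proof -
    interpret v: ground_state g g' b bt k V Q by (rule V)
    have "rad_ode k V Q (\<lambda>r. gx (V r))"
      using v.ode sh.gx_eq v.U_pos v.U_le V(2) unfolding rad_ode_def by (smt (verit, best) order_less_imp_le)
    from rad_ode_diff[OF fl(1) this, of "V 0" 1]
    have o: "rad_ode k (\<lambda>r. U (V 0) r - 1 * V r) (\<lambda>r. p (V 0) r - 1 * Q r) (\<lambda>r. gx (U (V 0) r) - 1 * gx (V r))" .
    have "\<bar>U (V 0) t - 1 * V t\<bar> \<le> gw_const L t * (\<bar>U (V 0) 0 - 1 * V 0\<bar> + 0)"
      by (rule rad_gronwall(1)[OF o L(1)]) (use gxL t in auto)
    then show ?thesis by (simp add: fl)
  qed
  have gs: "ground_state g g' b bt k (U (V 0)) (p (V 0))" if V: "ground_state g g' b bt k V Q" "V 0 < D" for V Q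
  proof -
    interpret v: ground_state g g' b bt k V Q by (rule V)
    have "(U (V 0) \<longlongrightarrow> 0) at_top"
      using v.U_lim
      by (rule Lim_transform_eventually) (rule eventually_mono[OF eventually_ge_at_top[of 0]], simp add: same[OF V])
    then show ?thesis
      by (intro sh.ground_state_flow) (use same[OF V] v.U_pos v.U_le V(2) in force)+
  qed
  have lt: "U1 0 < D" "U2 0 < D" using D unfolding M_def by auto
  have "U1 0 = U2 0"
    using sh.ground_heights_not_less[OF gs[OF 1 lt(1)] gs[OF 2 lt(2)]] sh.ground_heights_not_less[OF gs[OF 2 lt(2)] gs[OF 1 lt(1)]] lt
    by (meson linorder_neqE_linordered_idom)
  then show ?thesis using same[OF 1 lt(1) r] same[OF 2 lt(2) r] by simp
qed

section \<open>From the partial to the ordinary differential equation\<close>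

lemma partial_line_deriv:
  assumes "f differentiable (at (x + s *\<^sub>R i))"
  shows "((\<lambda>s. f (x + s *\<^sub>R i)) has_real_derivative partial i f (x + s *\<^sub>R i)) (at s)"
proof -
  have f: "(f has_derivative frechet_derivative f (at (x + s *\<^sub>R i))) (at (x + s *\<^sub>R i))"
    using assms by (simp add: frechet_derivative_works)
  have "((\<lambda>s. x + s *\<^sub>R i) has_derivative (\<lambda>t. t *\<^sub>R i)) (at s)" by (auto intro!: derivative_eq_intros)
  from diff_chain_at[OF this f]
  have "((\<lambda>s. f (x + s *\<^sub>R i)) has_derivative (\<lambda>t. frechet_derivative f (at (x + s *\<^sub>R i)) (t *\<^sub>R i))) (at s)"
    by (simp add: o_def)
  moreover have "frechet_derivative f (at (x + s *\<^sub>R i)) (t *\<^sub>R i) = t * partial i f (x + s *\<^sub>R i)" for t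
    unfolding partial_def using linear_scale[OF linear_frechet_derivative[OF assms]] by simp
  ultimately have "((\<lambda>s. f (x + s *\<^sub>R i)) has_derivative (\<lambda>t. t * partial i f (x + s *\<^sub>R i))) (at s)" by simp
  then show ?thesis unfolding has_field_derivative_def
    by (rule has_derivative_eq_rhs) (simp add: fun_eq_iff mult.commute)
qed

text \<open>On the ray through e the second derivative along e is U'', and each of the k directions
  orthogonal to e contributes U'/r. U'(0) = 0 holds because r -> u(r e) is an even differentiable
  function on the whole line.\<close>

theorem positive_radial_solution_ground_state:
  fixes u :: "'a::euclidean_space \<Rightarrow> real"
  assumes nl: "nonlinearity g g' b bt" and dim: "DIM('a) = Suc k" and k: "1 \<le> k"
    and sol: "positive_radial_solution g u" and e: "e \<in> Basis"
  shows "ground_state g g' b bt k (\<lambda>r. u (r *\<^sub>R e)) (\<lambda>r. partial e u (r *\<^sub>R e))" and "u x = u (norm x *\<^sub>R e)"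
proof -
  have C2: "Ck (Suc (Suc 0)) u" and eq: "\<And>x. - laplacian u x = g (u x)" and lim: "(u \<longlongrightarrow> 0) at_infinity"
    and pos: "\<And>x. 0 < u x"
    using sol unfolding positive_radial_solution_def by (auto simp: numeral_2_eq_2)
  obtain V where V: "\<And>x. u x = V (norm x)" using sol unfolding positive_radial_solution_def by auto
  define U where "U r = u (r *\<^sub>R e)" for r
  define P where "P r = partial e u (r *\<^sub>R e)" for r
  define P2 where "P2 r = partial e (partial e u) (r *\<^sub>R e)" for r
  have ne: "norm e = 1" using e by simp
  have rad: "u x = U (norm x)" for x unfolding U_def V[of x] V[of "norm x *\<^sub>R e"] using ne by simp
  show "u x = u (norm x *\<^sub>R e)" using rad unfolding U_def .
  have du: "u differentiable (at x)" for x using C2 by (auto simp: differentiable_on_def)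
  have dpu: "partial i u differentiable (at x)" if "i \<in> Basis" for i x using C2 that by (auto simp: differentiable_on_def)
  have Ud: "(U has_real_derivative P r) (at r)" for r
    using partial_line_deriv[of u 0 r e] du unfolding U_def P_def by simp
  have Pd: "(P has_real_derivative P2 r) (at r)" for r
    using partial_line_deriv[of "partial e u" 0 r e] dpu[OF e] unfolding P_def P2_def by simp
  have P0: "P 0 = 0"
  proof -
    have even: "U (- r) = U r" for r unfolding U_def V[of "(- r) *\<^sub>R e"] V[of "r *\<^sub>R e"] by simp
    have "((\<lambda>r. U (- r)) has_real_derivative P (- 0) * - 1) (at 0)"
      by (rule DERIV_chain2[OF Ud]) (auto intro!: derivative_eq_intros)
    then have "(U has_real_derivative - P 0) (at 0)" unfolding even by simp
    from DERIV_unique[OF Ud[of 0] this] show ?thesis by simp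
  qed
  \<comment> \<open>On the line r e + s i the norm is n = sqrt(r^2 + s^2), so the partial derivative
    is P(n) s / n. Its difference quotient at s = 0 is P(n) / n, and continuity of P gives the
    limit.\<close>
  have trans: "partial i (partial i u) (r *\<^sub>R e) = P r / r" if i: "i \<in> Basis" "i \<noteq> e" and r: "0 < r" for i r
  proof -
    define n where "n s = sqrt (r\<^sup>2 + s\<^sup>2)" for s
    have np: "0 < n s" for s unfolding n_def using r by (simp add: add_pos_nonneg)
    have norm: "norm (r *\<^sub>R e + s *\<^sub>R i) = n s" for s
    proof -
      have "(norm (r *\<^sub>R e + s *\<^sub>R i))\<^sup>2 = (r *\<^sub>R e + s *\<^sub>R i) \<bullet> (r *\<^sub>R e + s *\<^sub>R i)"
        by (rule power2_norm_eq_inner)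
      also have "\<dots> = r\<^sup>2 + s\<^sup>2"
        using i e by (simp add: inner_add_left inner_add_right inner_Basis power2_eq_square)
      finally have "(norm (r *\<^sub>R e + s *\<^sub>R i))\<^sup>2 = r\<^sup>2 + s\<^sup>2" .
      then show ?thesis unfolding n_def by (metis norm_ge_zero real_sqrt_abs abs_of_nonneg)
    qed
    have nd: "(n has_real_derivative s / n s) (at s)" for s
    proof -
      have "0 < r\<^sup>2 + s\<^sup>2" using r by (simp add: add_pos_nonneg)
      then show ?thesis unfolding n_def[abs_def] by (auto intro!: derivative_eq_intros simp: field_simps)
    qed
    have "partial i u (r *\<^sub>R e + s *\<^sub>R i) = P (n s) * (s / n s)" for s
    proof (rule DERIV_unique)
      show "((\<lambda>s. u (r *\<^sub>R e + s *\<^sub>R i)) has_real_derivative partial i u (r *\<^sub>R e + s *\<^sub>R i)) (at s)"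
        by (rule partial_line_deriv[OF du])
      show "((\<lambda>s. u (r *\<^sub>R e + s *\<^sub>R i)) has_real_derivative P (n s) * (s / n s)) (at s)"
        unfolding rad norm by (rule DERIV_chain2[OF Ud nd])
    qed
    then have eq: "(\<lambda>s. partial i u (r *\<^sub>R e + s *\<^sub>R i)) = (\<lambda>s. P (n s) * (s / n s))" by auto
    have 1: "((\<lambda>s. P (n s) * (s / n s)) has_real_derivative partial i (partial i u) (r *\<^sub>R e)) (at 0)"
      using partial_line_deriv[of "partial i u" "r *\<^sub>R e" 0 i] dpu[OF i(1)] unfolding eq by simp
    have n0: "n 0 = r" unfolding n_def using r by simp
    have "isCont n 0" using nd by (rule DERIV_isCont)
    moreover have "isCont P (n 0)" using Pd by (rule DERIV_isCont)
    ultimately have "isCont (\<lambda>s. P (n s) / n s) 0"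
      by (intro continuous_intros isCont_o2[of 0 n P]) (use np[of 0] in auto)
    then have l: "((\<lambda>s. P (n s) / n s) \<longlongrightarrow> P r / r) (at 0)" unfolding isCont_def n0 .
    have "((\<lambda>s. P (n s) * (s / n s)) has_real_derivative P r / r) (at 0)"
      unfolding has_field_derivative_iff
      by (rule Lim_transform_eventually[OF l]) (auto simp: eventually_at_filter)
    then show ?thesis using DERIV_unique[OF 1] by simp
  qed
  have ode: "P2 r + real k * (P r / r) = - g (U r)" if r: "0 < r" for r
  proof -
    have "laplacian u (r *\<^sub>R e) = P2 r + (\<Sum>i\<in>Basis - {e}. partial i (partial i u) (r *\<^sub>R e))"
      unfolding laplacian_def P2_def using e by (simp add: sum.remove)
    also have "(\<Sum>i\<in>Basis - {e}. partial i (partial i u) (r *\<^sub>R e)) = (\<Sum>i\<in>Basis - {e}. P r / r)"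
      by (rule sum.cong) (use trans r in auto)
    also have "\<dots> = real k * (P r / r)" using e dim by simp
    finally show ?thesis using eq[of "r *\<^sub>R e"] unfolding U_def by simp
  qed
  have "rad_ode k U P (\<lambda>r. g (U r))" unfolding rad_ode_def
  proof (intro conjI allI impI)
    show "continuous_on {0..} U" "continuous_on {0..} P"
      using Ud Pd by (auto intro!: continuous_at_imp_continuous_on DERIV_isCont)
    show "P 0 = 0" by (rule P0)
    fix r :: real assume r: "0 < r"
    show "(U has_real_derivative P r) (at r)" by (rule Ud)
    have "((\<lambda>r. r ^ k * P r) has_real_derivative (real k * r ^ (k - Suc 0)) * P r + P2 r * r ^ k) (at r)"
      by (intro DERIV_mult DERIV_pow Pd)
    moreover have "(real k * r ^ (k - Suc 0)) * P r + P2 r * r ^ k = - (r ^ k * g (U r))"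
    proof -
      have "real k * r ^ (k - Suc 0) = r ^ k * (real k / r)" using r k by (cases k) auto
      then have "(real k * r ^ (k - Suc 0)) * P r + P2 r * r ^ k = r ^ k * (P2 r + real k * (P r / r))"
        by (simp add: algebra_simps)
      then show ?thesis unfolding ode[OF r] by simp
    qed
    ultimately show "((\<lambda>r. r ^ k * P r) has_real_derivative - (r ^ k * g (U r))) (at r)" by simp
  qed
  moreover have "(U \<longlongrightarrow> 0) at_top"
  proof -
    have "filterlim (\<lambda>r::real. r *\<^sub>R e) at_infinity at_top"
      unfolding filterlim_at_infinity_conv_norm_at_top using ne
      by (simp add: filterlim_abs_real)
    from filterlim_compose[OF lim this] show ?thesis unfolding U_def .
  qed
  ultimately have "ground_state g g' b bt k U P"
    using nl k pos unfolding ground_state_def ground_state_axioms_def U_def by auto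
  then show "ground_state g g' b bt k (\<lambda>r. u (r *\<^sub>R e)) (\<lambda>r. partial e u (r *\<^sub>R e))" unfolding U_def P_def .
qed

section \<open>Smooth radial test functions\<close>

lemma partial_eqI:
  assumes "(f has_derivative f') (at x)" shows "partial i f x = f' i"
  unfolding partial_def using frechet_derivative_at[OF assms] by simp

lemma partial_works:
  assumes "f differentiable_on UNIV" shows "(f has_derivative frechet_derivative f (at x)) (at x)"
  using assms by (simp add: differentiable_on_def frechet_derivative_works)

lemma Ck_Suc_imp: "Ck (Suc k) f \<Longrightarrow> Ck k f"
  by (induction k arbitrary: f) (auto simp: differentiable_imp_continuous_on)

lemma Ck_const: "Ck k (\<lambda>x. c)"
proof (induction k arbitrary: c)
  case (Suc k)
  have "partial i (\<lambda>x. c) = (\<lambda>x. 0)" for i :: 'a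
    by (rule ext, rule partial_eqI) (auto intro!: derivative_eq_intros)
  then show ?case using Suc by simp
qed simp

lemma Ck_inner: "Ck k (\<lambda>x. x \<bullet> i)"
proof (cases k)
  case (Suc m)
  have "partial j (\<lambda>x. x \<bullet> i) = (\<lambda>x. j \<bullet> i)" for j
    by (rule ext, rule partial_eqI) (auto intro!: derivative_eq_intros)
  then show ?thesis using Suc Ck_const by (auto intro!: derivative_intros differentiable_on_def[THEN iffD2])
qed (auto intro!: continuous_intros)

lemma Ck_add: "Ck k f \<Longrightarrow> Ck k h \<Longrightarrow> Ck k (\<lambda>x. f x + h x)"
proof (induction k arbitrary: f h)
  case (Suc k)
  then have d: "f differentiable_on UNIV" "h differentiable_on UNIV" by auto
  have "partial i (\<lambda>x. f x + h x) = (\<lambda>x. partial i f x + partial i h x)" for i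
    by (rule ext, subst partial_eqI[OF has_derivative_add[OF partial_works[OF d(1)] partial_works[OF d(2)]]])
       (simp add: partial_def)
  then show ?case using Suc by (auto intro!: differentiable_on_add)
qed (auto intro: continuous_on_add)

lemma Ck_mult: "Ck k f \<Longrightarrow> Ck k h \<Longrightarrow> Ck k (\<lambda>x. f x * h x)"
proof (induction k arbitrary: f h)
  case (Suc k)
  then have d: "f differentiable_on UNIV" "h differentiable_on UNIV" by auto
  have "partial i (\<lambda>x. f x * h x) = (\<lambda>x. f x * partial i h x + partial i f x * h x)" for i
    by (rule ext, subst partial_eqI[OF has_derivative_mult[OF partial_works[OF d(1)] partial_works[OF d(2)]]])
       (simp add: partial_def)
  moreover have "Ck k (\<lambda>x. f x * partial i h x + partial i f x * h x)" if "i \<in> Basis" for i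
    using Suc.prems that by (intro Ck_add Suc.IH) (auto intro: Ck_Suc_imp)
  ultimately show ?case using d by (auto intro!: differentiable_on_mult)
qed (auto intro: continuous_on_mult)

lemma Ck_inverse: "Ck k f \<Longrightarrow> (\<And>x. f x \<noteq> 0) \<Longrightarrow> Ck k (\<lambda>x. inverse (f x))"
proof (induction k)
  case (Suc k)
  then have d: "f differentiable_on UNIV" by auto
  have D: "((\<lambda>x. inverse (f x)) has_derivative (\<lambda>h. - (inverse (f x) * frechet_derivative f (at x) h * inverse (f x)))) (at x)" for x
    by (rule Deriv.has_derivative_inverse[OF Suc.prems(2) partial_works[OF d]])
  have "partial i (\<lambda>x. inverse (f x)) = (\<lambda>x. (- 1) * (inverse (f x) * inverse (f x)) * partial i f x)" for i
    by (rule ext, subst partial_eqI[OF D]) (simp add: partial_def)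
  moreover have "Ck k (\<lambda>x. (- 1) * (inverse (f x) * inverse (f x)) * partial i f x)" if "i \<in> Basis" for i
    using Suc that by (intro Ck_mult Ck_const Suc.IH) (auto intro: Ck_Suc_imp)
  moreover have "(\<lambda>x. inverse (f x)) differentiable_on UNIV"
    using D by (auto simp: differentiable_on_def differentiable_def)
  ultimately show ?case by auto
qed (auto intro!: continuous_on_inverse)

lemma real_deriv_eq_partial:
  assumes "Ck (Suc 0) (f :: real \<Rightarrow> real)" shows "(f has_real_derivative partial 1 f x) (at x)"
  using partial_line_deriv[of f 0 x 1] assms by (auto simp: differentiable_on_def)

lemma partial_real_eq: "(f has_real_derivative D) (at x) \<Longrightarrow> partial 1 f x = D"
  using partial_eqI[of f "(*) D" x 1] by (simp add: has_field_derivative_def)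

lemma Ck_Suc_real:
  fixes f :: "real \<Rightarrow> real"
  assumes "\<And>x. (f has_real_derivative f' x) (at x)" "Ck k f'"
  shows "Ck (Suc k) f"
proof -
  have "f differentiable_on UNIV"
    using assms(1) by (auto simp: differentiable_on_def differentiable_def has_field_derivative_def)
  moreover have "partial 1 f = f'"
    by (rule ext, rule partial_real_eq, rule assms(1))
  ultimately show ?thesis using assms(2) by simp
qed

text \<open>Radial functions are written in terms of x \<bullet> x because this polynomial, unlike
  the norm, is smooth at the origin. The induction needs all orders of \<eta>, since each derivative
  replaces \<eta> by \<eta>'.\<close>

lemma Ck_comp_inner_self:
  fixes \<eta> :: "real \<Rightarrow> real"
  assumes "\<And>n. Ck n \<eta>"
  shows "Ck k (\<lambda>x::'a::euclidean_space. \<eta> (x \<bullet> x))"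
    and "\<And>i. partial i (\<lambda>x::'a. \<eta> (x \<bullet> x)) = (\<lambda>x. partial 1 \<eta> (x \<bullet> x) * (2 * (x \<bullet> i)))"
proof -
  have D: "((\<lambda>x::'a. \<eta> (x \<bullet> x)) has_derivative (\<lambda>h. partial 1 \<eta> (x \<bullet> x) * (x \<bullet> h + h \<bullet> x))) (at x)"
    if "\<And>n. Ck n \<eta>" for \<eta> :: "real \<Rightarrow> real" and x :: 'a
    by (rule has_derivative_compose[OF has_derivative_inner[OF has_derivative_ident has_derivative_ident]
        real_deriv_eq_partial[OF that, unfolded has_field_derivative_def]])
  have P: "partial i (\<lambda>x::'a. \<eta> (x \<bullet> x)) = (\<lambda>x. partial 1 \<eta> (x \<bullet> x) * (2 * (x \<bullet> i)))"
    if "\<And>n. Ck n \<eta>" for \<eta> :: "real \<Rightarrow> real" and i :: 'a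
    by (rule ext, subst partial_eqI[OF D[OF that]]) (simp add: inner_commute)
  show "\<And>i. partial i (\<lambda>x::'a. \<eta> (x \<bullet> x)) = (\<lambda>x. partial 1 \<eta> (x \<bullet> x) * (2 * (x \<bullet> i)))"
    by (rule P[OF assms])
  show "Ck k (\<lambda>x::'a. \<eta> (x \<bullet> x))" using assms
  proof (induction k arbitrary: \<eta>)
    case 0
    have "Ck 0 \<eta>" by (rule 0)
    then have "continuous_on UNIV \<eta>" by simp
    then show ?case by (auto intro!: continuous_on_compose2[of UNIV \<eta>] continuous_intros)
  next
    case (Suc k)
    have "(\<lambda>x::'a. \<eta> (x \<bullet> x)) differentiable_on UNIV"
      using D[OF Suc.prems] by (auto simp: differentiable_on_def differentiable_def)
    moreover have "Ck n (partial 1 \<eta>)" for n using Suc.prems[of "Suc n"] by simp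
    then have "Ck k (\<lambda>x. partial 1 \<eta> (x \<bullet> x) * (2 * (x \<bullet> i)))" for i :: 'a
      by (intro Ck_mult Ck_const Ck_inner Suc.IH)
    ultimately show ?case using P[OF Suc.prems] by simp
  qed
qed

lemma laplacian_radial:
  fixes \<eta> :: "real \<Rightarrow> real" and x :: "'a::euclidean_space"
  assumes "\<And>n. Ck n \<eta>"
  shows "laplacian (\<lambda>x::'a. \<eta> (x \<bullet> x)) x
    = 4 * (x \<bullet> x) * partial 1 (partial 1 \<eta>) (x \<bullet> x) + 2 * real DIM('a) * partial 1 \<eta> (x \<bullet> x)"
proof -
  have s: "Ck n (partial 1 \<eta>)" for n using assms[of "Suc n"] by simp
  have "partial i (partial i (\<lambda>x::'a. \<eta> (x \<bullet> x))) x
    = partial 1 (partial 1 \<eta>) (x \<bullet> x) * (2 * (x \<bullet> i)) * (2 * (x \<bullet> i)) + partial 1 \<eta> (x \<bullet> x) * 2" if i: "i \<in> Basis" for i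
  proof -
    have "Ck (Suc 0) (\<lambda>x::'a. partial 1 \<eta> (x \<bullet> x))" by (rule Ck_comp_inner_self(1)[OF s])
    then have d: "(\<lambda>x::'a. partial 1 \<eta> (x \<bullet> x)) differentiable_on UNIV" by simp
    have "((\<lambda>x. partial 1 \<eta> (x \<bullet> x) * (2 * (x \<bullet> i))) has_derivative
        (\<lambda>h. partial 1 \<eta> (x \<bullet> x) * (2 * (h \<bullet> i)) + frechet_derivative (\<lambda>x. partial 1 \<eta> (x \<bullet> x)) (at x) h * (2 * (x \<bullet> i)))) (at x)"
      by (rule has_derivative_mult[OF partial_works[OF d]]) (auto intro!: derivative_eq_intros)
    from partial_eqI[OF this, of i]
    have "partial i (\<lambda>x. partial 1 \<eta> (x \<bullet> x) * (2 * (x \<bullet> i))) x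
      = partial 1 \<eta> (x \<bullet> x) * (2 * (i \<bullet> i)) + partial i (\<lambda>x. partial 1 \<eta> (x \<bullet> x)) x * (2 * (x \<bullet> i))"
      unfolding partial_def[of i "\<lambda>x. partial 1 \<eta> (x \<bullet> x)" x] .
    then show ?thesis unfolding Ck_comp_inner_self(2)[OF assms] Ck_comp_inner_self(2)[OF s] using i by simp
  qed
  then have "laplacian (\<lambda>x::'a. \<eta> (x \<bullet> x)) x
    = (\<Sum>i\<in>Basis. 4 * partial 1 (partial 1 \<eta>) (x \<bullet> x) * ((x \<bullet> i) * (x \<bullet> i)) + 2 * partial 1 \<eta> (x \<bullet> x))"
    unfolding laplacian_def by (intro sum.cong) auto
  also have "\<dots> = 4 * partial 1 (partial 1 \<eta>) (x \<bullet> x) * (x \<bullet> x) + 2 * real DIM('a) * partial 1 \<eta> (x \<bullet> x)"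
    by (simp add: sum.distrib sum_distrib_left[symmetric] euclidean_inner[of x x, symmetric])
  finally show ?thesis by (simp add: mult_ac)
qed

section \<open>A smooth step function\<close>

definition flat :: "real poly \<Rightarrow> real \<Rightarrow> real" where
  "flat p x = (if 0 < x then poly p (1 / x) * exp (- (1 / x)) else 0)"

lemma poly_times_exp_lim: "((\<lambda>t. poly p t * exp (- t)) \<longlongrightarrow> 0) (at_top :: real filter)"
proof -
  have "((\<lambda>t::real. \<Sum>i\<le>degree p. coeff p i * (t ^ i / exp t)) \<longlongrightarrow> (\<Sum>i\<le>degree p. coeff p i * 0)) at_top"
    by (intro tendsto_sum tendsto_mult tendsto_const tendsto_power_div_exp_0)
  then show ?thesis by (simp add: poly_altdef sum_divide_distrib exp_minus field_simps)
qed

text \<open>The functions p(1/x) exp(- 1/x) with polynomial p, extended by 0, are closed under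
  differentiation: with t = 1/x the new polynomial is t^2 (p - p'). At 0 the right difference
  quotient is of the same form with t p in place of p, and tends to 0. Smoothness follows by
  induction over all p.\<close>

lemma flat_deriv: "(flat p has_real_derivative flat (monom 1 2 * (p - pderiv p)) x) (at x)"
proof (cases x "0::real" rule: linorder_cases)
  case greater
  have 1: "((\<lambda>x::real. 1 / x) has_real_derivative - (1 / x\<^sup>2)) (at x)"
    using greater by (auto intro!: derivative_eq_intros simp: power2_eq_square)
  have "((\<lambda>x. poly p (1 / x) * exp (- (1 / x))) has_real_derivative
     (poly (pderiv p) (1 / x) * (- (1 / x\<^sup>2))) * exp (- (1 / x)) + (exp (- (1 / x)) * - (- (1 / x\<^sup>2))) * poly p (1 / x)) (at x)"
    by (intro DERIV_mult DERIV_chain2[OF poly_DERIV 1] DERIV_chain2[OF DERIV_exp DERIV_minus[OF 1]])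
  moreover have "(poly (pderiv p) (1 / x) * (- (1 / x\<^sup>2))) * exp (- (1 / x)) + (exp (- (1 / x)) * - (- (1 / x\<^sup>2))) * poly p (1 / x)
     = flat (monom 1 2 * (p - pderiv p)) x"
    using greater unfolding flat_def by (simp add: poly_monom algebra_simps power_divide)
  ultimately have "((\<lambda>x. poly p (1 / x) * exp (- (1 / x))) has_real_derivative flat (monom 1 2 * (p - pderiv p)) x) (at x)" by simp
  then show ?thesis
    by (rule has_field_derivative_transform_within_open[where S = "{0<..}"]) (use greater in \<open>auto simp: flat_def\<close>)
next
  case less
  have "((\<lambda>x. 0) has_real_derivative 0) (at x)" by simp
  then have "(flat p has_real_derivative 0) (at x)"
    by (rule has_field_derivative_transform_within_open[where S = "{..<0}"]) (use less in \<open>auto simp: flat_def\<close>)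
  then show ?thesis using less by (simp add: flat_def)
next
  case equal
  have r: "((\<lambda>y. (flat p y - flat p 0) / (y - 0)) \<longlongrightarrow> 0) (at_right 0)"
  proof -
    have "((\<lambda>y::real. poly (pCons 0 p) (inverse y) * exp (- inverse y)) \<longlongrightarrow> 0) (at_right 0)"
      by (rule filterlim_compose[OF poly_times_exp_lim filterlim_inverse_at_top_right])
    then show ?thesis
      by (rule Lim_transform_eventually)
         (rule eventually_mono[OF eventually_at_right_less[of 0]], simp add: flat_def field_simps)
  qed
  have l: "((\<lambda>y. (flat p y - flat p 0) / (y - 0)) \<longlongrightarrow> 0) (at_left 0)"
  proof (rule Lim_transform_eventually[OF tendsto_const])
    have "\<forall>\<^sub>F y in at_left (0::real). y \<in> {-1<..<0}" by (rule eventually_at_left_real) simp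
    then show "\<forall>\<^sub>F y in at_left 0. 0 = (flat p y - flat p 0) / (y - 0)"
      by eventually_elim (simp add: flat_def)
  qed
  have "((\<lambda>y. (flat p y - flat p 0) / (y - 0)) \<longlongrightarrow> 0) (at 0)" using filterlim_split_at[OF l r] .
  then show ?thesis using equal by (simp add: has_field_derivative_iff flat_def)
qed

lemma Ck_flat: "Ck k (flat p)"
proof (induction k arbitrary: p)
  case 0
  show ?case using flat_deriv by (auto intro!: continuous_at_imp_continuous_on DERIV_isCont)
next
  case (Suc k)
  show ?case by (rule Ck_Suc_real[OF flat_deriv Suc])
qed

lemma Ck_affine:
  fixes f :: "real \<Rightarrow> real"
  assumes "\<And>n. Ck n f" shows "Ck k (\<lambda>x. f (a + c * x))"
  using assms
proof (induction k arbitrary: f)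
  case 0
  have "Ck 0 f" by (rule 0)
  then have "continuous_on UNIV f" by simp
  then show ?case by (auto intro!: continuous_on_compose2[of UNIV f] continuous_intros)
next
  case (Suc k)
  have "((\<lambda>x. f (a + c * x)) has_real_derivative partial 1 f (a + c * x) * c) (at x)" for x
    by (rule DERIV_chain2[OF real_deriv_eq_partial[OF Suc.prems]]) (auto intro!: derivative_eq_intros)
  moreover have "Ck k (\<lambda>x. partial 1 f (a + c * x) * c)"
    by (intro Ck_mult Ck_const Suc.IH) (use Suc.prems[of "Suc _"] in auto)
  ultimately show ?case by (rule Ck_Suc_real)
qed

text \<open>The denominator is positive because x and 1 - x are never both nonpositive. The linear
  argument is spelled out as a sum to fit \<open>Ck_affine\<close>.\<close>

definition step :: "real \<Rightarrow> real" where "step x = flat 1 x * inverse (flat 1 x + flat 1 (1 + (-1) * x))"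

lemma step_denom: "flat 1 x + flat 1 (1 + (-1) * x) > 0"
  unfolding flat_def by (auto simp: add_pos_pos)

lemma Ck_step: "Ck k step"
  unfolding step_def[abs_def]
  by (intro Ck_mult Ck_inverse Ck_add Ck_affine Ck_flat) (metis step_denom less_irrefl)

lemma step_0: "x \<le> 0 \<Longrightarrow> step x = 0" unfolding step_def flat_def by simp
lemma step_1: "1 \<le> x \<Longrightarrow> step x = 1" unfolding step_def flat_def by simp

abbreviation "step1 \<equiv> partial 1 step"
abbreviation "step2 \<equiv> partial 1 step1"

lemma Ck_step1: "Ck k step1" using Ck_step[of "Suc k"] by simp
lemma Ck_step2: "Ck k step2" using Ck_step1[of "Suc k"] by simp

text \<open>A one-sided difference quotient is enough, which covers the endpoints 0 and 1 of the
  transition interval of \<open>step\<close>.\<close>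

lemma const_within_imp_deriv_0:
  fixes f :: "real \<Rightarrow> real"
  assumes "(f has_real_derivative D) (at x)" "\<And>y. y \<in> S \<Longrightarrow> f y = f x" "at x within S \<noteq> bot"
  shows "D = 0"
proof -
  have "((\<lambda>y. (f y - f x) / (y - x)) \<longlongrightarrow> D) (at x within S)"
    using assms(1) unfolding has_field_derivative_iff by (rule tendsto_within_subset) simp
  moreover have "((\<lambda>y. (f y - f x) / (y - x)) \<longlongrightarrow> 0) (at x within S)"
    by (rule Lim_transform_eventually[OF tendsto_const]) (auto simp: eventually_at_filter assms(2))
  ultimately show ?thesis using tendsto_unique[OF assms(3)] by blast
qed

lemma step1_0: assumes "x \<le> 0 \<or> 1 \<le> x" shows "step1 x = 0"
  using assms
proof
  assume "x \<le> 0"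
  then show ?thesis
    by (intro const_within_imp_deriv_0[OF real_deriv_eq_partial[OF Ck_step], of "{..<x}"]) (auto simp: step_0)
next
  assume "1 \<le> x"
  then show ?thesis
    by (intro const_within_imp_deriv_0[OF real_deriv_eq_partial[OF Ck_step], of "{x<..}"]) (auto simp: step_1)
qed

lemma step2_0: assumes "x \<le> 0 \<or> 1 \<le> x" shows "step2 x = 0"
  using assms
proof
  assume "x \<le> 0"
  then show ?thesis
    by (intro const_within_imp_deriv_0[OF real_deriv_eq_partial[OF Ck_step1], of "{..<x}"]) (auto simp: step1_0)
next
  assume "1 \<le> x"
  then show ?thesis
    by (intro const_within_imp_deriv_0[OF real_deriv_eq_partial[OF Ck_step1], of "{x<..}"]) (auto simp: step1_0)
qed

lemma step_bounds:
  obtains K where "1 \<le> K" "\<And>x. \<bar>step x\<bar> \<le> K" "\<And>x. \<bar>step1 x\<bar> \<le> K" "\<And>x. \<bar>step2 x\<bar> \<le> K"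
proof -
  have b: "\<exists>K. \<forall>x\<in>{0..1}. \<bar>f x\<bar> \<le> K" if "\<And>n. Ck n f" for f :: "real \<Rightarrow> real"
  proof -
    have "continuous_on UNIV f" using that[of 0] by simp
    then have "compact (f ` {0..1})" by (intro compact_continuous_image) (auto intro: continuous_on_subset)
    then show ?thesis by (metis compact_imp_bounded bounded_iff imageI real_norm_def)
  qed
  obtain A where A: "\<And>x. x \<in> {0..1} \<Longrightarrow> \<bar>step x\<bar> \<le> A" using b[OF Ck_step] by blast
  obtain B where B: "\<And>x. x \<in> {0..1} \<Longrightarrow> \<bar>step1 x\<bar> \<le> B" using b[OF Ck_step1] by blast
  obtain C where C: "\<And>x. x \<in> {0..1} \<Longrightarrow> \<bar>step2 x\<bar> \<le> C" using b[OF Ck_step2] by blast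
  define K where "K = max 1 (max A (max B C))"
  show thesis
  proof (rule that[of K])
    show "1 \<le> K" unfolding K_def by simp
    fix x :: real
    consider "x \<le> 0" | "x \<in> {0..1}" | "1 \<le> x" by fastforce
    then have "\<bar>step x\<bar> \<le> K \<and> \<bar>step1 x\<bar> \<le> K \<and> \<bar>step2 x\<bar> \<le> K"
    proof cases
      case 2 then show ?thesis using A[OF 2] B[OF 2] C[OF 2] unfolding K_def by auto
    qed (auto simp: step_0 step_1 step1_0 step2_0 K_def)
    then show "\<bar>step x\<bar> \<le> K" "\<bar>step1 x\<bar> \<le> K" "\<bar>step2 x\<bar> \<le> K" by auto
  qed
qed

text \<open>
  As \<open>n \<rightarrow> \<infinity>\<close>, \<open>eta s n t\<close> tends to \<open>(s - t)\<^sub>+\<^sup>2 / 2\<close>, with first and second derivatives \<open>eta1\<close>, \<open>eta2\<close>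
  bounded uniformly in \<open>n\<close>. Testing with \<open>eta s n (x \<bullet> x)\<close> amounts to integrating the equation over
  balls twice.
\<close>

definition eta :: "real \<Rightarrow> real \<Rightarrow> real \<Rightarrow> real" where
  "eta s n t = (s - t)\<^sup>2 / 2 * step (n * (s - t))"
definition eta1 :: "real \<Rightarrow> real \<Rightarrow> real \<Rightarrow> real" where
  "eta1 s n t = - (s - t) * (step (n * (s - t)) + n * (s - t) * step1 (n * (s - t)) / 2)"
definition eta2 :: "real \<Rightarrow> real \<Rightarrow> real \<Rightarrow> real" where
  "eta2 s n t = step (n * (s - t)) + 2 * (n * (s - t)) * step1 (n * (s - t)) + (n * (s - t))\<^sup>2 * step2 (n * (s - t)) / 2"

lemma eta_deriv: "(eta s n has_real_derivative eta1 s n t) (at t)" "(eta1 s n has_real_derivative eta2 s n t) (at t)"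
proof -
  have a: "((\<lambda>t. s - t) has_real_derivative - 1) (at t)" "((\<lambda>t. n * (s - t)) has_real_derivative - n) (at t)"
    by (auto intro!: derivative_eq_intros)
  note b = DERIV_chain2[OF real_deriv_eq_partial[OF Ck_step] a(2)] DERIV_chain2[OF real_deriv_eq_partial[OF Ck_step1] a(2)]
  have "((\<lambda>t. (s - t) * (s - t) / 2 * step (n * (s - t))) has_real_derivative
     ((- 1) * (s - t) + (- 1) * (s - t)) / 2 * step (n * (s - t)) + (step1 (n * (s - t)) * - n) * ((s - t) * (s - t) / 2)) (at t)"
    by (intro DERIV_mult DERIV_cdivide a b)
  moreover have "((- 1) * (s - t) + (- 1) * (s - t)) / 2 * A + (B * - n) * ((s - t) * (s - t) / 2)
      = - (s - t) * (A + n * (s - t) * B / 2)" for A B :: real by (simp add: field_simps)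
  ultimately show "(eta s n has_real_derivative eta1 s n t) (at t)"
    unfolding eta_def[abs_def] eta1_def power2_eq_square by metis
  have "((\<lambda>t. (- (s - t)) * (step (n * (s - t)) + n * (s - t) * step1 (n * (s - t)) / 2)) has_real_derivative
     (- (- 1)) * (step (n * (s - t)) + n * (s - t) * step1 (n * (s - t)) / 2)
     + (step1 (n * (s - t)) * - n + ((- n) * step1 (n * (s - t)) + (step2 (n * (s - t)) * - n) * (n * (s - t))) / 2) * (- (s - t))) (at t)"
    by (intro DERIV_mult DERIV_cdivide DERIV_add DERIV_minus a b)
  moreover have "(- (- 1)) * (A + n * (s - t) * B / 2)
     + (B * - n + ((- n) * B + (C * - n) * (n * (s - t))) / 2) * (- (s - t))
     = A + 2 * (n * (s - t)) * B + (n * (s - t) * (n * (s - t))) * C / 2" for A B C :: real by (simp add: field_simps)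
  ultimately show "(eta1 s n has_real_derivative eta2 s n t) (at t)"
    unfolding eta1_def[abs_def] eta2_def power2_eq_square by metis
qed

lemma Ck_eta: "Ck k (eta s n)"
proof -
  have "eta s n = (\<lambda>t. (s + (-1) * t) * (s + (-1) * t) * (1 / 2) * step (n * s + (- n) * t))"
  proof
    fix t
    have "(s - t)\<^sup>2 / 2 * A = (s + (-1) * t) * (s + (-1) * t) * (1 / 2) * A" for A
      by (simp add: power2_eq_square field_simps)
    moreover have "n * (s - t) = n * s + (- n) * t" by (simp add: algebra_simps)
    ultimately show "eta s n t = (s + (-1) * t) * (s + (-1) * t) * (1 / 2) * step (n * s + (- n) * t)"
      unfolding eta_def by metis
  qed
  moreover have "Ck m (\<lambda>t::real. t)" for m using Ck_inner[of m "1::real"] by simp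
  ultimately show ?thesis by (simp only:) (intro Ck_mult Ck_const Ck_affine Ck_step Ck_add)
qed

lemma partial_eta: "partial 1 (eta s n) = eta1 s n" "partial 1 (eta1 s n) = eta2 s n"
  by (rule ext, rule partial_real_eq, rule eta_deriv)+

lemma eta_zero: assumes "s \<le> t" "0 \<le> n" shows "eta s n t = 0" "eta1 s n t = 0" "eta2 s n t = 0"
proof -
  have "n * (s - t) \<le> 0" using assms by (simp add: mult_nonneg_nonpos)
  then show "eta s n t = 0" "eta1 s n t = 0" "eta2 s n t = 0"
    unfolding eta_def eta1_def eta2_def by (simp_all add: step_0 step1_0 step2_0)
qed

lemma test_function_eta:
  assumes "0 \<le> n" shows "test_function (\<lambda>x::'a::euclidean_space. eta s n (x \<bullet> x))"
proof -
  have "bounded {x::'a. eta s n (x \<bullet> x) \<noteq> 0}"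
  proof (rule bounded_subset[OF bounded_cball[of 0 "sqrt s"]])
    show "{x::'a. eta s n (x \<bullet> x) \<noteq> 0} \<subseteq> cball 0 (sqrt s)"
    proof
      fix x :: 'a assume "x \<in> {x. eta s n (x \<bullet> x) \<noteq> 0}"
      then have "x \<bullet> x \<le> s" using eta_zero(1)[OF _ assms, of s "x \<bullet> x"] by fastforce
      then show "x \<in> cball 0 (sqrt s)" by (simp add: norm_eq_sqrt_inner)
    qed
  qed
  then show ?thesis unfolding test_function_def using Ck_comp_inner_self(1)[OF Ck_eta] by (auto simp: compact_closure)
qed

lemma laplacian_eta:
  "laplacian (\<lambda>x::'a::euclidean_space. eta s n (x \<bullet> x)) x
    = 4 * (x \<bullet> x) * eta2 s n (x \<bullet> x) + 2 * real DIM('a) * eta1 s n (x \<bullet> x)"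
  using laplacian_radial[OF Ck_eta, of s n x] unfolding partial_eta .

lemma eta_lim:
  "(\<lambda>n. eta s (real n) t) \<longlonglongrightarrow> (max 0 (s - t))\<^sup>2 / 2"
  "(\<lambda>n. eta1 s (real n) t) \<longlonglongrightarrow> - max 0 (s - t)"
  "(\<lambda>n. eta2 s (real n) t) \<longlonglongrightarrow> (if t < s then 1 else 0)"
proof -
  have "(\<lambda>n. eta s (real n) t) \<longlonglongrightarrow> (max 0 (s - t))\<^sup>2 / 2 \<and>
    (\<lambda>n. eta1 s (real n) t) \<longlonglongrightarrow> - max 0 (s - t) \<and> (\<lambda>n. eta2 s (real n) t) \<longlonglongrightarrow> (if t < s then 1 else 0)"
  proof (cases "t < s")
    case False
    then show ?thesis using eta_zero[of s t] by (auto simp: max_def)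
  next
    case True
    have "filterlim (\<lambda>n. real n * (s - t)) at_top sequentially"
      using filterlim_tendsto_pos_mult_at_top[OF tendsto_const[of "s - t"] _ filterlim_real_sequentially] True
      by (simp add: mult.commute)
    then have ev: "\<forall>\<^sub>F n in sequentially. 1 \<le> real n * (s - t)" by (simp add: filterlim_at_top)
    have e: "\<forall>\<^sub>F n in sequentially. (max 0 (s - t))\<^sup>2 / 2 = eta s (real n) t"
      "\<forall>\<^sub>F n in sequentially. - max 0 (s - t) = eta1 s (real n) t"
      "\<forall>\<^sub>F n in sequentially. (if t < s then 1 else 0) = eta2 s (real n) t"
      using ev by (eventually_elim, use True in \<open>simp add: eta_def eta1_def eta2_def step_1 step1_0 step2_0 max_def\<close>)+
    show ?thesis
      by (intro conjI Lim_transform_eventually[OF tendsto_const e(1)] Lim_transform_eventually[OF tendsto_const e(2)]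
          Lim_transform_eventually[OF tendsto_const e(3)])
  qed
  then show "(\<lambda>n. eta s (real n) t) \<longlonglongrightarrow> (max 0 (s - t))\<^sup>2 / 2"
    "(\<lambda>n. eta1 s (real n) t) \<longlonglongrightarrow> - max 0 (s - t)" "(\<lambda>n. eta2 s (real n) t) \<longlonglongrightarrow> (if t < s then 1 else 0)" by auto
qed

text \<open>The powers of n occur only through y = n (s - t) in y step'(y) and y^2 step''(y), and
  these are bounded because the derivatives of \<open>step\<close> vanish outside [0, 1]. Uniformity
  in n is what dominated convergence requires.\<close>

lemma eta_bounds:
  obtains K where "0 \<le> K" "\<And>s n t. 0 \<le> n \<Longrightarrow> 0 \<le> t \<Longrightarrow> 0 \<le> s \<Longrightarrow> \<bar>eta s n t\<bar> \<le> K * s\<^sup>2"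
    "\<And>s n t. 0 \<le> n \<Longrightarrow> 0 \<le> t \<Longrightarrow> 0 \<le> s \<Longrightarrow> \<bar>eta1 s n t\<bar> \<le> K * s"
    "\<And>s n t. 0 \<le> n \<Longrightarrow> 0 \<le> t \<Longrightarrow> 0 \<le> s \<Longrightarrow> \<bar>eta2 s n t\<bar> \<le> K"
proof -
  obtain K where K: "1 \<le> K" "\<And>x. \<bar>step x\<bar> \<le> K" "\<And>x. \<bar>step1 x\<bar> \<le> K" "\<And>x. \<bar>step2 x\<bar> \<le> K" by (rule step_bounds) blast
  have y1: "\<bar>y * step1 y\<bar> \<le> K" for y
  proof (cases "0 \<le> y \<and> y \<le> 1")
    case True
    then have "\<bar>y\<bar> * \<bar>step1 y\<bar> \<le> 1 * K" using K by (intro mult_mono) auto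
    then show ?thesis by (simp add: abs_mult)
  next
    case False then show ?thesis using step1_0[of y] K(1) by auto
  qed
  have y2: "\<bar>y\<^sup>2 * step2 y\<bar> \<le> K" for y
  proof (cases "0 \<le> y \<and> y \<le> 1")
    case True
    then have "\<bar>y\<^sup>2\<bar> * \<bar>step2 y\<bar> \<le> 1 * K" using K by (intro mult_mono) (auto simp: power_le_one)
    then show ?thesis by (simp add: abs_mult)
  next
    case False then show ?thesis using step2_0[of y] K(1) by auto
  qed
  show thesis
  \<comment> \<open>The three terms of \<open>eta2\<close> are bounded by K, 2 K and K / 2.\<close>
  proof (rule that[of "4 * K"])
    show "0 \<le> 4 * K" using K(1) by simp
    fix s n t :: real assume a: "0 \<le> n" "0 \<le> t" "0 \<le> s"
    show "\<bar>eta2 s n t\<bar> \<le> 4 * K"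
      unfolding eta2_def using K(2)[of "n * (s - t)"] y1[of "n * (s - t)"] y2[of "n * (s - t)"] by (simp add: mult.assoc)
    show "\<bar>eta1 s n t\<bar> \<le> 4 * K * s"
    proof (cases "s \<le> t")
      case True then show ?thesis using eta_zero[OF True a(1)] a K(1) by simp
    next
      case False
      have "\<bar>step (n * (s - t)) + n * (s - t) * step1 (n * (s - t)) / 2\<bar> \<le> 4 * K"
        using K(1) K(2)[of "n * (s - t)"] y1[of "n * (s - t)"] by linarith
      then have "\<bar>- (s - t)\<bar> * \<bar>step (n * (s - t)) + n * (s - t) * step1 (n * (s - t)) / 2\<bar> \<le> s * (4 * K)"
        using False a by (intro mult_mono) auto
      then show ?thesis unfolding eta1_def abs_mult by (simp add: mult_ac)
    qed
    show "\<bar>eta s n t\<bar> \<le> 4 * K * s\<^sup>2"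
    proof (cases "s \<le> t")
      case True then show ?thesis using eta_zero[OF True a(1)] K(1) by simp
    next
      case False
      have "\<bar>(s - t)\<^sup>2 / 2\<bar> * \<bar>step (n * (s - t))\<bar> \<le> s\<^sup>2 * (4 * K)"
      proof (rule mult_mono)
        have "(s - t)\<^sup>2 \<le> s\<^sup>2" using False a by (intro power_mono) auto
        then show "\<bar>(s - t)\<^sup>2 / 2\<bar> \<le> s\<^sup>2" using zero_le_power2[of s] by (simp, linarith)
        show "\<bar>step (n * (s - t))\<bar> \<le> 4 * K" using K(1) K(2)[of "n * (s - t)"] by linarith
      qed auto
      then show ?thesis unfolding eta_def abs_mult by (simp add: mult_ac)
    qed
  qed
qed

section \<open>Radial moments of weak solutions\<close>

text \<open>Balls are indexed by the squared radius, matching test functions of x \<bullet> x; for s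
  <= 0 the set is empty, so all moments vanish there.\<close>

definition qball :: "real \<Rightarrow> 'a::euclidean_space set" where "qball s = {x. x \<bullet> x < s}"

lemma qball_eq: "qball s = (if 0 < s then ball 0 (sqrt s) else {})"
proof -
  have "x \<bullet> x < s \<longleftrightarrow> norm x < sqrt s" for x :: 'a by (simp add: norm_eq_sqrt_inner)
  moreover have "\<not> x \<bullet> x < s" if "s \<le> 0" for x :: 'a using that inner_ge_zero[of x] by linarith
  ultimately show ?thesis unfolding qball_def by (auto simp: not_less)
qed

lemma open_qball: "open (qball s)" unfolding qball_eq by simp
lemma qball_sets [measurable]:
  "(qball s :: 'a::euclidean_space set) \<in> sets lebesgue" "(qball s :: 'b::euclidean_space set) \<in> sets borel"
proof -
  have "open (qball s :: 'a::euclidean_space set)" "open (qball s :: 'b::euclidean_space set)" by (rule open_qball)+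
  then show "qball s \<in> sets (lebesgue :: 'a measure)" "qball s \<in> sets (borel :: 'b measure)"
    by (auto intro!: sets_completionI_sets)
qed

lemma borel_imp_lebesgue_measurable:
  "f \<in> borel_measurable borel \<Longrightarrow> f \<in> borel_measurable (lebesgue :: 'a::euclidean_space measure)"
  by (rule measurable_completion) simp

definition loc_int :: "('a::euclidean_space \<Rightarrow> real) \<Rightarrow> bool" where
  "loc_int f \<longleftrightarrow> f \<in> borel_measurable lebesgue \<and> (\<forall>s. integrable lebesgue (\<lambda>x. indicator (qball s) x * f x))"

definition ball_int :: "('a::euclidean_space \<Rightarrow> real) \<Rightarrow> real \<Rightarrow> real" where
  "ball_int f s = (LINT x|lebesgue. indicator (qball s) x * f x)"

lemma loc_int_meas: "loc_int f \<Longrightarrow> f \<in> borel_measurable lebesgue" and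
  loc_int_integrable: "loc_int f \<Longrightarrow> integrable lebesgue (\<lambda>x. indicator (qball s) x * f x)"
  unfolding loc_int_def by auto

lemma loc_int_bounded_mult:
  assumes "loc_int f" "c \<in> borel_measurable lebesgue" "\<And>x. x \<in> qball s \<Longrightarrow> \<bar>c x\<bar> \<le> K"
  shows "integrable lebesgue (\<lambda>x. indicator (qball s) x * (c x * f x))"
proof (rule Bochner_Integration.integrable_bound[OF integrable_mult_right[OF loc_int_integrable[OF assms(1), of s], of K]])
  note [measurable] = loc_int_meas[OF assms(1)] assms(2)
  show "(\<lambda>x. indicator (qball s) x * (c x * f x)) \<in> borel_measurable lebesgue" by measurable
  show "AE x in lebesgue. norm (indicator (qball s) x * (c x * f x)) \<le> norm (K * (indicator (qball s) x * f x))"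
  proof (rule AE_I2)
    fix x
    show "norm (indicator (qball s) x * (c x * f x)) \<le> norm (K * (indicator (qball s) x * f x))"
    proof (cases "x \<in> qball s")
      case True
      have "\<bar>c x\<bar> * \<bar>f x\<bar> \<le> \<bar>K\<bar> * \<bar>f x\<bar>" using assms(3)[OF True] by (intro mult_right_mono) auto
      then show ?thesis using True by (simp add: abs_mult)
    qed simp
  qed
qed

lemma loc_int_abs: assumes "loc_int f" shows "loc_int (\<lambda>x. \<bar>f x\<bar>)"
  unfolding loc_int_def
proof (intro conjI allI)
  note [measurable] = loc_int_meas[OF assms]
  show "(\<lambda>x. \<bar>f x\<bar>) \<in> borel_measurable lebesgue" by measurable
  fix s
  have "integrable lebesgue (\<lambda>x. \<bar>indicator (qball s) x * f x\<bar>)" using loc_int_integrable[OF assms] by simp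
  then show "integrable lebesgue (\<lambda>x. indicator (qball s) x * \<bar>f x\<bar>)" by (simp add: abs_mult)
qed

lemma loc_int_mult: assumes "loc_int f" "c \<in> borel_measurable lebesgue" "\<And>x. \<bar>c x\<bar> \<le> K" shows "loc_int (\<lambda>x. c x * f x)"
  unfolding loc_int_def
proof (intro conjI allI)
  note [measurable] = loc_int_meas[OF assms(1)] assms(2)
  show "(\<lambda>x. c x * f x) \<in> borel_measurable lebesgue" by measurable
  show "integrable lebesgue (\<lambda>x. indicator (qball s) x * (c x * f x))" for s
    by (rule loc_int_bounded_mult[OF assms(1,2)]) (rule assms(3))
qed

lemma sphere_null: "AE x::'a::euclidean_space in lebesgue. x \<bullet> x \<noteq> s"
proof -
  have "{x::'a. x \<bullet> x = s} \<subseteq> sphere 0 (sqrt s)" by (auto simp: norm_eq_sqrt_inner)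
  then have "negligible {x::'a. x \<bullet> x = s}" using negligible_sphere negligible_subset by blast
  then have "{x::'a. x \<bullet> x = s} \<in> null_sets lebesgue" by (simp add: negligible_iff_null_sets)
  then show ?thesis by (rule AE_I') auto
qed

lemma ball_int_cont: assumes "loc_int f" shows "isCont (ball_int f) s"
  unfolding continuous_at_sequentially
proof (intro allI impI)
  fix X :: "nat \<Rightarrow> real" assume X: "X \<longlonglongrightarrow> s"
  note [measurable] = loc_int_meas[OF assms]
  obtain K where K: "\<And>n. X n \<le> K"
    using convergent_imp_Bseq[OF convergentI[OF X]] unfolding Bseq_def by (metis abs_le_D1 real_norm_def)
  have "(\<lambda>n. LINT x|lebesgue. indicator (qball (X n)) x * f x) \<longlonglongrightarrow> (LINT x|lebesgue. indicator (qball s) x * f x)"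
  proof (rule integral_dominated_convergence[where w = "\<lambda>x. \<bar>indicator (qball K) x * f x\<bar>"])
    show "integrable lebesgue (\<lambda>x. \<bar>indicator (qball K) x * f x\<bar>)" using loc_int_integrable[OF assms] by simp
    show "AE x in lebesgue. (\<lambda>n. indicator (qball (X n)) x * f x) \<longlonglongrightarrow> indicator (qball s) x * f x"
      using sphere_null[of s]
    proof eventually_elim
      case (elim x)
      have "\<forall>\<^sub>F n in sequentially. indicator (qball (X n)) x * f x = indicator (qball s) x * f x"
      proof (cases "x \<bullet> x < s")
        case True
        then have "\<forall>\<^sub>F n in sequentially. x \<bullet> x < X n" by (rule order_tendstoD(1)[OF X])
        then show ?thesis by eventually_elim (use True in \<open>simp add: qball_def indicator_def\<close>)
      next
        case False
        then have "s < x \<bullet> x" using elim by simp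
        then have "\<forall>\<^sub>F n in sequentially. X n < x \<bullet> x" by (rule order_tendstoD(2)[OF X])
        then show ?thesis by eventually_elim (use False in \<open>simp add: qball_def indicator_def\<close>)
      qed
      then show ?case by (rule tendsto_eventually)
    qed
    show "AE x in lebesgue. norm (indicator (qball (X n)) x * f x) \<le> \<bar>indicator (qball K) x * f x\<bar>" for n
      using K[of n] by (intro AE_I2) (auto simp: qball_def indicator_def)
  qed measurable
  then show "(ball_int f \<circ> X) \<longlonglongrightarrow> ball_int f s" unfolding ball_int_def o_def .
qed

lemma ball_int_0: "s \<le> 0 \<Longrightarrow> ball_int f s = 0" unfolding ball_int_def qball_eq by simp

lemma ball_int_diff:
  assumes "loc_int f" "s \<le> t"
  shows "ball_int f t - ball_int f s = (LINT x|lebesgue. indicator (qball t - qball s) x * f x)"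
    and "integrable lebesgue (\<lambda>x. indicator (qball t - qball s) x * f x)"
proof -
  have "qball s \<subseteq> (qball t :: 'a set)" using assms(2) unfolding qball_def by auto
  then have e: "indicator (qball t - qball s) x * f x = indicator (qball t) x * f x - indicator (qball s) x * f x" for x
    by (auto simp: indicator_def)
  show "integrable lebesgue (\<lambda>x. indicator (qball t - qball s) x * f x)"
    unfolding e by (intro Bochner_Integration.integrable_diff loc_int_integrable assms)
  show "ball_int f t - ball_int f s = (LINT x|lebesgue. indicator (qball t - qball s) x * f x)"
    unfolding e ball_int_def by (rule Bochner_Integration.integral_diff[symmetric]) (intro loc_int_integrable assms)+
qed

lemma ball_int_abs_mono:
  assumes "loc_int f" "s \<le> t" shows "ball_int (\<lambda>x. \<bar>f x\<bar>) s \<le> ball_int (\<lambda>x. \<bar>f x\<bar>) t"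
proof -
  have "0 \<le> (LINT x|lebesgue. indicator (qball t - qball s) x * \<bar>f x\<bar>)"
    by (rule Bochner_Integration.integral_nonneg) simp
  then show ?thesis using ball_int_diff(1)[OF loc_int_abs[OF assms(1)] assms(2)] by linarith
qed

section \<open>Moments as functions of the squared radius\<close>

definition pos_dist :: "real \<Rightarrow> 'a::euclidean_space \<Rightarrow> real" where "pos_dist s x = max 0 (s - x \<bullet> x)"

lemma pos_dist_meas [measurable]: "pos_dist s \<in> borel_measurable lebesgue"
proof -
  have "continuous_on UNIV (pos_dist s :: 'a \<Rightarrow> real)" unfolding pos_dist_def[abs_def] by (intro continuous_intros)
  then have "(pos_dist s :: 'a \<Rightarrow> real) \<in> borel_measurable borel" by (rule borel_measurable_continuous_onI)
  then show ?thesis by (rule borel_imp_lebesgue_measurable)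
qed

lemma pos_dist_indicator: "pos_dist s x = indicator (qball s) x * pos_dist s x"
  unfolding pos_dist_def qball_def by (auto simp: indicator_def)

lemma pos_dist_bound: "x \<in> qball s \<Longrightarrow> \<bar>pos_dist s x\<bar> \<le> s" "0 \<le> pos_dist s x"
  unfolding pos_dist_def qball_def by auto

lemma pos_dist_integrable:
  assumes "loc_int f" shows "integrable lebesgue (\<lambda>x. (pos_dist s x) ^ Suc n * f x)"
proof -
  have "integrable lebesgue (\<lambda>x. indicator (qball s) x * ((pos_dist s x) ^ Suc n * f x))"
  proof (rule loc_int_bounded_mult[OF assms, where K = "s ^ Suc n"])
    fix x :: 'a assume "x \<in> qball s"
    then show "\<bar>(pos_dist s x) ^ Suc n\<bar> \<le> s ^ Suc n" unfolding power_abs by (intro power_mono pos_dist_bound) auto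
  qed measurable
  moreover have "indicator (qball s) x * ((pos_dist s x) ^ Suc n * f x) = (pos_dist s x) ^ Suc n * f x" for x
    using pos_dist_indicator[of s x] by (cases "x \<in> qball s") auto
  ultimately show ?thesis by (simp only:)
qed

text \<open>For n = 1 and n = 2 this is n! times the n-fold antiderivative of
  \<open>ball_int f\<close> that vanishes for s <= 0. The weight makes it differentiable for every
  locally integrable f.\<close>

definition dist_int :: "nat \<Rightarrow> ('a::euclidean_space \<Rightarrow> real) \<Rightarrow> real \<Rightarrow> real" where
  "dist_int n f s = (LINT x|lebesgue. (pos_dist s x) ^ n * f x)"

lemma dist_int_0: "s \<le> 0 \<Longrightarrow> dist_int (Suc n) f s = 0"
proof -
  assume "s \<le> 0"
  then have "s - x \<bullet> x \<le> 0" for x :: 'a using inner_ge_zero[of x] by linarith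
  then have "pos_dist s x = 0" for x :: 'a unfolding pos_dist_def by simp
  then show ?thesis unfolding dist_int_def by simp
qed

text \<open>The error of the difference quotient lives on the shell between s and s + h and is
  bounded by the mass of |f| on it, which tends to 0 since spheres are null sets.\<close>

lemma dist_int1_deriv:
  fixes f :: "'a::euclidean_space \<Rightarrow> real"
  assumes "loc_int f" shows "(dist_int 1 f has_real_derivative ball_int f s) (at s)"
proof -
  let ?T = "ball_int (\<lambda>x. \<bar>f x\<bar>)"
  have b: "\<bar>(dist_int 1 f (s + h) - dist_int 1 f s) / h - ball_int f s\<bar> \<le> \<bar>?T (s + h) - ?T s\<bar>" if "h \<noteq> 0" for h
  proof -
    define lo hi where "lo = min s (s + h)" and "hi = max s (s + h)"
    have lh: "lo \<le> hi" unfolding lo_def hi_def by simp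
    have i: "integrable lebesgue (\<lambda>x. pos_dist s x * f x)" for s using pos_dist_integrable[OF assms, of s 0] by simp
    have "dist_int 1 f (s + h) - dist_int 1 f s - h * ball_int f s
      = (LINT x|lebesgue. pos_dist (s + h) x * f x - pos_dist s x * f x - h * (indicator (qball s) x * f x))"
      unfolding dist_int_def ball_int_def using i loc_int_integrable[OF assms, of s] by simp
    also have "\<bar>\<dots>\<bar> \<le> (LINT x|lebesgue. \<bar>h\<bar> * (indicator (qball hi - qball lo) x * \<bar>f x\<bar>))"
    proof (rule integral_abs_bound_integral)
      show "integrable lebesgue (\<lambda>x. pos_dist (s + h) x * f x - pos_dist s x * f x - h * (indicator (qball s) x * f x))"
        using i loc_int_integrable[OF assms, of s] by (intro Bochner_Integration.integrable_diff integrable_mult_right) auto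
      show "integrable lebesgue (\<lambda>x. \<bar>h\<bar> * (indicator (qball hi - qball lo) x * \<bar>f x\<bar>))"
        by (intro integrable_mult_right ball_int_diff(2)[OF loc_int_abs[OF assms] lh])
      fix x :: 'a
      have "\<bar>pos_dist (s + h) x - pos_dist s x - h * indicator (qball s) x\<bar> \<le> \<bar>h\<bar> * indicator (qball hi - qball lo) x"
        unfolding pos_dist_def qball_def lo_def hi_def by (auto simp: indicator_def max_def min_def)
      from mult_right_mono[OF this, of "\<bar>f x\<bar>"]
      show "\<bar>pos_dist (s + h) x * f x - pos_dist s x * f x - h * (indicator (qball s) x * f x)\<bar>
        \<le> \<bar>h\<bar> * (indicator (qball hi - qball lo) x * \<bar>f x\<bar>)"
        by (simp add: abs_mult[symmetric] algebra_simps)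
    qed
    also have "\<dots> = \<bar>h\<bar> * (?T hi - ?T lo)" using ball_int_diff(1)[OF loc_int_abs[OF assms] lh] by simp
    also have "?T hi - ?T lo = \<bar>?T (s + h) - ?T s\<bar>"
      using ball_int_abs_mono[OF assms, of s "s + h"] ball_int_abs_mono[OF assms, of "s + h" s] unfolding lo_def hi_def
      by (auto simp: max_def min_def)
    finally have "\<bar>dist_int 1 f (s + h) - dist_int 1 f s - h * ball_int f s\<bar> / \<bar>h\<bar> \<le> \<bar>?T (s + h) - ?T s\<bar>"
      using that by (simp add: divide_le_eq mult.commute)
    moreover have "(dist_int 1 f (s + h) - dist_int 1 f s) / h - ball_int f s = (dist_int 1 f (s + h) - dist_int 1 f s - h * ball_int f s) / h"
      using that by (simp add: field_simps)
    ultimately show ?thesis by (simp add: abs_divide)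
  qed
  have "((\<lambda>h. \<bar>?T (s + h) - ?T s\<bar>) \<longlongrightarrow> 0) (at 0)"
    using ball_int_cont[OF loc_int_abs[OF assms], of s] unfolding isCont_iff
    by (intro tendsto_rabs_zero LIM_zero)
  then have "((\<lambda>h. (dist_int 1 f (s + h) - dist_int 1 f s) / h - ball_int f s) \<longlongrightarrow> 0) (at 0)"
    by (rule Lim_null_comparison[rotated]) (use b in \<open>auto simp: eventually_at_filter\<close>)
  then show ?thesis unfolding DERIV_def by (rule LIM_zero_cancel)
qed

text \<open>Pointwise, the square of the positive part of a has derivative twice the positive part
  of a, with an error of at most h^2; for |h| < 1 this error is confined to
  \<open>qball (s + 1)\<close>.\<close>

lemma dist_int2_deriv:
  fixes f :: "'a::euclidean_space \<Rightarrow> real"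
  assumes "loc_int f" shows "(dist_int 2 f has_real_derivative 2 * dist_int 1 f s) (at s)"
proof -
  let ?K = "ball_int (\<lambda>x. \<bar>f x\<bar>) (s + 1)"
  have b: "\<bar>(dist_int 2 f (s + h) - dist_int 2 f s) / h - 2 * dist_int 1 f s\<bar> \<le> \<bar>h\<bar> * ?K" if h: "h \<noteq> 0" "\<bar>h\<bar> < 1" for h
  proof -
    have i1: "integrable lebesgue (\<lambda>x. pos_dist s x * f x)" for s using pos_dist_integrable[OF assms, of s 0] by simp
    have i2: "integrable lebesgue (\<lambda>x. (pos_dist s x)\<^sup>2 * f x)" for s
      using pos_dist_integrable[OF assms, of s 1] by (simp add: numeral_2_eq_2)
    have "dist_int 2 f (s + h) - dist_int 2 f s - 2 * h * dist_int 1 f s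
      = (LINT x|lebesgue. (pos_dist (s + h) x)\<^sup>2 * f x - (pos_dist s x)\<^sup>2 * f x - 2 * h * (pos_dist s x * f x))"
      unfolding dist_int_def using i1 i2 by simp
    also have "\<bar>\<dots>\<bar> \<le> (LINT x|lebesgue. h\<^sup>2 * (indicator (qball (s + 1)) x * \<bar>f x\<bar>))"
    proof (rule integral_abs_bound_integral)
      show "integrable lebesgue (\<lambda>x. (pos_dist (s + h) x)\<^sup>2 * f x - (pos_dist s x)\<^sup>2 * f x - 2 * h * (pos_dist s x * f x))"
        by (intro Bochner_Integration.integrable_diff integrable_mult_right i1 i2)
      show "integrable lebesgue (\<lambda>x. h\<^sup>2 * (indicator (qball (s + 1)) x * \<bar>f x\<bar>))"
        by (intro integrable_mult_right loc_int_integrable[OF loc_int_abs[OF assms]])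
      fix x :: 'a
      have "\<bar>(pos_dist (s + h) x)\<^sup>2 - (pos_dist s x)\<^sup>2 - 2 * h * pos_dist s x\<bar> \<le> h\<^sup>2 * indicator (qball (s + 1)) x"
      proof -
        define a where "a = s - x \<bullet> x"
        have *: "\<bar>(max 0 (a + h))\<^sup>2 - (max 0 a)\<^sup>2 - 2 * h * max 0 a\<bar> \<le> h\<^sup>2"
        proof (cases "0 \<le> a"; cases "0 \<le> a + h")
          assume "0 \<le> a" "0 \<le> a + h"
          then show ?thesis by (simp add: max_def power2_eq_square algebra_simps)
        next
          assume c: "0 \<le> a" "\<not> 0 \<le> a + h"
          have "0 \<le> a * (- a - 2 * h)" using c by (intro mult_nonneg_nonneg) auto
          moreover have "a * (- a - 2 * h) = h\<^sup>2 - (a + h)\<^sup>2" by (simp add: power2_eq_square algebra_simps)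
          moreover have "0 \<le> (a + h)\<^sup>2" by simp
          moreover have "(max 0 (a + h))\<^sup>2 - (max 0 a)\<^sup>2 - 2 * h * max 0 a = a * (- a - 2 * h)"
            using c by (simp add: max_def power2_eq_square algebra_simps)
          ultimately show ?thesis by simp
        next
          assume c: "\<not> 0 \<le> a" "0 \<le> a + h"
          then have "(a + h)\<^sup>2 \<le> h\<^sup>2" by (intro power_mono) auto
          then show ?thesis using c by (simp add: max_def)
        next
          assume "\<not> 0 \<le> a" "\<not> 0 \<le> a + h"
          then show ?thesis by (simp add: max_def)
        qed
        have sh: "s + h - x \<bullet> x = a + h" unfolding a_def by simp
        show ?thesis
        proof (cases "x \<bullet> x < s + 1")
          case True then show ?thesis using * unfolding pos_dist_def sh a_def[symmetric] by (simp add: qball_def)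
        next
          case False
          then have "a \<le> 0" "a + h \<le> 0" using h unfolding a_def by auto
          then have m: "max 0 a = 0" "max 0 (a + h) = 0" by auto
          show ?thesis unfolding pos_dist_def sh a_def[symmetric] m by simp
        qed
      qed
      from mult_right_mono[OF this, of "\<bar>f x\<bar>"]
      show "\<bar>(pos_dist (s + h) x)\<^sup>2 * f x - (pos_dist s x)\<^sup>2 * f x - 2 * h * (pos_dist s x * f x)\<bar>
        \<le> h\<^sup>2 * (indicator (qball (s + 1)) x * \<bar>f x\<bar>)"
        by (simp add: abs_mult[symmetric] algebra_simps)
    qed
    also have "\<dots> = h\<^sup>2 * ?K" unfolding ball_int_def by simp
    finally have "\<bar>dist_int 2 f (s + h) - dist_int 2 f s - 2 * h * dist_int 1 f s\<bar> / \<bar>h\<bar> \<le> h\<^sup>2 * ?K / \<bar>h\<bar>"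
      by (intro divide_right_mono) auto
    moreover have "h\<^sup>2 * ?K / \<bar>h\<bar> = \<bar>h\<bar> * ?K"
    proof -
      have "a * a * ?K / a = a * ?K" if "a \<noteq> 0" for a using that by simp
      from this[of "\<bar>h\<bar>"] show ?thesis using h(1) unfolding abs_mult_self_eq by (simp add: power2_eq_square)
    qed
    moreover have "(dist_int 2 f (s + h) - dist_int 2 f s) / h - 2 * dist_int 1 f s = (dist_int 2 f (s + h) - dist_int 2 f s - 2 * h * dist_int 1 f s) / h"
      using h(1) by (simp add: field_simps)
    ultimately show ?thesis by (simp add: abs_divide)
  qed
  have "((\<lambda>h. \<bar>h\<bar> * ?K) \<longlongrightarrow> 0) (at 0)" by (auto intro!: tendsto_eq_intros)
  moreover have "\<forall>\<^sub>F h in at 0. norm ((dist_int 2 f (s + h) - dist_int 2 f s) / h - 2 * dist_int 1 f s) \<le> \<bar>h\<bar> * ?K"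
    unfolding eventually_at using b by (intro exI[of _ 1]) (auto simp: dist_real_def)
  ultimately have "((\<lambda>h. (dist_int 2 f (s + h) - dist_int 2 f s) / h - 2 * dist_int 1 f s) \<longlongrightarrow> 0) (at 0)"
    by (rule Lim_null_comparison[rotated])
  then show ?thesis unfolding DERIV_def by (rule LIM_zero_cancel)
qed

text \<open>From |\<phi>| <= 1 + \<phi>^2. The explicit bound grows like the volume of the ball and
  later yields temperedness.\<close>

lemma L2_loc_int:
  fixes \<phi> :: "'a::euclidean_space \<Rightarrow> real"
  assumes "\<phi> \<in> L2"
  shows "loc_int \<phi>" "\<bar>ball_int (\<lambda>x. \<bar>\<phi> x\<bar>) s\<bar> \<le> measure lebesgue (qball s :: 'a set) + (LINT x|lebesgue. (\<phi> x)\<^sup>2)"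
proof -
  have m [measurable]: "\<phi> \<in> borel_measurable lebesgue" and i: "integrable lebesgue (\<lambda>x. (\<phi> x)\<^sup>2)" using assms unfolding L2_def by auto
  have fm: "emeasure lebesgue (qball s :: 'a set) < \<infinity>" for s
  proof -
    have "bounded (qball s :: 'a set)" unfolding qball_eq by simp
    then have "(qball s :: 'a set) \<in> lmeasurable" using open_qball lmeasurable_open by blast
    then show ?thesis by (simp add: fmeasurable_def)
  qed
  have ii: "integrable lebesgue (indicator (qball s) :: 'a \<Rightarrow> real)" for s using fm[of s] by simp
  have le: "\<bar>indicator (qball s) x * \<phi> x\<bar> \<le> indicator (qball s) x + (\<phi> x)\<^sup>2" for x s
  proof -
    have "2 * \<bar>\<phi> x\<bar> \<le> 1 + (\<phi> x)\<^sup>2" using sum_squares_bound[of 1 "\<bar>\<phi> x\<bar>"] by simp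
    then show ?thesis by (auto simp: indicator_def)
  qed
  have ib: "integrable lebesgue (\<lambda>x. indicator (qball s) x + (\<phi> x)\<^sup>2)" for s by (intro Bochner_Integration.integrable_add ii i)
  have "integrable lebesgue (\<lambda>x. indicator (qball s) x * \<phi> x)" for s
    by (rule Bochner_Integration.integrable_bound[OF ib[of s]]) (measurable, rule AE_I2, use le in force)
  then show li: "loc_int \<phi>" unfolding loc_int_def by simp
  have "\<bar>ball_int (\<lambda>x. \<bar>\<phi> x\<bar>) s\<bar> \<le> (LINT x|lebesgue. indicator (qball s) x + (\<phi> x)\<^sup>2)"
    unfolding ball_int_def
    by (rule integral_abs_bound_integral[OF loc_int_integrable[OF loc_int_abs[OF li]] ib]) (use le in \<open>simp add: abs_mult\<close>)
  also have "\<dots> = measure lebesgue (qball s :: 'a set) + (LINT x|lebesgue. (\<phi> x)\<^sup>2)"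
    using ii i by simp
  finally show "\<bar>ball_int (\<lambda>x. \<bar>\<phi> x\<bar>) s\<bar> \<le> measure lebesgue (qball s :: 'a set) + (LINT x|lebesgue. (\<phi> x)\<^sup>2)" .
qed

text \<open>The equation is tested with \<open>eta s n\<close> of x \<bullet> x and n tends to
  infinity by dominated convergence. The summand \<open>0 * \<phi> x\<close> keeps the form of the
  eigenvalue equation for the eigenvalue 0.\<close>

lemma weak_radial_identity:
  fixes \<phi> V :: "'a::euclidean_space \<Rightarrow> real"
  assumes \<phi>: "loc_int \<phi>" and V: "loc_int (\<lambda>x. V x * \<phi> x)" and weak: "weak_laplacian \<phi> (\<lambda>x. 0 * \<phi> x - V x * \<phi> x)" and s: "0 \<le> s"
  shows "4 * s * ball_int \<phi> s - (4 + 2 * real DIM('a)) * dist_int 1 \<phi> s = - dist_int 2 (\<lambda>x. V x * \<phi> x) s / 2"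
proof -
  obtain K where K: "0 \<le> K" "\<And>s n t. 0 \<le> n \<Longrightarrow> 0 \<le> t \<Longrightarrow> 0 \<le> s \<Longrightarrow> \<bar>eta s n t\<bar> \<le> K * s\<^sup>2"
    "\<And>s n t. 0 \<le> n \<Longrightarrow> 0 \<le> t \<Longrightarrow> 0 \<le> s \<Longrightarrow> \<bar>eta1 s n t\<bar> \<le> K * s"
    "\<And>s n t. 0 \<le> n \<Longrightarrow> 0 \<le> t \<Longrightarrow> 0 \<le> s \<Longrightarrow> \<bar>eta2 s n t\<bar> \<le> K" by (rule eta_bounds) blast
  let ?N = "real DIM('a)"
  note [measurable] = loc_int_meas[OF \<phi>] loc_int_meas[OF V]
  have cont: "continuous_on UNIV (eta s n)" "continuous_on UNIV (eta1 s n)" "continuous_on UNIV (eta2 s n)" for n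
  proof -
    have "Ck (Suc (Suc 0)) (eta s n)" by (rule Ck_eta)
    then show "continuous_on UNIV (eta s n)" "continuous_on UNIV (eta1 s n)" "continuous_on UNIV (eta2 s n)"
      using differentiable_imp_continuous_on by (auto simp: partial_eta)
  qed
  have meas: "(\<lambda>x::'a. f (x \<bullet> x)) \<in> borel_measurable lebesgue" if "continuous_on UNIV f" for f :: "real \<Rightarrow> real"
  proof -
    have "(\<lambda>x::'a. f (x \<bullet> x)) \<in> borel_measurable borel"
      by (rule borel_measurable_continuous_onI) (intro continuous_on_compose2[OF that] continuous_intros, auto)
    then show ?thesis by (rule borel_imp_lebesgue_measurable)
  qed
  note [measurable] = meas[OF cont(1)] meas[OF cont(2)] meas[OF cont(3)] meas[OF continuous_on_id]
  have l: "(\<lambda>n. LINT x|lebesgue. \<phi> x * (4 * (x \<bullet> x) * eta2 s (real n) (x \<bullet> x) + 2 * ?N * eta1 s (real n) (x \<bullet> x)))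
     \<longlonglongrightarrow> (LINT x|lebesgue. \<phi> x * (4 * (x \<bullet> x) * indicator (qball s) x + 2 * ?N * (- pos_dist s x)))"
  proof (rule integral_dominated_convergence[where w = "\<lambda>x. (4 * s * K + 2 * ?N * (K * s)) * (indicator (qball s) x * \<bar>\<phi> x\<bar>)"])
    show "integrable lebesgue (\<lambda>x. (4 * s * K + 2 * ?N * (K * s)) * (indicator (qball s) x * \<bar>\<phi> x\<bar>))"
      by (intro integrable_mult_right loc_int_integrable loc_int_abs \<phi>)
    show "AE x in lebesgue. (\<lambda>n. \<phi> x * (4 * (x \<bullet> x) * eta2 s (real n) (x \<bullet> x) + 2 * ?N * eta1 s (real n) (x \<bullet> x)))
      \<longlonglongrightarrow> \<phi> x * (4 * (x \<bullet> x) * indicator (qball s) x + 2 * ?N * (- pos_dist s x))"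
    proof (rule AE_I2)
      fix x :: 'a
      have "indicator (qball s) x = (if x \<bullet> x < s then 1 else 0 :: real)" unfolding qball_def by simp
      then show "(\<lambda>n. \<phi> x * (4 * (x \<bullet> x) * eta2 s (real n) (x \<bullet> x) + 2 * ?N * eta1 s (real n) (x \<bullet> x)))
        \<longlonglongrightarrow> \<phi> x * (4 * (x \<bullet> x) * indicator (qball s) x + 2 * ?N * (- pos_dist s x))"
        unfolding pos_dist_def by (simp only:) (intro tendsto_mult tendsto_add tendsto_const eta_lim)
    qed
    fix n
    show "AE x in lebesgue. norm (\<phi> x * (4 * (x \<bullet> x) * eta2 s (real n) (x \<bullet> x) + 2 * ?N * eta1 s (real n) (x \<bullet> x)))
      \<le> (4 * s * K + 2 * ?N * (K * s)) * (indicator (qball s) x * \<bar>\<phi> x\<bar>)"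
    proof (rule AE_I2)
      fix x :: 'a
      show "norm (\<phi> x * (4 * (x \<bullet> x) * eta2 s (real n) (x \<bullet> x) + 2 * ?N * eta1 s (real n) (x \<bullet> x)))
        \<le> (4 * s * K + 2 * ?N * (K * s)) * (indicator (qball s) x * \<bar>\<phi> x\<bar>)"
      proof (cases "x \<bullet> x < s")
        case False then show ?thesis using eta_zero[of s "x \<bullet> x" "real n"] by (simp add: qball_def)
      next
        case True
        have 1: "4 * (x \<bullet> x) * \<bar>eta2 s (real n) (x \<bullet> x)\<bar> \<le> 4 * s * K"
          using True K(1) K(4)[of "real n" "x \<bullet> x" s] s by (intro mult_mono) auto
        have 2: "2 * ?N * \<bar>eta1 s (real n) (x \<bullet> x)\<bar> \<le> 2 * ?N * (K * s)"
          using K(3)[of "real n" "x \<bullet> x" s] s by (intro mult_left_mono) auto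
        have "\<bar>4 * (x \<bullet> x) * eta2 s (real n) (x \<bullet> x) + 2 * ?N * eta1 s (real n) (x \<bullet> x)\<bar>
          \<le> \<bar>4 * (x \<bullet> x) * eta2 s (real n) (x \<bullet> x)\<bar> + \<bar>2 * ?N * eta1 s (real n) (x \<bullet> x)\<bar>" by (rule abs_triangle_ineq)
        also have "\<dots> = 4 * (x \<bullet> x) * \<bar>eta2 s (real n) (x \<bullet> x)\<bar> + 2 * ?N * \<bar>eta1 s (real n) (x \<bullet> x)\<bar>"
          by (simp add: abs_mult)
        also have "\<dots> \<le> 4 * s * K + 2 * ?N * (K * s)" by (rule add_mono[OF 1 2])
        finally have "\<bar>\<phi> x\<bar> * \<bar>4 * (x \<bullet> x) * eta2 s (real n) (x \<bullet> x) + 2 * ?N * eta1 s (real n) (x \<bullet> x)\<bar>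
          \<le> \<bar>\<phi> x\<bar> * (4 * s * K + 2 * ?N * (K * s))" by (rule mult_left_mono) simp
        then show ?thesis using True unfolding real_norm_def abs_mult[of "\<phi> x"] by (simp add: qball_def mult.commute)
      qed
    qed
  qed measurable
  have r: "(\<lambda>n. LINT x|lebesgue. (0 * \<phi> x - V x * \<phi> x) * eta s (real n) (x \<bullet> x))
     \<longlonglongrightarrow> (LINT x|lebesgue. (0 * \<phi> x - V x * \<phi> x) * ((pos_dist s x)\<^sup>2 / 2))"
  proof (rule integral_dominated_convergence[where w = "\<lambda>x. (K * s\<^sup>2) * (indicator (qball s) x * \<bar>V x * \<phi> x\<bar>)"])
    show "integrable lebesgue (\<lambda>x. (K * s\<^sup>2) * (indicator (qball s) x * \<bar>V x * \<phi> x\<bar>))"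
      by (intro integrable_mult_right loc_int_integrable loc_int_abs V)
    show "AE x in lebesgue. (\<lambda>n. (0 * \<phi> x - V x * \<phi> x) * eta s (real n) (x \<bullet> x)) \<longlonglongrightarrow> (0 * \<phi> x - V x * \<phi> x) * ((pos_dist s x)\<^sup>2 / 2)"
      unfolding pos_dist_def by (intro AE_I2 tendsto_mult tendsto_const eta_lim)
    fix n
    show "AE x in lebesgue. norm ((0 * \<phi> x - V x * \<phi> x) * eta s (real n) (x \<bullet> x)) \<le> (K * s\<^sup>2) * (indicator (qball s) x * \<bar>V x * \<phi> x\<bar>)"
    proof (rule AE_I2)
      fix x :: 'a
      show "norm ((0 * \<phi> x - V x * \<phi> x) * eta s (real n) (x \<bullet> x)) \<le> (K * s\<^sup>2) * (indicator (qball s) x * \<bar>V x * \<phi> x\<bar>)"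
      proof (cases "x \<bullet> x < s")
        case False then show ?thesis using eta_zero(1)[of s "x \<bullet> x" "real n"] by (simp add: qball_def)
      next
        case True
        have "\<bar>V x * \<phi> x\<bar> * \<bar>eta s (real n) (x \<bullet> x)\<bar> \<le> \<bar>V x * \<phi> x\<bar> * (K * s\<^sup>2)"
          using K(2)[of "real n" "x \<bullet> x" s] s by (intro mult_left_mono) auto
        then show ?thesis using True by (simp add: qball_def abs_mult mult_ac)
      qed
    qed
  qed measurable
  have "(LINT x|lebesgue. \<phi> x * (4 * (x \<bullet> x) * eta2 s (real n) (x \<bullet> x) + 2 * ?N * eta1 s (real n) (x \<bullet> x)))
    = (LINT x|lebesgue. (0 * \<phi> x - V x * \<phi> x) * eta s (real n) (x \<bullet> x))" for n
  proof -
    have "test_function (\<lambda>x::'a. eta s (real n) (x \<bullet> x))" by (rule test_function_eta) simp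
    then show ?thesis using weak unfolding weak_laplacian_def laplacian_eta[symmetric] by blast
  qed
  then have eq: "(LINT x|lebesgue. \<phi> x * (4 * (x \<bullet> x) * indicator (qball s) x + 2 * ?N * (- pos_dist s x)))
    = (LINT x|lebesgue. (0 * \<phi> x - V x * \<phi> x) * ((pos_dist s x)\<^sup>2 / 2))"
    using LIMSEQ_unique[OF l] r by simp
  have i1: "integrable lebesgue (\<lambda>x. pos_dist s x * \<phi> x)" using pos_dist_integrable[OF \<phi>, of s 0] by simp
  \<comment> \<open>On the ball, x \<bullet> x is written as s minus \<open>pos_dist\<close>, which
    turns the weight x \<bullet> x into the two moments.\<close>
  have "\<phi> x * (4 * (x \<bullet> x) * indicator (qball s) x + 2 * ?N * (- pos_dist s x))
     = 4 * s * (indicator (qball s) x * \<phi> x) - (4 + 2 * ?N) * (pos_dist s x * \<phi> x)" for x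
    unfolding pos_dist_def qball_def by (auto simp: indicator_def algebra_simps max_def)
  then have L: "(LINT x|lebesgue. \<phi> x * (4 * (x \<bullet> x) * indicator (qball s) x + 2 * ?N * (- pos_dist s x)))
    = 4 * s * ball_int \<phi> s - (4 + 2 * ?N) * dist_int 1 \<phi> s"
    unfolding ball_int_def dist_int_def using i1 loc_int_integrable[OF \<phi>, of s] by simp
  have "(LINT x|lebesgue. (0 * \<phi> x - V x * \<phi> x) * ((pos_dist s x)\<^sup>2 / 2)) = (LINT x|lebesgue. (- 1 / 2) * ((pos_dist s x)\<^sup>2 * (V x * \<phi> x)))"
    by (rule Bochner_Integration.integral_cong) auto
  also have "\<dots> = - dist_int 2 (\<lambda>x. V x * \<phi> x) s / 2" unfolding dist_int_def by (subst integral_mult_right_zero) simp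
  finally show ?thesis using eq L by simp
qed

text \<open>On a ball, the images of \<phi>^+ dx and \<phi>^- dx under x \<bullet> x agree on
  half-lines, hence as measures. Let T be a compact part of {\<phi> > 0} and A its image. By radial
  symmetry \<phi> > 0 almost everywhere on the preimage of A, so the negative part gives A no mass;
  then neither does the positive part, and T is null. As F is not known to be measurable,
  compactness of T is what makes A a Borel set.\<close>

lemma AE_radial_nonpos:
  fixes \<phi> :: "'a::euclidean_space \<Rightarrow> real"
  assumes \<phi>: "loc_int \<phi>" and rad: "AE x in lebesgue. \<phi> x = F (norm x)" and zero: "\<And>s. ball_int \<phi> s = 0"
  shows "AE x in lebesgue. \<phi> x \<le> 0"
proof -
  note m [measurable] = loc_int_meas[OF \<phi>]
  obtain Z where Z: "Z \<in> null_sets lebesgue" "{x. \<phi> x \<noteq> F (norm x)} \<subseteq> Z"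
  proof -
    obtain Z where "\<And>x. x \<in> space lebesgue - Z \<Longrightarrow> \<phi> x = F (norm x)" "Z \<in> null_sets lebesgue"
      using rad by (rule AE_E3) blast
    then show thesis using that[of Z] by auto
  qed
  have sq [measurable]: "(\<lambda>x::'a. x \<bullet> x) \<in> borel_measurable lebesgue"
    by (intro borel_imp_lebesgue_measurable borel_measurable_continuous_onI continuous_intros)
  have null: "{x \<in> qball (real n). 0 < \<phi> x} \<in> null_sets lebesgue" for n
  proof -
    let ?R = "real n"
    define S where "S = {x \<in> qball ?R. 0 < \<phi> x} - Z"
    have S [measurable]: "S \<in> sets lebesgue"
    proof -
      have "{x \<in> space lebesgue. 0 < \<phi> x} \<in> sets lebesgue" by measurable
      then have "qball ?R \<inter> {x. 0 < \<phi> x} \<in> sets lebesgue" using qball_sets(1) by auto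
      then show ?thesis using Z(1) unfolding S_def by (auto simp: Collect_conj_eq null_sets_def)
    qed
    define \<mu> where "\<mu> \<psi> = distr (density lebesgue (\<lambda>x. ennreal (indicator (qball ?R) x * max 0 (\<psi> x)))) borel (\<lambda>x::'a. x \<bullet> x)" for \<psi> :: "'a \<Rightarrow> real"
    have em: "emeasure (\<mu> \<psi>) A = (\<integral>\<^sup>+x. ennreal (indicator (qball ?R) x * max 0 (\<psi> x)) * indicator A (x \<bullet> x) \<partial>lebesgue)"
      if [measurable]: "\<psi> \<in> borel_measurable lebesgue" "A \<in> sets borel" for \<psi> A
    proof -
      have "emeasure (\<mu> \<psi>) A = emeasure (density lebesgue (\<lambda>x. ennreal (indicator (qball ?R) x * max 0 (\<psi> x)))) ((\<lambda>x. x \<bullet> x) -` A \<inter> space lebesgue)"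
        unfolding \<mu>_def by (subst emeasure_distr) auto
      also have "\<dots> = (\<integral>\<^sup>+x. ennreal (indicator (qball ?R) x * max 0 (\<psi> x)) * indicator ((\<lambda>x. x \<bullet> x) -` A \<inter> space lebesgue) x \<partial>lebesgue)"
        by (rule emeasure_density) measurable
      finally show ?thesis by (simp add: indicator_def)
    qed
    have m' [measurable]: "(\<lambda>x. - \<phi> x) \<in> borel_measurable lebesgue" by measurable
    have eqv: "indicator (qball ?R) x * \<phi> x * indicator {r<..} (x \<bullet> x) = indicator (qball ?R) x * \<phi> x - indicator (qball (min r ?R)) x * \<phi> x"
      if "x \<bullet> x \<noteq> r" for x r using that by (auto simp: indicator_def qball_def)
    have int0: "(LINT x|lebesgue. indicator (qball ?R) x * \<phi> x * indicator {r<..} (x \<bullet> x)) = 0" for r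
    proof -
      have "(LINT x|lebesgue. indicator (qball ?R) x * \<phi> x * indicator {r<..} (x \<bullet> x))
         = (LINT x|lebesgue. indicator (qball ?R) x * \<phi> x - indicator (qball (min r ?R)) x * \<phi> x)"
      proof (rule integral_cong_AE)
        show "(\<lambda>x. indicator (qball ?R) x * \<phi> x * indicator {r<..} (x \<bullet> x)) \<in> borel_measurable lebesgue" by measurable
        show "(\<lambda>x. indicator (qball ?R) x * \<phi> x - indicator (qball (min r ?R)) x * \<phi> x) \<in> borel_measurable lebesgue" by measurable
        show "AE x in lebesgue. indicator (qball ?R) x * \<phi> x * indicator {r<..} (x \<bullet> x) = indicator (qball ?R) x * \<phi> x - indicator (qball (min r ?R)) x * \<phi> x"
          using sphere_null[of r] by eventually_elim (rule eqv)
      qed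
      also have "\<dots> = ball_int \<phi> ?R - ball_int \<phi> (min r ?R)"
        unfolding ball_int_def by (rule Bochner_Integration.integral_diff) (intro loc_int_integrable \<phi>)+
      finally show ?thesis using zero by simp
    qed
    have ig: "integrable lebesgue (\<lambda>x. indicator (qball ?R) x * \<psi> x * indicator A (x \<bullet> x))" if "loc_int \<psi>" "A \<in> sets borel" for \<psi> :: "'a \<Rightarrow> real" and A
    proof -
      note [measurable] = loc_int_meas[OF that(1)] that(2)
      have "integrable lebesgue (\<lambda>x. indicator (qball ?R) x * (indicator A (x \<bullet> x) * \<psi> x))"
        by (rule loc_int_bounded_mult[OF that(1), where K = 1])
           (rule measurable_compose[OF sq borel_measurable_indicator[OF that(2)]], simp add: indicator_def)
      then show ?thesis by (simp add: mult_ac)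
    qed
    have lm: "loc_int (\<lambda>x. max 0 (\<phi> x))" "loc_int (\<lambda>x. max 0 (- \<phi> x))"
    proof -
      have le: "\<bar>max 0 (c * \<phi> x)\<bar> \<le> \<bar>\<phi> x\<bar>" if "\<bar>c\<bar> = 1" for c x
        using abs_ge_self[of "c * \<phi> x"] that by (simp add: abs_mult max_def)
      have "integrable lebesgue (\<lambda>x. indicator (qball s) x * max 0 (c * \<phi> x))" if "\<bar>c\<bar> = 1" for c s
        by (rule Bochner_Integration.integrable_bound[OF loc_int_integrable[OF \<phi>, of s]])
           (measurable, rule AE_I2, use le[OF that] in \<open>simp add: indicator_def\<close>)
      from this[of 1] this[of "-1"] show "loc_int (\<lambda>x. max 0 (\<phi> x))" "loc_int (\<lambda>x. max 0 (- \<phi> x))"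
        unfolding loc_int_def by auto
    qed
    have en: "(\<integral>\<^sup>+x. ennreal (indicator (qball ?R) x * f x) * indicator A (x \<bullet> x) \<partial>lebesgue)
       = ennreal (LINT x|lebesgue. indicator (qball ?R) x * f x * indicator A (x \<bullet> x))"
      if "loc_int f" "\<And>x. 0 \<le> f x" "A \<in> sets borel" for f :: "'a \<Rightarrow> real" and A
    proof -
      have "(\<integral>\<^sup>+x. ennreal (indicator (qball ?R) x * f x) * indicator A (x \<bullet> x) \<partial>lebesgue)
        = (\<integral>\<^sup>+x. ennreal (indicator (qball ?R) x * f x * indicator A (x \<bullet> x)) \<partial>lebesgue)"
        by (intro nn_integral_cong) (auto simp: indicator_def)
      also have "\<dots> = ennreal (LINT x|lebesgue. indicator (qball ?R) x * f x * indicator A (x \<bullet> x))"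
        by (rule nn_integral_eq_integral[OF ig[OF that(1,3)]]) (use that(2) in auto)
      finally show ?thesis .
    qed
    \<comment> \<open>Half-lines determine a measure that is finite on them, and on each of them the
      difference of the two masses is a difference of ball integrals, hence 0.\<close>
    have \<mu>eq: "\<mu> \<phi> = \<mu> (\<lambda>x. - \<phi> x)"
    proof (rule measure_eqI_lessThan)
      show "sets (\<mu> \<phi>) = sets borel" "sets (\<mu> (\<lambda>x. - \<phi> x)) = sets borel" unfolding \<mu>_def by auto
      fix r :: real
      have b: "{r<..} \<in> sets borel" by simp
      show "emeasure (\<mu> \<phi>) {r<..} < \<infinity>" unfolding em[OF m b] en[OF lm(1) _ b, simplified] by simp
      have "(LINT x|lebesgue. indicator (qball ?R) x * max 0 (\<phi> x) * indicator {r<..} (x \<bullet> x))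
        - (LINT x|lebesgue. indicator (qball ?R) x * max 0 (- \<phi> x) * indicator {r<..} (x \<bullet> x))
        = (LINT x|lebesgue. indicator (qball ?R) x * max 0 (\<phi> x) * indicator {r<..} (x \<bullet> x)
           - indicator (qball ?R) x * max 0 (- \<phi> x) * indicator {r<..} (x \<bullet> x))"
        by (rule Bochner_Integration.integral_diff[symmetric]) (intro ig lm b)+
      also have "\<dots> = (LINT x|lebesgue. indicator (qball ?R) x * \<phi> x * indicator {r<..} (x \<bullet> x))"
        by (rule Bochner_Integration.integral_cong) (auto simp: indicator_def max_def)
      finally show "emeasure (\<mu> \<phi>) {r<..} = emeasure (\<mu> (\<lambda>x. - \<phi> x)) {r<..}"
        unfolding em[OF m b] em[OF m' b] en[OF lm(1) _ b, simplified] en[OF lm(2) _ b, simplified] using int0[of r] by simp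
    qed
    have le_e: "emeasure lebesgue S \<le> ennreal e" if e: "0 < e" for e
    proof -
      obtain T where T: "closed T" "T \<subseteq> S" "S - T \<in> lmeasurable" "emeasure lebesgue (S - T) < ennreal e"
        using sets_lebesgue_inner_closed[OF S e] by blast
      have "bounded (qball ?R :: 'a set)" unfolding qball_eq by simp
      then have "bounded T" using T(2) bounded_subset unfolding S_def by blast
      then have cT: "compact T" using T(1) by (simp add: compact_eq_bounded_closed)
      define A where "A = (\<lambda>x. x \<bullet> x) ` T"
      have "compact A" unfolding A_def by (intro compact_continuous_image continuous_intros cT)
      then have A: "A \<in> sets borel" by (simp add: borel_closed compact_imp_closed)
      have posA: "0 < \<phi> x" if "x \<bullet> x \<in> A" "x \<notin> Z" for x
      proof -
        obtain y where y: "y \<in> T" "x \<bullet> x = y \<bullet> y" using \<open>x \<bullet> x \<in> A\<close> unfolding A_def by auto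
        then have "y \<notin> Z" "0 < \<phi> y" using T(2) unfolding S_def by auto
        moreover have "norm x = norm y" using y by (simp add: norm_eq_sqrt_inner)
        ultimately show ?thesis using Z(2) that by (metis (mono_tags, lifting) mem_Collect_eq subset_iff)
      qed
      have nZ: "AE x in lebesgue. x \<notin> Z" using Z(1) by (rule AE_not_in)
      have "emeasure (\<mu> (\<lambda>x. - \<phi> x)) A = 0"
        unfolding em[OF m' A]
      proof (subst nn_integral_0_iff_AE)
        show "(\<lambda>x. ennreal (indicator (qball ?R) x * max 0 (- \<phi> x)) * indicator A (x \<bullet> x)) \<in> borel_measurable lebesgue"
          using A by measurable
        show "AE x in lebesgue. ennreal (indicator (qball ?R) x * max 0 (- \<phi> x)) * indicator A (x \<bullet> x) = 0"
          using nZ by eventually_elim (use posA in \<open>force simp: indicator_def max_def\<close>)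
      qed
      then have "emeasure (\<mu> \<phi>) A = 0" using \<mu>eq by simp
      then have "AE x in lebesgue. ennreal (indicator (qball ?R) x * max 0 (\<phi> x)) * indicator A (x \<bullet> x) = 0"
        unfolding em[OF m A] by (subst (asm) nn_integral_0_iff_AE) (use A in measurable)
      then have "AE x in lebesgue. x \<notin> T"
      proof eventually_elim
        case (elim x)
        show ?case
        proof
          assume xT: "x \<in> T"
          then have "0 < \<phi> x" "x \<in> qball ?R" "x \<bullet> x \<in> A" using T(2) unfolding S_def A_def by auto
          then show False using elim by (simp add: indicator_def max_def)
        qed
      qed
      then have "T \<in> null_sets lebesgue" using T(1) by (simp add: AE_iff_null_sets)
      then have "emeasure lebesgue (S - T \<union> T) = emeasure lebesgue (S - T)"
        by (rule emeasure_Un_null_set[rotated]) (use T(3) in auto)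
      moreover have "S - T \<union> T = S" using T(2) by auto
      ultimately show ?thesis using T(4) by simp
    qed
    have "emeasure lebesgue S \<le> 0"
    proof (rule ennreal_le_epsilon)
      fix e :: real assume "0 < e"
      then show "emeasure lebesgue S \<le> 0 + ennreal e" using le_e[of e] by simp
    qed
    then have "S \<in> null_sets lebesgue" using S by (simp add: null_sets_def)
    then have "S \<union> Z \<in> null_sets lebesgue" using Z(1) by auto
    moreover have "{x \<in> qball ?R. 0 < \<phi> x} \<subseteq> S \<union> Z" unfolding S_def by auto
    ultimately show ?thesis by (rule completion.complete2[rotated])
  qed
  have un: "(\<Union>n. {x \<in> qball (real n). 0 < \<phi> x}) \<in> null_sets lebesgue" by (rule null_sets_UN) (rule null)
  have "{x. \<not> \<phi> x \<le> 0} \<subseteq> (\<Union>n. {x \<in> qball (real n). 0 < \<phi> x})"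
    using reals_Archimedean2 by (force simp: qball_def)
  then show ?thesis by (intro AE_I'[OF un]) simp
qed

lemma AE_radial_zero:
  fixes \<phi> :: "'a::euclidean_space \<Rightarrow> real"
  assumes \<phi>: "loc_int \<phi>" and rad: "AE x in lebesgue. \<phi> x = F (norm x)" and zero: "\<And>s. ball_int \<phi> s = 0"
  shows "AE x in lebesgue. \<phi> x = 0"
proof -
  have 1: "AE x in lebesgue. \<phi> x \<le> 0" by (rule AE_radial_nonpos[OF assms])
  have "loc_int (\<lambda>x. (- 1) * \<phi> x)" by (rule loc_int_mult[OF \<phi>, of _ 1]) auto
  moreover have "AE x in lebesgue. (- 1) * \<phi> x = - F (norm x)" using rad by eventually_elim simp
  moreover have "ball_int (\<lambda>x. (- 1) * \<phi> x) s = 0" for s using zero[of s] unfolding ball_int_def by simp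
  ultimately have "AE x in lebesgue. (- 1) * \<phi> x \<le> 0" using AE_radial_nonpos[of "\<lambda>x. (- 1) * \<phi> x" "\<lambda>r. - F r"] by blast
  then show ?thesis using 1 by eventually_elim simp
qed

text \<open>
  On a thin shell \<open>V\<close> is nearly constant, which compares the two increments; Bolzano's bisection
  principle turns the local estimates into a global one.
\<close>

lemma ball_int_weighted_deriv:
  fixes \<phi> V :: "'a::euclidean_space \<Rightarrow> real"
  assumes \<phi>: "loc_int \<phi>" and V\<phi>: "loc_int (\<lambda>x. V x * \<phi> x)" and V: "\<And>x. V x = v (x \<bullet> x)"
    and v: "continuous_on {0<..} v" and \<rho>: "continuous_on {0<..} \<rho>"
    and M: "\<And>s. 0 < s \<Longrightarrow> (ball_int \<phi> has_real_derivative \<rho> s) (at s)" and s: "0 < s"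
  shows "(ball_int (\<lambda>x. V x * \<phi> x) has_real_derivative v s * \<rho> s) (at s)"
proof -
  \<comment> \<open>The functions v and \<rho> are continuous only away from 0, so the
    antiderivative J starts at c, and increments are compared beyond 2 c, which is still below
    s.\<close>
  define c where "c = s / 4"
  have c: "0 < c" using s unfolding c_def by simp
  define J where "J x = integral {c..x} (\<lambda>t. v t * \<rho> t)" for x
  let ?m = "ball_int (\<lambda>x. V x * \<phi> x)" and ?T = "ball_int (\<lambda>x. \<bar>\<phi> x\<bar>)"
  have Jd: "(J has_real_derivative v x * \<rho> x) (at x)" if x: "c < x" for x
  proof -
    have "(J has_real_derivative v x * \<rho> x) (at x within {c..x+1})" unfolding J_def[abs_def]
      by (rule integral_has_real_derivative)
         (use x c in \<open>auto intro!: continuous_intros continuous_on_subset[OF v] continuous_on_subset[OF \<rho>]\<close>)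
    then show ?thesis using at_within_interior[of x "{c..x+1}"] x by simp
  qed
  have inc: "?m b - ?m a = J b - J a" if ab: "2 * c \<le> a" "a \<le> b" for a b
  proof -
    have "compact (\<rho> ` {c..b+1})"
      by (rule compact_continuous_image) (use c in \<open>auto intro: continuous_on_subset[OF \<rho>]\<close>)
    then obtain K where K: "\<And>x. x \<in> {c..b+1} \<Longrightarrow> \<bar>\<rho> x\<bar> \<le> K"
      by (metis compact_imp_bounded bounded_iff imageI real_norm_def)
    \<comment> \<open>The mass of |\<phi>| controls the error of the ball integrals, the linear term
      that of J. Being an increment, the resulting bound is additive over adjacent intervals, as
      bisection requires.\<close>
    define \<Psi> where "\<Psi> x = ?T x + K * x" for x
    have est: "\<bar>?m b - ?m a - (J b - J a)\<bar> \<le> \<epsilon> * (\<Psi> b - \<Psi> a)" if \<epsilon>: "0 < \<epsilon>" for \<epsilon>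
      using ab(2)
    proof (induction a b rule: Bolzano)
      case (trans a b c)
      then show ?case by (simp add: right_diff_distrib)
    next
      case (local x)
      have x: "2 * c \<le> x" "x \<le> b" using local ab by auto
      have "isCont v x" using v x c by (simp add: continuous_on_eq_continuous_at)
      then obtain d0 where d0: "0 < d0" "\<And>y. dist y x < d0 \<Longrightarrow> dist (v y) (v x) < \<epsilon>"
        using \<epsilon> unfolding continuous_at_eps_delta by blast
      define d where "d = min d0 (min c 1)"
      have d: "0 < d" "d \<le> d0" "d \<le> c" "d \<le> 1" using d0 c unfolding d_def by auto
      show ?case
      proof (intro exI[of _ d] conjI allI impI d(1))
        fix y z assume yz: "y \<le> x \<and> x \<le> z \<and> z - y < d"
        then have yz': "y \<le> z" "x - d < y" "z < x + d" by auto
        have vx: "\<bar>v t - v x\<bar> \<le> \<epsilon>" if "y \<le> t" "t \<le> z" for t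
          using d0(2)[of t] that yz' d(2) yz by (auto simp: dist_real_def intro!: less_imp_le)
        have i1: "integrable lebesgue (\<lambda>t. indicator (qball z - qball y) t * (V t * \<phi> t))" by (rule ball_int_diff(2)[OF V\<phi> yz'(1)])
        have i2: "integrable lebesgue (\<lambda>t. indicator (qball z - qball y) t * \<phi> t)" by (rule ball_int_diff(2)[OF \<phi> yz'(1)])
        have i3: "integrable lebesgue (\<lambda>t. indicator (qball z - qball y) t * \<bar>\<phi> t\<bar>)" by (rule ball_int_diff(2)[OF loc_int_abs[OF \<phi>] yz'(1)])
        have "?m z - ?m y - v x * (ball_int \<phi> z - ball_int \<phi> y)
          = (LINT t|lebesgue. indicator (qball z - qball y) t * (V t * \<phi> t) - v x * (indicator (qball z - qball y) t * \<phi> t))"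
          unfolding ball_int_diff(1)[OF V\<phi> yz'(1)] ball_int_diff(1)[OF \<phi> yz'(1)] using i1 i2 by simp
        also have "\<bar>\<dots>\<bar> \<le> (LINT t|lebesgue. \<epsilon> * (indicator (qball z - qball y) t * \<bar>\<phi> t\<bar>))"
        proof (rule integral_abs_bound_integral)
          show "integrable lebesgue (\<lambda>t. indicator (qball z - qball y) t * (V t * \<phi> t) - v x * (indicator (qball z - qball y) t * \<phi> t))"
            by (intro Bochner_Integration.integrable_diff integrable_mult_right i1 i2)
          show "integrable lebesgue (\<lambda>t. \<epsilon> * (indicator (qball z - qball y) t * \<bar>\<phi> t\<bar>))" by (intro integrable_mult_right i3)
          fix t :: 'a
          show "\<bar>indicator (qball z - qball y) t * (V t * \<phi> t) - v x * (indicator (qball z - qball y) t * \<phi> t)\<bar>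
            \<le> \<epsilon> * (indicator (qball z - qball y) t * \<bar>\<phi> t\<bar>)"
          proof (cases "t \<in> qball z - qball y")
            case True
            then have "\<bar>V t - v x\<bar> \<le> \<epsilon>" unfolding V qball_def by (intro vx) auto
            from mult_right_mono[OF this, of "\<bar>\<phi> t\<bar>"] show ?thesis using True
              by (simp add: abs_mult[symmetric] left_diff_distrib mult.assoc)
          qed simp
        qed
        also have "\<dots> = \<epsilon> * (?T z - ?T y)" unfolding ball_int_diff(1)[OF loc_int_abs[OF \<phi>] yz'(1)] by simp
        finally have 1: "\<bar>?m z - ?m y - v x * (ball_int \<phi> z - ball_int \<phi> y)\<bar> \<le> \<epsilon> * (?T z - ?T y)" .
        \<comment> \<open>The same freezing of v at x for the antiderivative: the integrand differs
          by (v(x) - v(t)) \<rho>(t), which is at most \<epsilon> K.\<close>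
        have 2: "\<bar>(v x * ball_int \<phi> z - J z) - (v x * ball_int \<phi> y - J y)\<bar> \<le> \<epsilon> * K * z - \<epsilon> * K * y"
        proof (rule deriv_bound_compare[OF yz'(1), where f = "\<lambda>t. v x * ball_int \<phi> t - J t" and f' = "\<lambda>t. v x * \<rho> t - v t * \<rho> t" and B' = "\<lambda>t. \<epsilon> * K * 1"])
          have D: "((\<lambda>t. v x * ball_int \<phi> t - J t) has_real_derivative v x * \<rho> t - v t * \<rho> t) (at t)" if "c < t" for t
            by (intro DERIV_diff DERIV_cmult M Jd that) (use that c in simp)
          have cy: "c < y" using yz' x d by linarith
          show "continuous_on {y..z} (\<lambda>t. v x * ball_int \<phi> t - J t)"
            by (rule continuous_at_imp_continuous_on, rule ballI, rule DERIV_isCont, rule D) (use cy in auto)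
          show "continuous_on {y..z} (\<lambda>t. \<epsilon> * K * t)" by (intro continuous_intros)
          fix t assume t: "y < t" "t < z"
          show "((\<lambda>t. v x * ball_int \<phi> t - J t) has_real_derivative v x * \<rho> t - v t * \<rho> t) (at t)" by (rule D) (use cy t in auto)
          show "((\<lambda>t. \<epsilon> * K * t) has_real_derivative \<epsilon> * K * 1) (at t)" by (intro DERIV_cmult DERIV_ident)
          have "\<bar>v t - v x\<bar> * \<bar>\<rho> t\<bar> \<le> \<epsilon> * K"
            by (rule mult_mono[OF vx K]) (use t cy yz' x d \<epsilon> in auto)
          then show "\<bar>v x * \<rho> t - v t * \<rho> t\<bar> \<le> \<epsilon> * K * 1"
            by (simp add: left_diff_distrib[symmetric] abs_mult abs_minus_commute)
        qed
        have "?m z - ?m y - (J z - J y) = (?m z - ?m y - v x * (ball_int \<phi> z - ball_int \<phi> y)) + ((v x * ball_int \<phi> z - J z) - (v x * ball_int \<phi> y - J y))"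
          by (simp add: algebra_simps)
        moreover have "\<epsilon> * (\<Psi> z - \<Psi> y) = \<epsilon> * (?T z - ?T y) + (\<epsilon> * K * z - \<epsilon> * K * y)" unfolding \<Psi>_def by (simp add: algebra_simps)
        ultimately show "\<bar>?m z - ?m y - (J z - J y)\<bar> \<le> \<epsilon> * (\<Psi> z - \<Psi> y)" using 1 2 by linarith
      qed
    qed
    have "\<bar>?m b - ?m a - (J b - J a)\<bar> \<le> 0"
    proof (rule field_le_epsilon)
      fix e :: real assume e: "0 < e"
      define \<epsilon> where "\<epsilon> = e / (\<bar>\<Psi> b - \<Psi> a\<bar> + 1)"
      have "0 < \<epsilon>" unfolding \<epsilon>_def using e by (simp add: add_nonneg_pos)
      from est[OF this] have "\<bar>?m b - ?m a - (J b - J a)\<bar> \<le> \<epsilon> * (\<Psi> b - \<Psi> a)" .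
      also have "\<dots> \<le> \<epsilon> * (\<bar>\<Psi> b - \<Psi> a\<bar> + 1)" using \<open>0 < \<epsilon>\<close> by (intro mult_left_mono) auto
      also have "\<dots> = e" unfolding \<epsilon>_def by (simp add: add_nonneg_eq_0_iff)
      finally show "\<bar>?m b - ?m a - (J b - J a)\<bar> \<le> 0 + e" by simp
    qed
    then show ?thesis by simp
  qed
  have "((\<lambda>x. ?m (2 * c) - J (2 * c) + J x) has_real_derivative 0 + v s * \<rho> s) (at s)"
    by (intro DERIV_add DERIV_const Jd) (use s in \<open>simp add: c_def\<close>)
  then have "((\<lambda>x. ?m (2 * c) - J (2 * c) + J x) has_real_derivative v s * \<rho> s) (at s)" by simp
  then show ?thesis
  proof (rule has_field_derivative_transform_within_open[where S = "{2 * c<..}"])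
    fix x assume "x \<in> {2 * c<..}"
    then show "?m (2 * c) - J (2 * c) + J x = ?m x" using inc[of "2 * c" x] by simp
  qed (use s in \<open>auto simp: c_def\<close>)
qed

section \<open>From weak eigenfunctions to solutions of the linearized equation\<close>

lemma weighted_integral_bound:
  fixes \<phi> c :: "'a::euclidean_space \<Rightarrow> real"
  assumes \<phi>: "loc_int \<phi>" and i: "integrable lebesgue (\<lambda>x. c x * \<phi> x)"
    and c: "\<And>x. \<bar>c x\<bar> \<le> K * indicator (qball s) x"
  shows "\<bar>LINT x|lebesgue. c x * \<phi> x\<bar> \<le> K * ball_int (\<lambda>x. \<bar>\<phi> x\<bar>) s"
proof -
  have "\<bar>LINT x|lebesgue. c x * \<phi> x\<bar> \<le> (LINT x|lebesgue. K * (indicator (qball s) x * \<bar>\<phi> x\<bar>))"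
  proof (rule integral_abs_bound_integral[OF i])
    show "integrable lebesgue (\<lambda>x. K * (indicator (qball s) x * \<bar>\<phi> x\<bar>))"
      by (intro integrable_mult_right loc_int_integrable loc_int_abs \<phi>)
    fix x
    show "\<bar>c x * \<phi> x\<bar> \<le> K * (indicator (qball s) x * \<bar>\<phi> x\<bar>)"
      using mult_right_mono[OF c[of x], of "\<bar>\<phi> x\<bar>"] by (simp add: abs_mult mult.assoc)
  qed
  then show ?thesis unfolding ball_int_def by simp
qed

text \<open>
  Testing the equation against radial functions only involves the moments \<open>ball_int\<close> and \<open>dist_int\<close>
  of \<open>\<phi>\<close>; these satisfy an ordinary differential equation. Up to a constant, \<open>\<rho> s\<close> is
  \<open>r ^ (k - 1)\<close> times the radial profile of \<open>\<phi>\<close> at \<open>r = sqrt s\<close>.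
\<close>

theorem not_eigenvalue_rad:
  fixes u :: "'a::euclidean_space \<Rightarrow> real"
  assumes nl: "nonlinearity g g' b bt" and dim: "DIM('a) = Suc k" and k: "1 \<le> k"
    and sol: "positive_radial_solution g u"
  shows "\<not> eigenvalue_rad (\<lambda>x. g' (u x)) 0"
proof
  assume "eigenvalue_rad (\<lambda>x. g' (u x)) 0"
  then obtain \<phi> :: "'a \<Rightarrow> real" where L2: "\<phi> \<in> L2" and rad: "\<exists>F. AE x in lebesgue. \<phi> x = F (norm x)"
    and weak: "weak_laplacian \<phi> (\<lambda>x. 0 * \<phi> x - g' (u x) * \<phi> x)" and nz: "\<not> (AE x in lebesgue. \<phi> x = 0)"
    unfolding eigenvalue_rad_def in_eigenspace_rad_def H1_rad_def H1_def by auto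
  obtain F where F: "AE x in lebesgue. \<phi> x = F (norm x)" using rad by auto
  obtain e :: 'a where e: "e \<in> Basis" using nonempty_Basis by blast
  define U where "U r = u (r *\<^sub>R e)" for r
  define P where "P r = partial e u (r *\<^sub>R e)" for r
  have uU: "u x = U (norm x)" for x unfolding U_def by (rule positive_radial_solution_ground_state(2)[OF nl dim k sol e])
  interpret ground_state g g' b bt k U P
    unfolding U_def[abs_def] P_def[abs_def] by (rule positive_radial_solution_ground_state(1)[OF nl dim k sol e])
  define V where "V x = g' (u x)" for x
  define v where "v t = g' (U (sqrt t))" for t
  have Vv: "V x = v (x \<bullet> x)" for x unfolding V_def v_def uU by (simp add: norm_eq_sqrt_inner)
  have vr: "v (r\<^sup>2) = g' (U r)" if "0 < r" for r using that unfolding v_def by simp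
  obtain L where L: "0 \<le> L" "\<And>r. 0 \<le> r \<Longrightarrow> \<bar>g' (U r)\<bar> \<le> L" using U_lipschitz_bound by metis
  have VL: "\<bar>V x\<bar> \<le> L" for x unfolding V_def uU by (rule L(2)) simp
  have g'U: "continuous_on {0..} (\<lambda>r. g' (U r))"
    by (rule continuous_on_compose2[OF g'_cont U_cont]) (use U_pos in \<open>auto intro: less_imp_le\<close>)
  have vc: "continuous_on {0<..} v" unfolding v_def
    by (rule continuous_on_compose2[OF g'U]) (auto intro!: continuous_intros)
  have Vm [measurable]: "V \<in> borel_measurable lebesgue"
  proof -
    have "continuous_on UNIV V" unfolding V_def uU
      by (rule continuous_on_compose2[OF g'U]) (auto intro!: continuous_intros)
    then show ?thesis by (intro borel_imp_lebesgue_measurable borel_measurable_continuous_onI)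
  qed
  have \<phi>: "loc_int \<phi>" by (rule L2_loc_int[OF L2])
  have V\<phi>: "loc_int (\<lambda>x. V x * \<phi> x)" by (rule loc_int_mult[OF \<phi> Vm VL])
  define M where "M = ball_int \<phi>"
  define A where "A = dist_int 1 \<phi>"
  define m where "m = ball_int (\<lambda>x. V x * \<phi> x)"
  define C where "C = dist_int 1 (\<lambda>x. V x * \<phi> x)"
  define B2 where "B2 = dist_int 2 (\<lambda>x. V x * \<phi> x)"
  define N where "N = real k + 1"
  have id: "4 * s * M s - (4 + 2 * N) * A s = - B2 s / 2" if "0 \<le> s" for s
    using weak_radial_identity[OF \<phi> V\<phi> _ that] weak dim unfolding V_def M_def A_def B2_def N_def by (simp add: add.commute)
  have Ad: "(A has_real_derivative M s) (at s)" for s unfolding A_def M_def by (rule dist_int1_deriv[OF \<phi>])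
  have Cd: "(C has_real_derivative m s) (at s)" for s unfolding C_def m_def by (rule dist_int1_deriv[OF V\<phi>])
  have B2d: "(B2 has_real_derivative 2 * C s) (at s)" for s unfolding C_def B2_def by (rule dist_int2_deriv[OF V\<phi>])
  \<comment> \<open>Divided by 4 s, the identity expresses M through the differentiable moments A
    and B2, so M is differentiable although \<phi> is only a class of functions; \<rho> is its
    derivative, simplified by the identity, and is itself differentiable.\<close>
  define \<rho> where "\<rho> s = (2 * N * M s - C s) / (4 * s)" for s
  have Md: "(M has_real_derivative \<rho> s) (at s)" if s: "0 < s" for s
  proof -
    have "((\<lambda>s. ((4 + 2 * N) * A s - B2 s / 2) / (4 * s)) has_real_derivative
       (((4 + 2 * N) * M s - 2 * C s / 2) * (4 * s) - ((4 + 2 * N) * A s - B2 s / 2) * (4 * 1)) / (4 * s * (4 * s))) (at s)"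
      by (intro DERIV_divide DERIV_diff DERIV_cmult DERIV_cdivide DERIV_ident Ad B2d) (use s in simp)
    moreover have "(4 + 2 * N) * A s - B2 s / 2 = 4 * s * M s" using id[of s] s by simp
    then have "(((4 + 2 * N) * M s - 2 * C s / 2) * (4 * s) - ((4 + 2 * N) * A s - B2 s / 2) * (4 * 1)) / (4 * s * (4 * s)) = \<rho> s"
      unfolding \<rho>_def using s by (simp add: field_simps)
    ultimately have "((\<lambda>s. ((4 + 2 * N) * A s - B2 s / 2) / (4 * s)) has_real_derivative \<rho> s) (at s)" by simp
    then show ?thesis
    proof (rule has_field_derivative_transform_within_open[where S = "{0<..}"])
      fix x :: real assume "x \<in> {0<..}"
      then show "((4 + 2 * N) * A x - B2 x / 2) / (4 * x) = M x" using id[of x] by (simp add: field_simps)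
    qed (use s in auto)
  qed
  have \<rho>d: "(\<rho> has_real_derivative (2 * N * \<rho> s - m s) / (4 * s) - \<rho> s / s) (at s)" if s: "0 < s" for s
  proof -
    have "((\<lambda>s. (2 * N * M s - C s) / (4 * s)) has_real_derivative
       ((2 * N * \<rho> s - m s) * (4 * s) - (2 * N * M s - C s) * (4 * 1)) / (4 * s * (4 * s))) (at s)"
      by (intro DERIV_divide DERIV_diff DERIV_cmult DERIV_ident Md Cd s) (use s in simp)
    moreover have "2 * N * M s - C s = 4 * s * \<rho> s" unfolding \<rho>_def using s by simp
    then have "((2 * N * \<rho> s - m s) * (4 * s) - (2 * N * M s - C s) * (4 * 1)) / (4 * s * (4 * s)) = (2 * N * \<rho> s - m s) / (4 * s) - \<rho> s / s"
      using s by (simp add: field_simps)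
    ultimately show ?thesis unfolding \<rho>_def[abs_def] by simp
  qed
  have \<rho>c: "continuous_on {0<..} \<rho>" by (rule continuous_at_imp_continuous_on) (use \<rho>d DERIV_isCont in blast)
  have md: "(m has_real_derivative v s * \<rho> s) (at s)" if "0 < s" for s
    unfolding m_def by (rule ball_int_weighted_deriv[OF \<phi> V\<phi> Vv vc \<rho>c _ that]) (use Md in \<open>simp add: M_def\<close>)
  \<comment> \<open>The quotient r / r^k stands for r^(1 - k). The formula for q is the flux
    identity: r^k w' is minus half the integral of V \<phi> over the ball of radius r.\<close>
  define w where "w r = \<rho> (r\<^sup>2) * (r / r ^ k)" for r
  define q where "q r = - (m (r\<^sup>2) / 2) / r ^ k" for r
  have sq: "((\<lambda>r::real. r\<^sup>2) has_real_derivative 2 * r) (at r)" for r by (auto intro!: derivative_eq_intros)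
  have wd: "(w has_real_derivative q r) (at r)" if r: "0 < r" for r
  proof -
    have r2: "0 < r\<^sup>2" using r by simp
    have a: "((\<lambda>r. \<rho> (r\<^sup>2)) has_real_derivative ((2 * N * \<rho> (r\<^sup>2) - m (r\<^sup>2)) / (4 * r\<^sup>2) - \<rho> (r\<^sup>2) / r\<^sup>2) * (2 * r)) (at r)"
      by (rule DERIV_chain2[OF \<rho>d[OF r2] sq])
    have pk: "real k * r ^ (k - Suc 0) * r = real k * r ^ k" using k1 by (cases k) auto
    have "((\<lambda>r. r / r ^ k) has_real_derivative (1 * r ^ k - r * (real k * r ^ (k - Suc 0))) / (r ^ k * r ^ k)) (at r)"
      by (intro DERIV_divide DERIV_ident DERIV_pow) (use r in simp)
    moreover have "(1 * r ^ k - r * (real k * r ^ (k - Suc 0))) / (r ^ k * r ^ k) = (1 - real k) / r ^ k"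
    proof -
      have "1 * r ^ k - r * (real k * r ^ (k - Suc 0)) = (1 - real k) * r ^ k" using pk by (simp add: algebra_simps) metis
      then show ?thesis using r by simp
    qed
    ultimately have b: "((\<lambda>r. r / r ^ k) has_real_derivative (1 - real k) / r ^ k) (at r)" by simp
    have "(w has_real_derivative ((2 * N * \<rho> (r\<^sup>2) - m (r\<^sup>2)) / (4 * r\<^sup>2) - \<rho> (r\<^sup>2) / r\<^sup>2) * (2 * r) * (r / r ^ k)
       + (1 - real k) / r ^ k * \<rho> (r\<^sup>2)) (at r)"
      unfolding w_def[abs_def] by (rule DERIV_mult[OF a b])
    moreover have "((2 * N * x - y) / (4 * r\<^sup>2) - x / r\<^sup>2) * (2 * r) * (r / r ^ k) + (1 - real k) / r ^ k * x = - (y / 2) / r ^ k" for x y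
    proof -
      have "((2 * N * x - y) / (4 * r\<^sup>2) - x / r\<^sup>2) * (2 * r) * r = N * x - y / 2 - 2 * x"
        using r by (simp add: field_simps power2_eq_square)
      then have "((2 * N * x - y) / (4 * r\<^sup>2) - x / r\<^sup>2) * (2 * r) * (r / r ^ k) = (N * x - y / 2 - 2 * x) / r ^ k"
        by (metis times_divide_eq_right)
      moreover have "(N * x - y / 2 - 2 * x) + (1 - real k) * x = - (y / 2)" unfolding N_def by (simp add: algebra_simps)
      ultimately show ?thesis by (metis add_divide_distrib times_divide_eq_left)
    qed
    ultimately show ?thesis unfolding q_def by simp
  qed
  have kq: "r ^ k * q r = - m (r\<^sup>2) / 2" if "0 < r" for r unfolding q_def using that by simp
  have kw: "r ^ (k + 1) * w r = (2 * N * M (r\<^sup>2) - C (r\<^sup>2)) / 4" if "0 < r" for r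
    unfolding w_def \<rho>_def using that by (simp add: power2_eq_square field_simps)
  have qd: "((\<lambda>r. r ^ k * q r) has_real_derivative - (r ^ k * (g' (U r) * w r))) (at r)" if r: "0 < r" for r
  proof -
    have r2: "0 < r\<^sup>2" using r by simp
    have "((\<lambda>r. - m (r\<^sup>2) / 2) has_real_derivative - (v (r\<^sup>2) * \<rho> (r\<^sup>2) * (2 * r)) / 2) (at r)"
      by (intro DERIV_cdivide DERIV_minus DERIV_chain2[OF md[OF r2] sq])
    moreover have "- (v (r\<^sup>2) * \<rho> (r\<^sup>2) * (2 * r)) / 2 = - (r ^ k * (g' (U r) * w r))"
      unfolding w_def vr[OF r] using r by simp
    ultimately have "((\<lambda>r. - m (r\<^sup>2) / 2) has_real_derivative - (r ^ k * (g' (U r) * w r))) (at r)" by simp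
    then show ?thesis
      by (rule has_field_derivative_transform_within_open[where S = "{0<..}"]) (use r kq in auto)
  qed
  have lim0: "((\<lambda>r. f (r\<^sup>2)) \<longlongrightarrow> 0) (at_right 0)" if "isCont f 0" "f 0 = 0" for f :: "real \<Rightarrow> real"
  proof -
    have "((\<lambda>r::real. r\<^sup>2) \<longlongrightarrow> 0) (at_right 0)" by (auto intro!: tendsto_eq_intros)
    from isCont_tendsto_compose[OF that(1) this] show ?thesis using that(2) by simp
  qed
  have l: "((\<lambda>r. M (r\<^sup>2)) \<longlongrightarrow> 0) (at_right 0)" "((\<lambda>r. m (r\<^sup>2)) \<longlongrightarrow> 0) (at_right 0)" "((\<lambda>r. C (r\<^sup>2)) \<longlongrightarrow> 0) (at_right 0)"
  proof -
    show "((\<lambda>r. M (r\<^sup>2)) \<longlongrightarrow> 0) (at_right 0)" unfolding M_def by (rule lim0[OF ball_int_cont[OF \<phi>] ball_int_0]) simp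
    show "((\<lambda>r. m (r\<^sup>2)) \<longlongrightarrow> 0) (at_right 0)" unfolding m_def by (rule lim0[OF ball_int_cont[OF V\<phi>] ball_int_0]) simp
    show "((\<lambda>r. C (r\<^sup>2)) \<longlongrightarrow> 0) (at_right 0)"
      by (rule lim0[OF DERIV_isCont[OF Cd]]) (use dist_int_0[of 0 0] in \<open>simp add: C_def\<close>)
  qed
  have lin: "lin_sol w q"
    unfolding lin_sol_def
  proof (intro conjI allI impI)
    show "(w has_real_derivative q r) (at r)" if "0 < r" for r by (rule wd[OF that])
    show "((\<lambda>r. r ^ k * q r) has_real_derivative - (r ^ k * (g' (U r) * w r))) (at r)" if "0 < r" for r by (rule qd[OF that])
    have "((\<lambda>r. - m (r\<^sup>2) / 2) \<longlongrightarrow> - 0 / 2) (at_right 0)" by (intro tendsto_intros l) simp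
    then have "((\<lambda>r. - m (r\<^sup>2) / 2) \<longlongrightarrow> 0) (at_right 0)" by simp
    then show "((\<lambda>r. r ^ k * q r) \<longlongrightarrow> 0) (at_right 0)"
      by (rule Lim_transform_eventually) (rule eventually_mono[OF at_right_0_pos], simp add: kq)
    have "((\<lambda>r. (2 * N * M (r\<^sup>2) - C (r\<^sup>2)) / 4) \<longlongrightarrow> (2 * N * 0 - 0) / 4) (at_right 0)" by (intro tendsto_intros l) simp
    then have "((\<lambda>r. (2 * N * M (r\<^sup>2) - C (r\<^sup>2)) / 4) \<longlongrightarrow> 0) (at_right 0)" by simp
    then show "((\<lambda>r. r ^ (k + 1) * w r) \<longlongrightarrow> 0) (at_right 0)"
      by (rule Lim_transform_eventually) (rule eventually_mono[OF at_right_0_pos], rule kw[symmetric], assumption)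
    \<comment> \<open>If w vanished, M would be constant for s > 0, hence equal to its limit 0 at
      the origin; a radial function with vanishing ball integrals is zero almost everywhere.\<close>
    show "\<exists>r>0. w r \<noteq> 0"
    proof (rule ccontr)
      assume "\<not> ?thesis"
      then have w0: "w r = 0" if "0 < r" for r using that by blast
      have \<rho>0: "\<rho> s = 0" if s: "0 < s" for s using w0[of "sqrt s"] s unfolding w_def by simp
      have const: "M s = M t" if "0 < s" "s < t" for s t
      proof (rule DERIV_isconst2[of s t M t, symmetric])
        show "continuous_on {s..t} M"
          by (rule continuous_at_imp_continuous_on, rule ballI, rule DERIV_isCont, rule Md) (use that in auto)
        show "(M has_real_derivative 0) (at x)" if "s < x" "x < t" for x
          using Md[of x] \<rho>0[of x] that \<open>0 < s\<close> by simp
      qed (use that in auto)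
      have "M s = 0" for s
      proof (cases "0 < s")
        case False then show ?thesis unfolding M_def by (simp add: ball_int_0)
      next
        case True
        have "(M \<longlongrightarrow> M 0) (at_right 0)" using ball_int_cont[OF \<phi>, of 0] unfolding M_def isCont_def
          by (rule filterlim_mono[OF _ order_refl]) (simp add: at_le)
        moreover have "M 0 = 0" unfolding M_def by (simp add: ball_int_0)
        moreover have "(M \<longlongrightarrow> M s) (at_right 0)"
        proof (rule Lim_transform_eventually[OF tendsto_const])
          have "\<forall>\<^sub>F t in at_right 0. t \<in> {0<..<s}" by (rule eventually_at_right_real[OF True])
          then show "\<forall>\<^sub>F t in at_right 0. M s = M t" by eventually_elim (use const in auto)
        qed
        ultimately show ?thesis using tendsto_unique[OF trivial_limit_at_right_real] by metis
      qed
      then have "AE x in lebesgue. \<phi> x = 0" unfolding M_def by (intro AE_radial_zero[OF \<phi> F]) simp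
      then show False using nz by simp
    qed
  qed
  \<comment> \<open>The mass of |\<phi>| on the ball of radius r bounds all three moments M, m and
    C, up to the factors 1, L and r^2 L.\<close>
  define T where "T r = ball_int (\<lambda>x. \<bar>\<phi> x\<bar>) (r\<^sup>2)" for r
  have MT: "\<bar>M (r\<^sup>2)\<bar> \<le> 1 * T r" for r unfolding M_def T_def ball_int_def[of \<phi>]
    by (rule weighted_integral_bound[OF \<phi> loc_int_integrable[OF \<phi>]]) simp
  have mT: "\<bar>m (r\<^sup>2)\<bar> \<le> L * T r" for r
  proof -
    have "\<bar>LINT x|lebesgue. (indicator (qball (r\<^sup>2)) x * V x) * \<phi> x\<bar> \<le> L * T r" unfolding T_def
    proof (rule weighted_integral_bound[OF \<phi>])
      show "integrable lebesgue (\<lambda>x. indicator (qball (r\<^sup>2)) x * V x * \<phi> x)" using loc_int_integrable[OF V\<phi>, of "r\<^sup>2"] by (simp add: mult.assoc)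
      show "\<bar>indicator (qball (r\<^sup>2)) x * V x\<bar> \<le> L * indicator (qball (r\<^sup>2)) x" for x using VL[of x] by (simp add: indicator_def)
    qed
    then show ?thesis unfolding m_def ball_int_def by (simp add: mult.assoc)
  qed
  have CT: "\<bar>C (r\<^sup>2)\<bar> \<le> r\<^sup>2 * L * T r" for r
  proof -
    have "\<bar>LINT x|lebesgue. (pos_dist (r\<^sup>2) x * V x) * \<phi> x\<bar> \<le> r\<^sup>2 * L * T r" unfolding T_def
    proof (rule weighted_integral_bound[OF \<phi>])
      show "integrable lebesgue (\<lambda>x. pos_dist (r\<^sup>2) x * V x * \<phi> x)" using pos_dist_integrable[OF V\<phi>, of "r\<^sup>2" 0] by (simp add: mult.assoc)
      show "\<bar>pos_dist (r\<^sup>2) x * V x\<bar> \<le> r\<^sup>2 * L * indicator (qball (r\<^sup>2)) x" for x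
      proof (cases "x \<in> qball (r\<^sup>2)")
        case True
        have "\<bar>pos_dist (r\<^sup>2) x\<bar> * \<bar>V x\<bar> \<le> r\<^sup>2 * L" using pos_dist_bound(1)[OF True] VL[of x] by (intro mult_mono) auto
        then show ?thesis using True by (simp add: abs_mult)
      next
        case False
        then show ?thesis using pos_dist_indicator[of "r\<^sup>2" x] by simp
      qed
    qed
    then show ?thesis unfolding C_def dist_int_def by (simp add: mult.assoc)
  qed
  \<comment> \<open>Volume of the unit ball plus the squared L^2 norm; for r >= 1 both contributions
    are covered by the factor r^(k+1).\<close>
  define D where "D = measure lborel (ball (0::'a) 1) + (LINT x|lebesgue. (\<phi> x)\<^sup>2)"
  have TD: "T r \<le> D * r ^ (k + 1)" if r: "1 \<le> r" for r
  proof -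
    have "T r \<le> measure lebesgue (qball (r\<^sup>2) :: 'a set) + (LINT x|lebesgue. (\<phi> x)\<^sup>2)"
      using L2_loc_int(2)[OF L2, of "r\<^sup>2"] unfolding T_def by simp
    also have "measure lebesgue (qball (r\<^sup>2) :: 'a set) = measure lborel (ball (0::'a) 1) * r ^ (k + 1)"
    proof -
      have "(qball (r\<^sup>2) :: 'a set) = ball 0 r" using r unfolding qball_eq by simp
      then show ?thesis using content_ball_conv_unit_ball[of r "0::'a"] r dim by (simp add: measure_completion)
    qed
    finally have "T r \<le> measure lborel (ball (0::'a) 1) * r ^ (k + 1) + (LINT x|lebesgue. (\<phi> x)\<^sup>2)" .
    moreover have "(LINT x|lebesgue. (\<phi> x)\<^sup>2) * 1 \<le> (LINT x|lebesgue. (\<phi> x)\<^sup>2) * r ^ (k + 1)"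
      by (intro mult_left_mono one_le_power r Bochner_Integration.integral_nonneg) simp
    ultimately show ?thesis unfolding D_def distrib_right by linarith
  qed
  have T0: "0 \<le> T r" for r unfolding T_def ball_int_def by (rule Bochner_Integration.integral_nonneg) simp
  have "tempered q"
  proof (rule temperedI[of 1 _ "L * D" "k + 1"])
    fix r :: real assume r: "1 \<le> r"
    have "\<bar>q r\<bar> * 1 \<le> \<bar>q r\<bar> * r ^ k" by (intro mult_left_mono one_le_power r) simp
    also have "\<dots> = \<bar>r ^ k * q r\<bar>" using r by (simp add: abs_mult)
    also have "\<dots> \<le> \<bar>m (r\<^sup>2)\<bar>" using kq[of r] r by simp
    also have "\<dots> \<le> L * T r" by (rule mT)
    also have "\<dots> \<le> L * (D * r ^ (k + 1))" by (rule mult_left_mono[OF TD[OF r] L(1)])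
    finally show "\<bar>q r\<bar> \<le> L * D * r ^ (k + 1)" by simp
  qed
  moreover have "tempered w"
  \<comment> \<open>The exponent is k + 1 from the mass \<open>T\<close> and 2 from the bound r^2 L
    T for C.\<close>
  proof (rule temperedI[of 1 _ "(2 * N + L) * D" "k + 3"])
    fix r :: real assume r: "1 \<le> r"
    have N0: "0 \<le> N" unfolding N_def by simp
    have r2: "1 \<le> r\<^sup>2" using r by simp
    have "\<bar>w r\<bar> * 1 \<le> \<bar>w r\<bar> * r ^ (k + 1)" by (intro mult_left_mono one_le_power r) simp
    also have "\<dots> = \<bar>r ^ (k + 1) * w r\<bar>" using r by (simp add: abs_mult)
    also have "\<dots> \<le> 2 * N * \<bar>M (r\<^sup>2)\<bar> + \<bar>C (r\<^sup>2)\<bar>" unfolding kw[OF less_le_trans[OF zero_less_one r]]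
    proof -
      have "\<bar>2 * N * M (r\<^sup>2)\<bar> = 2 * N * \<bar>M (r\<^sup>2)\<bar>" using N0 by (simp add: abs_mult)
      moreover have "\<bar>(x - y) / 4\<bar> \<le> \<bar>x\<bar> + \<bar>y\<bar>" for x y :: real
        using abs_triangle_ineq4[of x y] by (simp add: abs_divide)
      ultimately show "\<bar>(2 * N * M (r\<^sup>2) - C (r\<^sup>2)) / 4\<bar> \<le> 2 * N * \<bar>M (r\<^sup>2)\<bar> + \<bar>C (r\<^sup>2)\<bar>" by metis
    qed
    also have "\<dots> \<le> 2 * N * T r + r\<^sup>2 * L * T r" using MT[of r] CT[of r] N0 by (intro add_mono mult_left_mono) auto
    also have "2 * N * T r \<le> 2 * N * T r * r\<^sup>2" using mult_left_mono[OF r2, of "2 * N * T r"] N0 T0[of r] by simp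
    finally have "\<bar>w r\<bar> \<le> (2 * N + L) * r\<^sup>2 * T r" by (simp add: algebra_simps)
    also have "\<dots> \<le> (2 * N + L) * r\<^sup>2 * (D * r ^ (k + 1))" using N0 L(1) by (intro mult_left_mono TD r) auto
    also have "\<dots> = (2 * N + L) * D * r ^ (k + 3)" by (simp add: power_add power2_eq_square power3_eq_cube)
    finally show "\<bar>w r\<bar> \<le> (2 * N + L) * D * r ^ (k + 3)" .
  qed
  ultimately show False using lin_sol_not_tempered[OF lin] by simp
qed

theorem positive_radial_solution_unique:
  fixes u1 u2 :: "'a::euclidean_space \<Rightarrow> real"
  assumes nl: "nonlinearity g g' b bt" and dim: "DIM('a) = Suc k" and k: "1 \<le> k"
    and 1: "positive_radial_solution g u1" and 2: "positive_radial_solution g u2"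
  shows "u1 = u2"
proof
  fix x :: 'a
  obtain e :: 'a where e: "e \<in> Basis" using nonempty_Basis by blast
  have "u1 (norm x *\<^sub>R e) = u2 (norm x *\<^sub>R e)"
    by (rule ground_state_unique[OF positive_radial_solution_ground_state(1)[OF nl dim k 1 e]
          positive_radial_solution_ground_state(1)[OF nl dim k 2 e]]) simp
  then show "u1 x = u2 x"
    using positive_radial_solution_ground_state(2)[OF nl dim k 1 e, of x]
      positive_radial_solution_ground_state(2)[OF nl dim k 2 e, of x] by simp
qed

theorem theorem1p1:
  fixes g g' :: "real \<Rightarrow> real" and b :: real and bt :: ereal
  assumes "CARD('n::finite) \<ge> 2"
    and "G1 g g'" and "G2 g g' b bt" and "G3 g b" and "G4 g g' b bt" and "G5 g g' b"
  shows "(\<exists>\<^sub>\<le>\<^sub>1 u :: real ^ 'n \<Rightarrow> real. positive_radial_solution g u) \<and>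
    (\<forall>u :: real ^ 'n \<Rightarrow> real. positive_radial_solution g u \<longrightarrow>
       \<not> eigenvalue_rad (\<lambda>x. g' (u x)) 0)"
proof -
  have nl: "nonlinearity g g' b bt" using assms by unfold_locales
  define k where "k = CARD('n) - 1"
  have k: "1 \<le> k" "DIM(real ^ 'n) = Suc k" using assms(1) unfolding k_def by auto
  show ?thesis
    using positive_radial_solution_unique[OF nl k(2,1)] not_eigenvalue_rad[OF nl k(2,1)]
    unfolding Uniq_def by blast
qed

end
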